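(* Let $\mathrm{k}$ be a field and $S = \mathrm{k}[x_1,\ldots,x_d,y_1,\ldots,y_d]$. For a fixed integer $j$ such that $1 \le j \le d$, let $G_{d,j}$ be the bipartite graph on the vertex set $\{x_1,\ldots,x_d,y_1,\ldots,y_d\}$ whose edge ideal is $$I(G_{d,j}) = (x_i y_i,\; x_1 y_i,\; x_k y_j \mid 1 \le i \le d,\ 1 \le k \le j).$$ Then $$\operatorname{depth} S/I(G_{d,j})^s = \max(1,\, d-j-s+3)$$ for all $s \ge 2$.
   Context: The edge ideal of a graph is the ideal, in the polynomial ring whose variables are the vertices, generated by the products $uv$ over all edges $\{u,v\}$. Depth is taken with respect to the maximal homogeneous ideal $\mathfrak m$ of $S$ (generated by all variables): for a finitely generated graded $S$-module $L$, $\operatorname{depth}(L) = \min\{i \mid H^i_{\mathfrak m}(L)\ne 0\}$, where $H^i_{\mathfrak m}(L)$ denotes the $i$-th local cohomology module of $L$ with respect to $\mathfrak m$.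
   Formalization: For j = 1 the formula is proved only when s > d: for d ≥ 2 the graphs G_{d,1} and G_{d,2} coincide, so for j = 1 and 2 ≤ s ≤ d the stated value is false (e.g. d = 2, j = 1, s = 2 has depth 1, not 2); the depth there is the j = 2 value. *)

theory Defs
  imports "HOL-Algebra.Module" "HOL-Algebra.Ideal_Product" "HOL-Library.Poly_Mapping"
begin

section \<open>Modules over a commutative ring\<close>

definition ring_module :: "('a, 'r) ring_scheme \<Rightarrow> ('a, 'a) module" where
  "ring_module R = \<lparr>carrier = carrier R, mult = mult R, one = one R, zero = zero R,
     add = add R, smult = mult R\<rparr>"

text \<open>A module record inherits the fields \<open>mult\<close> and \<open>one\<close> from \<open>ring\<close>; the locale \<open>module\<close>
  does not constrain them.  On cosets, scalar multiplication is given as a union over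
  representatives, in the style of \<open>rcoset_mult\<close>.\<close>

definition quot_module :: "('a, 'm) module \<Rightarrow> 'm set \<Rightarrow> ('a, 'm set) module" where
  "quot_module M N = \<lparr>carrier = a_rcosets\<^bsub>M\<^esub> N, mult = undefined, one = undefined, zero = N,
     add = set_add M, smult = (\<lambda>a C. \<Union>x\<in>C. N +>\<^bsub>M\<^esub> (a \<odot>\<^bsub>M\<^esub> x))\<rparr>"

definition module_hom ::
    "('a, 'r) ring_scheme \<Rightarrow> ('a, 'm) module \<Rightarrow> ('a, 'n) module \<Rightarrow> ('m \<Rightarrow> 'n) set" where
  "module_hom R M N = {f \<in> carrier M \<rightarrow> carrier N.
     (\<forall>x\<in>carrier M. \<forall>y\<in>carrier M. f (x \<oplus>\<^bsub>M\<^esub> y) = f x \<oplus>\<^bsub>N\<^esub> f y) \<and>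
     (\<forall>a\<in>carrier R. \<forall>x\<in>carrier M. f (a \<odot>\<^bsub>M\<^esub> x) = a \<odot>\<^bsub>N\<^esub> f x)}"


section \<open>Local cohomology and depth\<close>

text \<open>A definition cannot quantify over all types, so the test modules \<open>N\<close> have their elements
  in the type of ring elements.  These include \<open>R\<close> itself with its ideals as submodules, hence by
  Baer's criterion this is injectivity with respect to all \<open>R\<close>-modules.\<close>

definition injective_module :: "('a, 'r) ring_scheme \<Rightarrow> ('a, 'm) module \<Rightarrow> bool" where
  "injective_module R E \<longleftrightarrow> module R E \<and>
     (\<forall>(N :: ('a, 'a) module) M f.
        module R N \<longrightarrow> submodule M R N \<longrightarrow> f \<in> module_hom R (N\<lparr>carrier := M\<rparr>) E \<longrightarrow>
        (\<exists>g \<in> module_hom R N E. \<forall>x\<in>M. g x = f x))"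

definition injective_resolution ::
    "('a, 'r) ring_scheme \<Rightarrow> ('a, 'l) module \<Rightarrow> (nat \<Rightarrow> ('a, 'e) module) \<Rightarrow>
     (nat \<Rightarrow> 'e \<Rightarrow> 'e) \<Rightarrow> ('l \<Rightarrow> 'e) \<Rightarrow> bool" where
  "injective_resolution R L E \<delta> \<epsilon> \<longleftrightarrow>
     (\<forall>i. injective_module R (E i)) \<and>
     (\<forall>i. \<delta> i \<in> module_hom R (E i) (E (Suc i))) \<and>
     \<epsilon> \<in> module_hom R L (E 0) \<and>
     inj_on \<epsilon> (carrier L) \<and>
     \<epsilon> ` carrier L = a_kernel (E 0) (E 1) (\<delta> 0) \<and>
     (\<forall>i. \<delta> i ` carrier (E i) = a_kernel (E (Suc i)) (E (Suc (Suc i))) (\<delta> (Suc i)))"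

text \<open>The functor \<open>\<Gamma>\<^sub>I\<close>: the elements annihilated by some power of \<open>I\<close>.\<close>

definition torsion :: "('a, 'r) ring_scheme \<Rightarrow> 'a set \<Rightarrow> ('a, 'm) module \<Rightarrow> 'm set" where
  "torsion R I M = {x \<in> carrier M.
     \<exists>n::nat. \<forall>a \<in> I [^]\<^bsub>ideals_set R\<^esub> n. a \<odot>\<^bsub>M\<^esub> x = \<zero>\<^bsub>M\<^esub>}"

text \<open>The \<open>i\<close>-th cohomology module of the complex \<open>\<Gamma>\<^sub>I(E 0) \<rightarrow> \<Gamma>\<^sub>I(E 1) \<rightarrow> \<dots>\<close>.\<close>

definition torsion_cohomology ::
    "('a, 'r) ring_scheme \<Rightarrow> 'a set \<Rightarrow> (nat \<Rightarrow> ('a, 'e) module) \<Rightarrow> (nat \<Rightarrow> 'e \<Rightarrow> 'e) \<Rightarrow>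
     nat \<Rightarrow> ('a, 'e set) module" where
  "torsion_cohomology R I E \<delta> i =
     quot_module
       ((E i)\<lparr>carrier := torsion R I (E i) \<inter> a_kernel (E i) (E (Suc i)) (\<delta> i)\<rparr>)
       (case i of 0 \<Rightarrow> {\<zero>\<^bsub>E 0\<^esub>} | Suc k \<Rightarrow> \<delta> k ` torsion R I (E k))"

text \<open>Local cohomology as the right derived functors of \<open>\<Gamma>\<^sub>I\<close>, computed from a chosen injective
  resolution.  The type \<open>'a list \<Rightarrow> 'l\<close> is large enough to contain an injective resolution of every
  \<open>R\<close>-module \<open>L\<close>: if \<open>'l\<close> has at least two elements, its cardinality \<open>\<kappa>\<close> satisfies
  \<open>\<kappa> = \<kappa>\<^sup>\<mu>\<close> for \<open>\<mu> = max |R| \<aleph>\<^sub>0\<close>, a module of size at most \<open>\<kappa>\<close> embeds into a divisible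
  group \<open>D\<close> of size at most \<open>\<kappa>\<close>, and hence into the injective module of additive maps
  \<open>R \<rightarrow> D\<close>, again of size at most \<open>\<kappa>\<close>; otherwise \<open>L = 0\<close>.\<close>

definition local_cohomology ::
    "('a, 'r) ring_scheme \<Rightarrow> 'a set \<Rightarrow> ('a, 'l) module \<Rightarrow> nat \<Rightarrow>
     ('a, ('a list \<Rightarrow> 'l) set) module" where
  "local_cohomology R I L i =
     (case (SOME (E, \<delta>, \<epsilon>). injective_resolution R L E \<delta> \<epsilon>) of
       (E, \<delta>, \<epsilon>) \<Rightarrow> torsion_cohomology R I E \<delta> i)"

definition depth :: "('a, 'r) ring_scheme \<Rightarrow> 'a set \<Rightarrow> ('a, 'l) module \<Rightarrow> nat" where
  "depth R I L =
     (LEAST i. carrier (local_cohomology R I L i) \<noteq> {\<zero>\<^bsub>local_cohomology R I L i\<^esub>})"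


section \<open>Polynomial rings and edge ideals\<close>

text \<open>Polynomials with coefficients in \<open>'k\<close> and variables in \<open>V\<close>, as finitely supported functions on
  monomials, which are in turn finitely supported exponent functions.\<close>

definition mpoly_ring :: "'v set \<Rightarrow> (('v \<Rightarrow>\<^sub>0 nat) \<Rightarrow>\<^sub>0 'k::field) ring" where
  "mpoly_ring V = \<lparr>carrier = {p. \<forall>m\<in>Poly_Mapping.keys p. Poly_Mapping.keys m \<subseteq> V}, mult = (*), one = 1, zero = 0, add = (+)\<rparr>"

definition mvar :: "'v \<Rightarrow> ('v \<Rightarrow>\<^sub>0 nat) \<Rightarrow>\<^sub>0 'k::field" where
  "mvar v = Poly_Mapping.single (Poly_Mapping.single v 1) 1"

definition max_hom_ideal :: "'v set \<Rightarrow> (('v \<Rightarrow>\<^sub>0 nat) \<Rightarrow>\<^sub>0 'k::field) set" where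
  "max_hom_ideal V = Idl\<^bsub>mpoly_ring V\<^esub> (mvar ` V)"

text \<open>The edge ideal of the simple graph with vertex set \<open>V\<close> and edge set \<open>E\<close>, whose elements
  are two-element subsets of \<open>V\<close>.\<close>

definition edge_ideal :: "'v set \<Rightarrow> 'v set set \<Rightarrow> (('v \<Rightarrow>\<^sub>0 nat) \<Rightarrow>\<^sub>0 'k::field) set" where
  "edge_ideal V E = Idl\<^bsub>mpoly_ring V\<^esub> {mvar u * mvar v | u v. {u, v} \<in> E}"


section \<open>The graphs\<close>

datatype vertex = Xv nat | Yv nat

definition G_verts :: "nat \<Rightarrow> vertex set" where
  "G_verts d = Xv ` {1..d} \<union> Yv ` {1..d}"

definition G_edges :: "nat \<Rightarrow> nat \<Rightarrow> vertex set set" where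
  "G_edges d j = {{Xv i, Yv i} | i. i \<in> {1..d}} \<union> {{Xv 1, Yv i} | i. i \<in> {1..d}}
     \<union> {{Xv k, Yv j} | k. k \<in> {1..j}}"

lemma G_edges_bipartite:
  assumes "1 \<le> j" "j \<le> d" "e \<in> G_edges d j"
  shows "\<exists>u\<in>Xv ` {1..d}. \<exists>v\<in>Yv ` {1..d}. e = {u, v}"
proof -
  have d: "1 \<in> {1..d}" "j \<in> {1..d}" and le: "\<And>k. k \<in> {1..j} \<Longrightarrow> k \<in> {1..d}"
    using assms(1,2) by auto
  show ?thesis
    using assms(3) d le unfolding G_edges_def by blast
qed

lemma edge_ideal_G_eq:
  "(edge_ideal (G_verts d) (G_edges d j) :: ((vertex \<Rightarrow>\<^sub>0 nat) \<Rightarrow>\<^sub>0 'k::field) set) =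
     Idl\<^bsub>mpoly_ring (G_verts d)\<^esub>
       ({mvar (Xv i) * mvar (Yv i) | i. i \<in> {1..d}} \<union> {mvar (Xv 1) * mvar (Yv i) | i. i \<in> {1..d}}
         \<union> {mvar (Xv k) * mvar (Yv j) | k. k \<in> {1..j}})"
proof -
  have "{mvar u * mvar v | u v. {u, v} \<in> G_edges d j} =
      {mvar (Xv i) * mvar (Yv i) | i. i \<in> {1..d}} \<union> {mvar (Xv 1) * mvar (Yv i) | i. i \<in> {1..d}}
         \<union> {mvar (Xv k) * mvar (Yv j) :: (vertex \<Rightarrow>\<^sub>0 nat) \<Rightarrow>\<^sub>0 'k | k. k \<in> {1..j}}"
    unfolding G_edges_def by (auto simp: doubleton_eq_iff mult.commute; metis mult.commute)
  thus ?thesis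
    unfolding edge_ideal_def by simp
qed

text \<open>For \<open>d \<ge> 2\<close> the values \<open>j = 1\<close> and \<open>j = 2\<close> give the same graph, but
  \<open>max 1 (d - j - s + 3)\<close> takes different values for them when \<open>s \<le> d\<close>.  The depth is
  then the value for \<open>j = 2\<close>, so the case \<open>j = 1\<close>, \<open>s \<le> d\<close> has to be excluded.\<close>

lemma G_edges_1_eq_2:
  assumes "2 \<le> d"
  shows "G_edges d 1 = G_edges d 2"
proof -
  have "{k::nat. k \<in> {1..2}} = {1, 2}" by auto
  hence k: "\<And>k::nat. k \<in> {1..2} \<longleftrightarrow> k = 1 \<or> k = 2" by auto
  have d: "1 \<in> {1..d}" "2 \<in> {1..d}" using assms by auto
  show ?thesis
    unfolding G_edges_def k using d by (auto 4 3)
qed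

end

(*
  The depth is computed from Koszul cohomology. An injective module E over S has no Koszul
  cohomology in positive degree, so dimension shifting along an injective resolution of L turns
  the vanishing of the Koszul cohomology of L in degree i into exactness of the socles of the
  resolution at i; filtering S/m^n by copies of S/m, this gives the same least nonvanishing degree
  as local cohomology. The required resolution is built from the coinduced modules Hom_k(S, M).

  Lower bound: for monomial f and a monomial ideal J, the Koszul cohomology of S/J
  vanishes wherever that of S/(J : f) and S/(J, f) does. Write a = x_1 and b = y_j. If x is a leaf
  at y, or more generally if all neighbours of x are adjacent to all neighbours of y, then
  I^(s+1) : xy = I^s. For each of the d - j paths a - y_i - x_i with i > j, taking colons by
  x_i y_i, by y_i and by a reduces to smaller powers or to induced subgraphs, and a free variable
  raises the depth by one.

  Upper bound: with r = min (d - j) (s - 2) and f = (ab)^(s-1-r) * prod_(j < i <= j+r) a y_i, the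
  ideal I^s : f contains all products of X' = {x_1, ..., x_(j+r)} with {y_1, ..., y_d} but no
  variable of either set, so the monomials outside it form a disconnected complex; together with the
  remaining d - j - r variables x_i this gives a nonzero class in degree d - j - r + 1.
*)
theory Submission
  imports Defs
begin

section \<open>Monomial ideals\<close>

text \<open>Depth is read off a resolution picked by \<open>SOME\<close>, so the argument has to
  work for every injective resolution. The Koszul complex sees only the socles of its terms, whereas
  depth concerns torsion, and a nonzero socle class may become the boundary of a torsion element. It
  cannot do so in the least degree with a nonzero class, so vanishing in all lower degrees is needed
  before a single class fixes the depth.

  The number s - 2 in the upper bound comes from degrees. A product f of s - 1 edges has degree s -
  1 in the x's and in the y's, hence no variable times f lies in I^s. One of the factors has to be
  ab, because b is what ties x_2, ..., x_j to the rest; each of the other s - 2 factors can bring in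
  one further x_i.

  In the lower bound a step may use up a path only if it also lowers s or frees a variable. The last
  stage counts x_1 and x_j, and likewise y_1 and y_j, as different vertices, so it requires j \<ge>
  2; for j = 1 the hypothesis d < s makes the value 1, and positive depth suffices.\<close>

type_synonym 'v monomial = "'v \<Rightarrow>\<^sub>0 nat"
type_synonym ('v, 'k) mpoly = "('v \<Rightarrow>\<^sub>0 nat) \<Rightarrow>\<^sub>0 'k"

abbreviation "keys \<equiv> Poly_Mapping.keys"
abbreviation "lookup \<equiv> Poly_Mapping.lookup"

abbreviation xpow :: "'v monomial \<Rightarrow> ('v, 'k::field) mpoly"
  where "xpow m \<equiv> Poly_Mapping.single m 1"

abbreviation var :: "'v \<Rightarrow> 'v monomial" where "var v \<equiv> Poly_Mapping.single v 1"

text \<open>An ideal generated by monomials is recorded by its exponent set, so that colons, sums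
  and products become operations on upsets. \<open>U\<close> ranges over all monomials and only its
  part supported in \<open>V\<close> matters; \<open>U = UNIV\<close> gives the whole ring.\<close>

definition mon_ideal :: "'v set \<Rightarrow> 'v monomial set \<Rightarrow> ('v, 'k::field) mpoly set" where
  "mon_ideal V U = {p. \<forall>m\<in>keys p. keys m \<subseteq> V \<and> m \<in> U}"

definition upset :: "'v monomial set \<Rightarrow> bool" where
  "upset U \<longleftrightarrow> (\<forall>m\<in>U. \<forall>r. r + m \<in> U)"

lemma keys_add_nat: "keys (m + n) = keys m \<union> keys (n :: 'v monomial)"
  by (auto simp: in_keys_iff lookup_add)

lemma carrier_mpoly_ring: "carrier (mpoly_ring V) = mon_ideal V UNIV"
  by (simp add: mpoly_ring_def mon_ideal_def)

lemma mpoly_ring_sel [simp]: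
  "mult (mpoly_ring V) = (*)" "one (mpoly_ring V) = 1"
  "zero (mpoly_ring V) = 0" "add (mpoly_ring V) = (+)"
  by (simp_all add: mpoly_ring_def)

lemma mon_ideal_zero [simp]: "0 \<in> mon_ideal V U"
  by (simp add: mon_ideal_def)

lemma mon_ideal_add: "p \<in> mon_ideal V U \<Longrightarrow> q \<in> mon_ideal V U \<Longrightarrow> p + q \<in> mon_ideal V U"
  using keys_add[of p q] by (auto simp: mon_ideal_def)

lemma mon_ideal_uminus: "p \<in> mon_ideal V U \<Longrightarrow> - p \<in> mon_ideal V U"
  by (simp add: mon_ideal_def in_keys_iff)

lemma mon_ideal_diff: "p \<in> mon_ideal V U \<Longrightarrow> q \<in> mon_ideal V U \<Longrightarrow> p - q \<in> mon_ideal V U"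
  using mon_ideal_add[of p V U "- q"] mon_ideal_uminus[of q V U] by simp

lemma mon_ideal_sum: "(\<And>i. i \<in> I \<Longrightarrow> f i \<in> mon_ideal V U) \<Longrightarrow> (\<Sum>i\<in>I. f i) \<in> mon_ideal V U"
  by (induction I rule: infinite_finite_induct) (auto intro: mon_ideal_add)

lemma mon_ideal_mult:
  assumes "upset U" "p \<in> mon_ideal V UNIV" "q \<in> mon_ideal V U"
  shows "p * q \<in> mon_ideal V U"
  using keys_mult[of p q] assms by (fastforce simp: mon_ideal_def upset_def keys_add_nat)

lemma upset_UNIV [simp]: "upset UNIV"
  by (simp add: upset_def)

lemma mon_ideal_mono: "U \<subseteq> U' \<Longrightarrow> mon_ideal V U \<subseteq> mon_ideal V U'"
  by (auto simp: mon_ideal_def)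

lemma mon_in_mon_ideal_iff:
  "Poly_Mapping.single m (c :: 'k::field) \<in> mon_ideal V U \<longleftrightarrow> c = 0 \<or> keys m \<subseteq> V \<and> m \<in> U"
  by (simp add: mon_ideal_def)

lemma one_in_mon_ideal_iff: "1 \<in> mon_ideal V U \<longleftrightarrow> 0 \<in> U"
  by (simp add: mon_ideal_def)

lemma poly_mapping_sum_single: "(\<Sum>m\<in>keys p. Poly_Mapping.single m (lookup p m)) = p"
  by (rule poly_mapping_eqI) (simp add: lookup_sum lookup_single when_def in_keys_iff)

lemma cring_mpoly_ring: "cring (mpoly_ring V)"
proof (rule cringI)
  show "abelian_group (mpoly_ring V)"
  proof (rule abelian_groupI)
    fix x assume "x \<in> carrier (mpoly_ring V)"
    then have "- x \<in> carrier (mpoly_ring V)" "- x + x = 0"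
      by (auto simp: carrier_mpoly_ring mon_ideal_uminus)
    then show "\<exists>y\<in>carrier (mpoly_ring V). y \<oplus>\<^bsub>mpoly_ring V\<^esub> x = \<zero>\<^bsub>mpoly_ring V\<^esub>"
      unfolding mpoly_ring_sel by blast
  qed (auto simp: carrier_mpoly_ring mon_ideal_add add_ac)
  show "comm_monoid (mpoly_ring V)"
    by (rule comm_monoidI)
      (auto simp: carrier_mpoly_ring mon_ideal_mult one_in_mon_ideal_iff mult_ac)
qed (auto simp: distrib_right)

lemma a_inv_mpoly_ring:
  assumes "p \<in> carrier (mpoly_ring V)"
  shows "\<ominus>\<^bsub>mpoly_ring V\<^esub> p = - p"
proof -
  interpret cring "mpoly_ring V" by (rule cring_mpoly_ring)
  show ?thesis
    by (rule minus_equality) (use assms in \<open>auto simp: carrier_mpoly_ring mon_ideal_uminus\<close>)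
qed

lemma ideal_mon_ideal:
  assumes "upset U"
  shows "ideal (mon_ideal V U) (mpoly_ring V)"
proof (rule idealI)
  interpret cring "mpoly_ring V" by (rule cring_mpoly_ring)
  show "ring (mpoly_ring V)" ..
  have *: "mon_ideal V U \<subseteq> carrier (mpoly_ring V)"
    by (simp add: carrier_mpoly_ring mon_ideal_mono)
  show "subgroup (mon_ideal V U) (add_monoid (mpoly_ring V))"
  proof (rule add.subgroupI)
    show "mon_ideal V U \<subseteq> carrier (mpoly_ring V)" by fact
    show "mon_ideal V U \<noteq> {}" using mon_ideal_zero by blast
    show "\<ominus>\<^bsub>mpoly_ring V\<^esub> a \<in> mon_ideal V U" if "a \<in> mon_ideal V U" for a
      using that * by (auto simp: a_inv_mpoly_ring mon_ideal_uminus)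
  qed (auto simp: mon_ideal_add)
  show "p \<otimes>\<^bsub>mpoly_ring V\<^esub> q \<in> mon_ideal V U" "q \<otimes>\<^bsub>mpoly_ring V\<^esub> p \<in> mon_ideal V U"
    if "q \<in> mon_ideal V U" "p \<in> carrier (mpoly_ring V)" for p q
    using mon_ideal_mult[OF assms, of p V q] that by (simp_all add: carrier_mpoly_ring mult.commute)
qed

section \<open>Products, powers and generators of monomial ideals\<close>

definition sumset :: "'v monomial set \<Rightarrow> 'v monomial set \<Rightarrow> 'v monomial set" where
  "sumset A B = {a + b | a b. a \<in> A \<and> b \<in> B}"

lemma upset_sumset: "upset A \<Longrightarrow> upset (sumset A B)"
  by (fastforce simp: upset_def sumset_def add.assoc[symmetric])

text \<open>Exponents are natural numbers, so nothing cancels in \<open>m = a + b\<close>: both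
  summands are supported in \<open>V\<close> as soon as \<open>m\<close> is. Every term of an
  element thus factors inside the ring.\<close>

lemma ideal_prod_mon_ideal:
  assumes "upset A" "upset B"
  shows "ideal_prod (mpoly_ring V) (mon_ideal V A) (mon_ideal V B)
    = (mon_ideal V (sumset A B) :: ('v, 'k::field) mpoly set)"
proof
  show "ideal_prod (mpoly_ring V) (mon_ideal V A) (mon_ideal V B) \<subseteq>
    (mon_ideal V (sumset A B) :: ('v, 'k) mpoly set)"
  proof
    fix p :: "('v, 'k) mpoly" assume "p \<in> ideal_prod (mpoly_ring V) (mon_ideal V A) (mon_ideal V B)"
    then show "p \<in> mon_ideal V (sumset A B)"
    proof induction
      case (prod p q)
      then show ?case
        using keys_mult[of p q] by (fastforce simp: mon_ideal_def sumset_def keys_add_nat)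
    qed (simp add: mon_ideal_add)
  qed
  have *: "finite M \<Longrightarrow> (\<And>m. m \<in> M \<Longrightarrow> keys m \<subseteq> V \<and> m \<in> sumset A B) \<Longrightarrow>
     (\<Sum>m\<in>M. Poly_Mapping.single m (c m)) \<in> ideal_prod (mpoly_ring V) (mon_ideal V A) (mon_ideal V B)"
    for M and c :: "_ \<Rightarrow> 'k"
  proof (induction M rule: finite_induct)
    case empty
    have "0 * (0 :: ('v, 'k) mpoly) \<in> ideal_prod (mpoly_ring V) (mon_ideal V A) (mon_ideal V B)"
      using ideal_prod.prod[of 0 "mon_ideal V A" 0 "mon_ideal V B" "mpoly_ring V"] by simp
    then show ?case by simp
  next
    case (insert m M)
    obtain a b where ab: "m = a + b" "a \<in> A" "b \<in> B" "keys a \<subseteq> V" "keys b \<subseteq> V"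
      using insert.prems[of m] by (auto simp: sumset_def keys_add_nat)
    have "xpow a * Poly_Mapping.single b (c m) \<in> ideal_prod (mpoly_ring V) (mon_ideal V A) (mon_ideal V B)"
      using ideal_prod.prod[of "xpow a" "mon_ideal V A" "Poly_Mapping.single b (c m)" "mon_ideal V B" "mpoly_ring V"] ab
      by (auto simp: mon_in_mon_ideal_iff)
    then have "Poly_Mapping.single m (c m) \<in> ideal_prod (mpoly_ring V) (mon_ideal V A) (mon_ideal V B)"
      by (simp add: mult_single ab)
    from ideal_prod.sum[OF this insert.IH] insert.prems show ?case
      using insert.hyps by simp
  qed
  show "(mon_ideal V (sumset A B) :: ('v, 'k) mpoly set) \<subseteq> ideal_prod (mpoly_ring V) (mon_ideal V A) (mon_ideal V B)"
  proof
    fix p :: "('v, 'k) mpoly" assume "p \<in> mon_ideal V (sumset A B)"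
    then show "p \<in> ideal_prod (mpoly_ring V) (mon_ideal V A) (mon_ideal V B)"
      using *[of "keys p" "lookup p"] by (auto simp: poly_mapping_sum_single mon_ideal_def)
  qed
qed

fun powset :: "'v monomial set \<Rightarrow> nat \<Rightarrow> 'v monomial set" where
  "powset U 0 = UNIV"
| "powset U (Suc n) = sumset (powset U n) U"

lemma upset_powset: "upset (powset U n)"
  by (induction n) (simp_all add: upset_sumset)

lemma ideal_power_mon_ideal:
  assumes "upset U"
  shows "(mon_ideal V U :: ('v, 'k::field) mpoly set) [^]\<^bsub>ideals_set (mpoly_ring V)\<^esub> n
    = mon_ideal V (powset U n)"
proof (induction n)
  case 0
  show ?case by (simp add: nat_pow_def ideals_set_def carrier_mpoly_ring)
next
  case (Suc n)
  have "(mon_ideal V U :: ('v, 'k) mpoly set) [^]\<^bsub>ideals_set (mpoly_ring V)\<^esub> Suc n =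
    ideal_prod (mpoly_ring V) (mon_ideal V U [^]\<^bsub>ideals_set (mpoly_ring V)\<^esub> n) (mon_ideal V U)"
    by (simp add: nat_pow_def ideals_set_def)
  also have "\<dots> = mon_ideal V (powset U (Suc n))"
    by (simp only: Suc ideal_prod_mon_ideal[OF upset_powset assms] powset.simps)
  finally show ?case .
qed

definition up_closure :: "'v monomial set \<Rightarrow> 'v monomial set" where
  "up_closure G = {r + g | r g. g \<in> G}"

lemma upset_up_closure: "upset (up_closure G)"
  by (fastforce simp: upset_def up_closure_def add.assoc[symmetric])

lemma genideal_mon:
  assumes "\<And>g. g \<in> G \<Longrightarrow> keys g \<subseteq> V"
  shows "Idl\<^bsub>mpoly_ring V\<^esub> (xpow ` G) = (mon_ideal V (up_closure G) :: ('v, 'k::field) mpoly set)"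
proof
  interpret cring "mpoly_ring V :: ('v, 'k) mpoly ring" by (rule cring_mpoly_ring)
  have "g \<in> up_closure G" if "g \<in> G" for g
    using that add_0[of g] unfolding up_closure_def by (metis (mono_tags, lifting) mem_Collect_eq)
  then have "(xpow ` G :: ('v, 'k) mpoly set) \<subseteq> mon_ideal V (up_closure G)"
    using assms by (auto simp: mon_in_mon_ideal_iff)
  then show "Idl\<^bsub>mpoly_ring V\<^esub> (xpow ` G) \<subseteq> (mon_ideal V (up_closure G) :: ('v, 'k) mpoly set)"
    by (intro genideal_minimal ideal_mon_ideal upset_up_closure)
  have sub: "(xpow ` G :: ('v, 'k) mpoly set) \<subseteq> carrier (mpoly_ring V)"
    using assms by (auto simp: mon_in_mon_ideal_iff carrier_mpoly_ring)
  interpret I: ideal "Idl\<^bsub>mpoly_ring V\<^esub> (xpow ` G) :: ('v, 'k) mpoly set" "mpoly_ring V"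
    by (rule genideal_ideal[OF sub])
  have *: "finite M \<Longrightarrow> (\<And>m. m \<in> M \<Longrightarrow> keys m \<subseteq> V \<and> m \<in> up_closure G) \<Longrightarrow>
     (\<Sum>m\<in>M. Poly_Mapping.single m (c m)) \<in> Idl\<^bsub>mpoly_ring V\<^esub> (xpow ` G)"
    for M and c :: "_ \<Rightarrow> 'k"
  proof (induction M rule: finite_induct)
    case empty
    show ?case using I.zero_closed by simp
  next
    case (insert m M)
    obtain r g where rg: "m = r + g" "g \<in> G" "keys r \<subseteq> V"
      using insert.prems[of m] by (auto simp: up_closure_def keys_add_nat)
    have "Poly_Mapping.single r (c m) * xpow g \<in> Idl\<^bsub>mpoly_ring V\<^esub> (xpow ` G)"
      using I.I_l_closed[of "xpow g" "Poly_Mapping.single r (c m)"] rg genideal_self[OF sub]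
      by (auto simp: carrier_mpoly_ring mon_in_mon_ideal_iff)
    then have "Poly_Mapping.single m (c m) \<in> Idl\<^bsub>mpoly_ring V\<^esub> (xpow ` G)"
      by (simp add: mult_single rg)
    from I.a_closed[OF this insert.IH] insert.prems show ?case
      using insert.hyps by simp
  qed
  show "mon_ideal V (up_closure G) \<subseteq> (Idl\<^bsub>mpoly_ring V\<^esub> (xpow ` G) :: ('v, 'k) mpoly set)"
  proof
    fix p :: "('v, 'k) mpoly" assume "p \<in> mon_ideal V (up_closure G)"
    then show "p \<in> Idl\<^bsub>mpoly_ring V\<^esub> (xpow ` G)"
      using *[of "keys p" "lookup p"] by (auto simp: poly_mapping_sum_single mon_ideal_def)
  qed
qed

lemma mvar_mult_eq: "mvar u * mvar v = xpow (var u + var v)"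
  by (simp add: mvar_def mult_single)

lemma edge_ideal_eq_mon_ideal:
  assumes "\<And>e. e \<in> E \<Longrightarrow> e \<subseteq> V"
  shows "(edge_ideal V E :: ('v, 'k::field) mpoly set) =
    mon_ideal V (up_closure {var u + var v | u v. {u, v} \<in> E})"
proof -
  have "{mvar u * mvar v :: ('v, 'k) mpoly | u v. {u, v} \<in> E} = xpow ` {var u + var v | u v. {u, v} \<in> E}"
    unfolding mvar_mult_eq by blast
  then show ?thesis
    unfolding edge_ideal_def using assms
    by (simp only:) (rule genideal_mon, auto simp: keys_add_nat dest: assms)
qed

lemma max_hom_ideal_eq_mon_ideal: "(max_hom_ideal V :: ('v, 'k::field) mpoly set) = mon_ideal V (up_closure (var ` V))"
proof -
  have "(mvar ` V :: ('v, 'k) mpoly set) = xpow ` var ` V"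
    unfolding image_image mvar_def ..
  then show ?thesis
    unfolding max_hom_ideal_def by (simp only:) (rule genideal_mon, auto)
qed

section \<open>Existence of injective resolutions\<close>

lemma module_homI:
  assumes "\<And>x. x \<in> carrier M \<Longrightarrow> f x \<in> carrier N"
    and "\<And>x y. x \<in> carrier M \<Longrightarrow> y \<in> carrier M \<Longrightarrow> f (x \<oplus>\<^bsub>M\<^esub> y) = f x \<oplus>\<^bsub>N\<^esub> f y"
    and "\<And>a x. a \<in> carrier R \<Longrightarrow> x \<in> carrier M \<Longrightarrow> f (a \<odot>\<^bsub>M\<^esub> x) = a \<odot>\<^bsub>N\<^esub> f x"
  shows "f \<in> module_hom R M N"
  using assms by (simp add: module_hom_def)

lemma module_homD:
  assumes "f \<in> module_hom R M N"
  shows "x \<in> carrier M \<Longrightarrow> f x \<in> carrier N"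
    and "x \<in> carrier M \<Longrightarrow> y \<in> carrier M \<Longrightarrow> f (x \<oplus>\<^bsub>M\<^esub> y) = f x \<oplus>\<^bsub>N\<^esub> f y"
    and "a \<in> carrier R \<Longrightarrow> x \<in> carrier M \<Longrightarrow> f (a \<odot>\<^bsub>M\<^esub> x) = a \<odot>\<^bsub>N\<^esub> f x"
  using assms by (auto simp: module_hom_def)

lemma module_hom_zero:
  assumes "module R M" "module R N" "f \<in> module_hom R M N"
  shows "f \<zero>\<^bsub>M\<^esub> = \<zero>\<^bsub>N\<^esub>"
proof -
  interpret M: module R M by fact
  interpret N: module R N by fact
  have "f (\<zero>\<^bsub>R\<^esub> \<odot>\<^bsub>M\<^esub> \<zero>\<^bsub>M\<^esub>) = \<zero>\<^bsub>R\<^esub> \<odot>\<^bsub>N\<^esub> f \<zero>\<^bsub>M\<^esub>"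
    by (rule module_homD(3)[OF assms(3)]) auto
  then show ?thesis using module_homD(1)[OF assms(3), of "\<zero>\<^bsub>M\<^esub>"] by simp
qed

lemma module_hom_uminus:
  assumes "module R M" "module R N" "f \<in> module_hom R M N" "x \<in> carrier M"
  shows "f (\<ominus>\<^bsub>M\<^esub> x) = \<ominus>\<^bsub>N\<^esub> f x"
proof -
  interpret M: module R M by fact
  interpret N: module R N by fact
  have "f (\<ominus>\<^bsub>R\<^esub> \<one>\<^bsub>R\<^esub> \<odot>\<^bsub>M\<^esub> x) = \<ominus>\<^bsub>R\<^esub> \<one>\<^bsub>R\<^esub> \<odot>\<^bsub>N\<^esub> f x"
    using module_homD(3)[OF assms(3)] assms(4) by simp
  then show ?thesis
    using module_homD(1)[OF assms(3,4)] assms(4) by (simp add: M.smult_l_minus N.smult_l_minus)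
qed

lemma module_hom_minus:
  assumes "module R M" "module R N" "f \<in> module_hom R M N" "x \<in> carrier M" "y \<in> carrier M"
  shows "f (x \<ominus>\<^bsub>M\<^esub> y) = f x \<ominus>\<^bsub>N\<^esub> f y"
proof -
  interpret M: module R M by fact
  interpret N: module R N by fact
  show ?thesis
    using module_homD(2)[OF assms(3)] assms(4,5) module_hom_uminus[OF assms(1-3)]
    by (simp add: a_minus_def)
qed

lemma submodule_zero:
  assumes "submodule H R M"
  shows "\<zero>\<^bsub>M\<^esub> \<in> H"
  using submodule.axioms(1)[OF assms] subgroup.one_closed by fastforce

lemma submodule_image:
  assumes M: "module R M" and N: "module R N" and f: "f \<in> module_hom R M N" and H: "submodule H R M"
  shows "submodule (f ` H) R N"
proof -
  interpret M: module R M by fact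
  interpret N: module R N by fact
  note sub = M.submoduleE[OF H]
  have z: "\<zero>\<^bsub>M\<^esub> \<in> H" by (rule submodule_zero[OF H])
  show ?thesis
  proof (rule N.submoduleI)
    show "f ` H \<subseteq> carrier N" using module_homD(1)[OF f] sub(1) by blast
    show "\<zero>\<^bsub>N\<^esub> \<in> f ` H" using module_hom_zero[OF M N f] z by (metis imageI)
    show "\<ominus>\<^bsub>N\<^esub> a \<in> f ` H" if "a \<in> f ` H" for a
      using that module_hom_uminus[OF M N f] sub(1,3) by (auto simp flip: module_hom_uminus[OF M N f])
    show "a \<oplus>\<^bsub>N\<^esub> b \<in> f ` H" if ab: "a \<in> f ` H" "b \<in> f ` H" for a b
    proof -
      obtain x y where "x \<in> H" "y \<in> H" "a = f x" "b = f y" using ab by blast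
      then have "x \<oplus>\<^bsub>M\<^esub> y \<in> H" "a \<oplus>\<^bsub>N\<^esub> b = f (x \<oplus>\<^bsub>M\<^esub> y)"
        using sub(5) module_homD(2)[OF f, of x y] subsetD[OF sub(1)] by auto
      then show ?thesis by blast
    qed
    show "a \<odot>\<^bsub>N\<^esub> b \<in> f ` H" if ab: "a \<in> carrier R" "b \<in> f ` H" for a b
    proof -
      obtain x where "x \<in> H" "b = f x" using ab by blast
      then have "a \<odot>\<^bsub>M\<^esub> x \<in> H" "a \<odot>\<^bsub>N\<^esub> b = f (a \<odot>\<^bsub>M\<^esub> x)"
        using ab sub(4) module_homD(3)[OF f, of a x] subsetD[OF sub(1)] by auto
      then show ?thesis by blast
    qed
  qed
qed

lemma submodule_carrier:
  assumes M: "module R M"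
  shows "submodule (carrier M) R M"
proof -
  interpret M: module R M by fact
  show ?thesis by (rule M.submoduleI) auto
qed

text \<open>Apart from closure and negatives the module axioms are equations, and all of them pass
  to the image of a map that respects the operations. Representatives, encodings and cosets below
  become modules this way.\<close>

lemma image_module:
  assumes "module R N" and carrier: "carrier M = \<pi> ` carrier N"
    and add: "\<And>x y. x \<in> carrier N \<Longrightarrow> y \<in> carrier N \<Longrightarrow> \<pi> (x \<oplus>\<^bsub>N\<^esub> y) = \<pi> x \<oplus>\<^bsub>M\<^esub> \<pi> y"
    and smult: "\<And>a x. a \<in> carrier R \<Longrightarrow> x \<in> carrier N \<Longrightarrow> \<pi> (a \<odot>\<^bsub>N\<^esub> x) = a \<odot>\<^bsub>M\<^esub> \<pi> x"
    and zero: "\<zero>\<^bsub>M\<^esub> = \<pi> \<zero>\<^bsub>N\<^esub>"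
  shows "module R M"
proof -
  interpret N: module R N by fact
  show ?thesis
  proof (rule moduleI)
    show "cring R" ..
    show "abelian_group M"
    proof (rule abelian_groupI)
      fix x assume "x \<in> carrier M"
      then obtain n where n: "n \<in> carrier N" "x = \<pi> n" by (auto simp: carrier)
      have "\<pi> (\<ominus>\<^bsub>N\<^esub> n) \<oplus>\<^bsub>M\<^esub> x = \<zero>\<^bsub>M\<^esub>"
        using n by (simp add: zero N.M.l_neg flip: add)
      then show "\<exists>y\<in>carrier M. y \<oplus>\<^bsub>M\<^esub> x = \<zero>\<^bsub>M\<^esub>"
        using n by (auto simp: carrier)
    qed (auto simp: carrier zero N.M.a_ac simp flip: add)
  qed (auto simp: carrier N.smult_l_distr N.smult_r_distr N.smult_assoc1 simp flip: add smult)
qed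

subsection \<open>Quotients on the type of the module\<close>

text \<open>Quotients are carried by chosen coset representatives, so that their elements have the same type
  as those of the module; a resolution needs all its terms on one type.\<close>

definition rep :: "('a, 'm) module \<Rightarrow> 'm set \<Rightarrow> 'm \<Rightarrow> 'm" where
  "rep M N x = (SOME y. y \<in> carrier M \<and> x \<ominus>\<^bsub>M\<^esub> y \<in> N)"

definition rep_quot :: "('a, 'm) module \<Rightarrow> 'm set \<Rightarrow> ('a, 'm) module" where
  "rep_quot M N = \<lparr>carrier = rep M N ` carrier M, mult = undefined, one = undefined,
     zero = rep M N \<zero>\<^bsub>M\<^esub>, add = (\<lambda>x y. rep M N (x \<oplus>\<^bsub>M\<^esub> y)), smult = (\<lambda>a x. rep M N (a \<odot>\<^bsub>M\<^esub> x))\<rparr>"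

context
  fixes R :: "('a, 'r) ring_scheme" and M :: "('a, 'm) module" and N
  assumes M: "module R M" and N: "submodule N R M"
begin

interpretation M: module R M by (rule M)

lemmas N_closed = M.submoduleE[OF N]

lemma rep_closed: "x \<in> carrier M \<Longrightarrow> rep M N x \<in> carrier M"
  and rep_minus: "x \<in> carrier M \<Longrightarrow> x \<ominus>\<^bsub>M\<^esub> rep M N x \<in> N"
proof -
  assume x: "x \<in> carrier M"
  have "\<zero>\<^bsub>M\<^esub> \<in> N" by (rule submodule_zero[OF N])
  with x have "x \<in> carrier M \<and> x \<ominus>\<^bsub>M\<^esub> x \<in> N" by (simp add: a_minus_def M.M.r_neg)
  from someI[where P="\<lambda>y. y \<in> carrier M \<and> x \<ominus>\<^bsub>M\<^esub> y \<in> N", OF this] 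
  show "rep M N x \<in> carrier M" "x \<ominus>\<^bsub>M\<^esub> rep M N x \<in> N"
    unfolding rep_def by auto
qed

lemma minus_mem_trans:
  assumes "x \<in> carrier M" "y \<in> carrier M" "z \<in> carrier M" "x \<ominus>\<^bsub>M\<^esub> y \<in> N" "y \<ominus>\<^bsub>M\<^esub> z \<in> N"
  shows "x \<ominus>\<^bsub>M\<^esub> z \<in> N"
proof -
  have "x \<ominus>\<^bsub>M\<^esub> z = (x \<ominus>\<^bsub>M\<^esub> y) \<oplus>\<^bsub>M\<^esub> (y \<ominus>\<^bsub>M\<^esub> z)"
    using assms by (simp add: a_minus_def M.M.a_ac M.M.r_neg1 M.M.r_neg2)
  then show ?thesis using N_closed(5)[OF assms(4,5)] by simp
qed

lemma minus_mem_sym: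
  assumes "x \<in> carrier M" "y \<in> carrier M" "x \<ominus>\<^bsub>M\<^esub> y \<in> N"
  shows "y \<ominus>\<^bsub>M\<^esub> x \<in> N"
proof -
  have "y \<ominus>\<^bsub>M\<^esub> x = \<ominus>\<^bsub>M\<^esub> (x \<ominus>\<^bsub>M\<^esub> y)"
    using assms by (simp add: a_minus_def M.M.minus_add M.M.a_ac)
  then show ?thesis using N_closed(3)[OF assms(3)] by simp
qed

lemma rep_eq_iff:
  assumes "x \<in> carrier M" "y \<in> carrier M"
  shows "rep M N x = rep M N y \<longleftrightarrow> x \<ominus>\<^bsub>M\<^esub> y \<in> N"
proof
  assume "rep M N x = rep M N y"
  then show "x \<ominus>\<^bsub>M\<^esub> y \<in> N"
    using minus_mem_trans minus_mem_sym rep_closed rep_minus assms by metis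
next
  assume "x \<ominus>\<^bsub>M\<^esub> y \<in> N"
  \<comment> \<open>The predicates under \<open>SOME\<close> coincide, so the chosen representative
    depends on the coset alone.\<close>
  then have "(\<lambda>z. z \<in> carrier M \<and> x \<ominus>\<^bsub>M\<^esub> z \<in> N) = (\<lambda>z. z \<in> carrier M \<and> y \<ominus>\<^bsub>M\<^esub> z \<in> N)"
    using minus_mem_trans minus_mem_sym assms by blast
  then show "rep M N x = rep M N y" by (simp only: rep_def)
qed

lemma rep_add:
  assumes "x \<in> carrier M" "y \<in> carrier M"
  shows "rep M N (x \<oplus>\<^bsub>M\<^esub> y) = rep M N (rep M N x \<oplus>\<^bsub>M\<^esub> rep M N y)"
proof -
  have "(x \<oplus>\<^bsub>M\<^esub> y) \<ominus>\<^bsub>M\<^esub> (rep M N x \<oplus>\<^bsub>M\<^esub> rep M N y) =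
    (x \<ominus>\<^bsub>M\<^esub> rep M N x) \<oplus>\<^bsub>M\<^esub> (y \<ominus>\<^bsub>M\<^esub> rep M N y)"
    using assms rep_closed by (simp add: a_minus_def M.M.minus_add M.M.a_ac)
  also have "\<dots> \<in> N"
    using assms by (intro N_closed(5) rep_minus)
  finally show ?thesis using assms rep_closed by (subst rep_eq_iff) auto
qed

lemma rep_smult:
  assumes "a \<in> carrier R" "x \<in> carrier M"
  shows "rep M N (a \<odot>\<^bsub>M\<^esub> x) = rep M N (a \<odot>\<^bsub>M\<^esub> rep M N x)"
proof -
  have "(a \<odot>\<^bsub>M\<^esub> x) \<ominus>\<^bsub>M\<^esub> (a \<odot>\<^bsub>M\<^esub> rep M N x) = a \<odot>\<^bsub>M\<^esub> (x \<ominus>\<^bsub>M\<^esub> rep M N x)"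
    using assms rep_closed by (simp add: a_minus_def M.smult_r_distr M.smult_r_minus)
  also have "\<dots> \<in> N"
    using assms by (intro N_closed(4) rep_minus)
  finally show ?thesis using assms rep_closed by (subst rep_eq_iff) auto
qed

lemma module_rep_quot: "module R (rep_quot M N)"
  by (rule image_module[OF M, where \<pi> = "rep M N"])
    (simp_all add: rep_quot_def rep_add rep_smult)

lemma rep_hom: "rep M N \<in> module_hom R M (rep_quot M N)"
  by (rule module_homI) (simp_all add: rep_quot_def rep_add rep_smult)

lemma rep_eq_zero_iff:
  assumes "x \<in> carrier M"
  shows "rep M N x = \<zero>\<^bsub>rep_quot M N\<^esub> \<longleftrightarrow> x \<in> N"
proof -
  have "\<ominus>\<^bsub>M\<^esub> \<zero>\<^bsub>M\<^esub> = \<zero>\<^bsub>M\<^esub>" by (rule M.M.minus_equality) auto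
  then have "x \<ominus>\<^bsub>M\<^esub> \<zero>\<^bsub>M\<^esub> = x"
    unfolding a_minus_def by (simp only: M.M.r_zero[OF assms])
  then show ?thesis
    using rep_eq_iff[of x "\<zero>\<^bsub>M\<^esub>"] assms by (simp add: rep_quot_def)
qed

end

lemma carrier_rep_quot: "carrier (rep_quot M N) = rep M N ` carrier M"
  by (simp add: rep_quot_def)

subsection \<open>Coinduced modules\<close>

abbreviation cst :: "'k::field \<Rightarrow> ('v, 'k) mpoly" where "cst \<equiv> Poly_Mapping.single 0"

lemma cst_carrier [simp]: "cst c \<in> carrier (mpoly_ring V)"
  by (simp add: carrier_mpoly_ring mon_in_mon_ideal_iff)

definition subspace :: "(('v, 'k::field) mpoly, 'm) module \<Rightarrow> 'm set \<Rightarrow> bool" where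
  "subspace N C \<longleftrightarrow> C \<subseteq> carrier N \<and> \<zero>\<^bsub>N\<^esub> \<in> C \<and> (\<forall>x\<in>C. \<forall>y\<in>C. x \<oplus>\<^bsub>N\<^esub> y \<in> C) \<and>
     (\<forall>c. \<forall>x\<in>C. cst c \<odot>\<^bsub>N\<^esub> x \<in> C)"

text \<open>By Zorn's lemma there is a maximal subspace that meets \<open>H\<close> in zero only. A
  vector outside \<open>H + C\<close> could be adjoined to it without changing this, against
  maximality.\<close>

lemma subspace_complement:
  fixes N :: "(('v, 'k::field) mpoly, 'm) module"
  assumes N: "module (mpoly_ring V) N" and H: "subspace N H"
  obtains C where "subspace N C" "C \<inter> H = {\<zero>\<^bsub>N\<^esub>}"
    "\<And>x. x \<in> carrier N \<Longrightarrow> \<exists>h\<in>H. \<exists>c\<in>C. x = h \<oplus>\<^bsub>N\<^esub> c"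
proof -
  interpret N: module "mpoly_ring V" N by (rule N)
  note [simp] = subsetD
  have H': "H \<subseteq> carrier N" "\<zero>\<^bsub>N\<^esub> \<in> H" "\<And>x y. x \<in> H \<Longrightarrow> y \<in> H \<Longrightarrow> x \<oplus>\<^bsub>N\<^esub> y \<in> H"
     "\<And>x c. x \<in> H \<Longrightarrow> cst c \<odot>\<^bsub>N\<^esub> x \<in> H"
    using H by (auto simp: subspace_def)
  define A where "A = {C. subspace N C \<and> C \<inter> H = {\<zero>\<^bsub>N\<^esub>}}"
  have "{\<zero>\<^bsub>N\<^esub>} \<in> A"
    using H' by (auto simp: A_def subspace_def)
  moreover have "\<Union>\<C> \<in> A" if "\<C> \<noteq> {}" "subset.chain A \<C>" for \<C>
  proof -
    have *: "C \<in> A" "C' \<in> A" "C \<subseteq> C' \<or> C' \<subseteq> C" if "C \<in> \<C>" "C' \<in> \<C>" for C C'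
      using \<open>subset.chain A \<C>\<close> that by (auto simp: subset_chain_def)
    have sub: "subspace N C" "C \<inter> H = {\<zero>\<^bsub>N\<^esub>}" if "C \<in> \<C>" for C
      using * that by (auto simp: A_def)
    have "x \<oplus>\<^bsub>N\<^esub> y \<in> \<Union>\<C>" if "x \<in> \<Union>\<C>" "y \<in> \<Union>\<C>" for x y
    proof -
      obtain C C' where C: "C \<in> \<C>" "C' \<in> \<C>" "x \<in> C" "y \<in> C'" using \<open>x \<in> _\<close> \<open>y \<in> _\<close> by blast
      then obtain D where "D \<in> \<C>" "x \<in> D" "y \<in> D" using *(3) by blast
      then show ?thesis using sub by (auto simp: subspace_def)
    qed
    then have "subspace N (\<Union>\<C>)"
      using sub(1) \<open>\<C> \<noteq> {}\<close> unfolding subspace_def by blast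
    moreover have "\<Union>\<C> \<inter> H = {\<zero>\<^bsub>N\<^esub>}"
      using sub(2) \<open>\<C> \<noteq> {}\<close> by blast
    ultimately show ?thesis by (simp add: A_def)
  qed
  ultimately obtain C where C: "C \<in> A" "\<And>X. X \<in> A \<Longrightarrow> C \<subseteq> X \<Longrightarrow> X = C"
    using subset_Zorn_nonempty[of A] by blast
  have C': "C \<subseteq> carrier N" "\<zero>\<^bsub>N\<^esub> \<in> C" "\<And>x y. x \<in> C \<Longrightarrow> y \<in> C \<Longrightarrow> x \<oplus>\<^bsub>N\<^esub> y \<in> C"
     "\<And>x c. x \<in> C \<Longrightarrow> cst c \<odot>\<^bsub>N\<^esub> x \<in> C" "C \<inter> H = {\<zero>\<^bsub>N\<^esub>}"
    using C(1) by (auto simp: subspace_def A_def)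
  have cst0: "0 \<odot>\<^bsub>N\<^esub> x = \<zero>\<^bsub>N\<^esub>" if "x \<in> carrier N" for x
    using N.smult_l_null[OF that] by simp
  have cst1: "1 \<odot>\<^bsub>N\<^esub> x = x" if "x \<in> carrier N" for x
    using N.smult_one[OF that] by simp
  have cstm: "cst a \<odot>\<^bsub>N\<^esub> (cst b \<odot>\<^bsub>N\<^esub> x) = cst (a * b) \<odot>\<^bsub>N\<^esub> x" if "x \<in> carrier N" for x and a b :: 'k
    using N.smult_assoc1[of "cst a" "cst b" x] that by (simp add: mult_single)
  have csta: "cst a \<odot>\<^bsub>N\<^esub> x \<oplus>\<^bsub>N\<^esub> cst b \<odot>\<^bsub>N\<^esub> x = cst (a + b) \<odot>\<^bsub>N\<^esub> x" if "x \<in> carrier N" for x and a b :: 'k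
    using N.smult_l_distr[of "cst a" "cst b" x] that by (simp add: single_add)
  have "\<exists>h\<in>H. \<exists>c\<in>C. x = h \<oplus>\<^bsub>N\<^esub> c" if x: "x \<in> carrier N" for x
  proof (rule ccontr)
    assume no: "\<not> ?thesis"
    define D where "D = {c \<oplus>\<^bsub>N\<^esub> cst a \<odot>\<^bsub>N\<^esub> x | c a. c \<in> C}"
    have "subspace N D"
      unfolding subspace_def
    proof (intro conjI ballI allI)
      show "D \<subseteq> carrier N" using C'(1) x by (auto simp: D_def)
      have "\<zero>\<^bsub>N\<^esub> = \<zero>\<^bsub>N\<^esub> \<oplus>\<^bsub>N\<^esub> cst 0 \<odot>\<^bsub>N\<^esub> x" using x by (simp add: cst0)
      then show "\<zero>\<^bsub>N\<^esub> \<in> D" using C'(2) unfolding D_def by blast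
    next
      fix y z assume "y \<in> D" "z \<in> D"
      then obtain c a c' a' where *: "c \<in> C" "c' \<in> C" "y = c \<oplus>\<^bsub>N\<^esub> cst a \<odot>\<^bsub>N\<^esub> x" "z = c' \<oplus>\<^bsub>N\<^esub> cst a' \<odot>\<^bsub>N\<^esub> x"
        by (auto simp: D_def)
      have "y \<oplus>\<^bsub>N\<^esub> z = (c \<oplus>\<^bsub>N\<^esub> c') \<oplus>\<^bsub>N\<^esub> (cst a \<odot>\<^bsub>N\<^esub> x \<oplus>\<^bsub>N\<^esub> cst a' \<odot>\<^bsub>N\<^esub> x)"
        using * C'(1) x by (simp add: N.M.a_ac)
      also have "\<dots> = (c \<oplus>\<^bsub>N\<^esub> c') \<oplus>\<^bsub>N\<^esub> cst (a + a') \<odot>\<^bsub>N\<^esub> x"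
        using x by (simp add: csta)
      finally show "y \<oplus>\<^bsub>N\<^esub> z \<in> D" using * C'(3) unfolding D_def by blast
    next
      fix b y assume "y \<in> D"
      then obtain c a where *: "c \<in> C" "y = c \<oplus>\<^bsub>N\<^esub> cst a \<odot>\<^bsub>N\<^esub> x"
        by (auto simp: D_def)
      have "cst b \<odot>\<^bsub>N\<^esub> y = cst b \<odot>\<^bsub>N\<^esub> c \<oplus>\<^bsub>N\<^esub> cst (b * a) \<odot>\<^bsub>N\<^esub> x"
        using * C'(1) x by (simp add: N.smult_r_distr cstm)
      then show "cst b \<odot>\<^bsub>N\<^esub> y \<in> D" using * C'(4) unfolding D_def by blast
    qed
    moreover have "y = \<zero>\<^bsub>N\<^esub>" if "y \<in> D" "y \<in> H" for y
    proof -
      obtain c a where *: "c \<in> C" "y = c \<oplus>\<^bsub>N\<^esub> cst a \<odot>\<^bsub>N\<^esub> x"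
        using \<open>y \<in> D\<close> by (auto simp: D_def)
      note cl = subsetD[OF C'(1) *(1)] subsetD[OF H'(1) \<open>y \<in> H\<close>] x
      show ?thesis
      proof (cases "a = 0")
        case True
        then show ?thesis using * C' cl \<open>y \<in> H\<close> by (auto simp: cst0)
      next
        case False
        \<comment> \<open>With a nonzero coefficient the equation can be solved for
          \<open>x\<close>, which would put it into \<open>H + C\<close>.\<close>
        have "x = cst (inverse a) \<odot>\<^bsub>N\<^esub> (cst a \<odot>\<^bsub>N\<^esub> x)"
          using False x by (simp add: cstm cst1)
        also have "cst a \<odot>\<^bsub>N\<^esub> x = y \<oplus>\<^bsub>N\<^esub> cst (- 1) \<odot>\<^bsub>N\<^esub> c"
        proof -
          have "y \<oplus>\<^bsub>N\<^esub> cst (- 1) \<odot>\<^bsub>N\<^esub> c = (cst 1 \<odot>\<^bsub>N\<^esub> c \<oplus>\<^bsub>N\<^esub> cst (- 1) \<odot>\<^bsub>N\<^esub> c) \<oplus>\<^bsub>N\<^esub> cst a \<odot>\<^bsub>N\<^esub> x"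
            using cl * by (simp add: N.M.a_ac cst1)
          also have "\<dots> = cst a \<odot>\<^bsub>N\<^esub> x"
            unfolding csta[OF cl(1)] using cl by (simp add: cst0)
          finally show ?thesis ..
        qed
        also have "cst (inverse a) \<odot>\<^bsub>N\<^esub> \<dots> = cst (inverse a) \<odot>\<^bsub>N\<^esub> y \<oplus>\<^bsub>N\<^esub> cst (- inverse a) \<odot>\<^bsub>N\<^esub> c"
          using cl by (simp add: N.smult_r_distr cstm)
        finally show ?thesis using no C'(4)[OF *(1)] H'(4)[OF \<open>y \<in> H\<close>] by blast
      qed
    qed
    then have "D \<inter> H = {\<zero>\<^bsub>N\<^esub>}"
      using \<open>subspace N D\<close> H' by (auto simp: subspace_def)
    ultimately have "D \<in> A" by (simp add: A_def)
    moreover have "C \<subseteq> D"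
    proof
      fix c assume "c \<in> C"
      then have "c = c \<oplus>\<^bsub>N\<^esub> cst 0 \<odot>\<^bsub>N\<^esub> x" using x C'(1) by (simp add: cst0)
      then show "c \<in> D" using \<open>c \<in> C\<close> unfolding D_def by blast
    qed
    ultimately have "D = C" by (rule C(2))
    have "x = \<zero>\<^bsub>N\<^esub> \<oplus>\<^bsub>N\<^esub> cst 1 \<odot>\<^bsub>N\<^esub> x" using x by (simp add: cst1)
    then have "x \<in> D" using C'(2) unfolding D_def by blast
    then have "\<zero>\<^bsub>N\<^esub> \<in> H \<and> x \<in> C \<and> x = \<zero>\<^bsub>N\<^esub> \<oplus>\<^bsub>N\<^esub> x" using \<open>D = C\<close> x H' by simp
    then show False using no by blast
  qed
  with C C' show ?thesis by (intro that[of C]) (auto simp: A_def)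
qed

lemma subspace_projection:
  fixes N :: "(('v, 'k::field) mpoly, 'm) module"
  assumes N: "module (mpoly_ring V) N" and H: "subspace N H"
  obtains p where "\<And>x. x \<in> carrier N \<Longrightarrow> p x \<in> H" "\<And>x. x \<in> H \<Longrightarrow> p x = x"
    "\<And>x y. x \<in> carrier N \<Longrightarrow> y \<in> carrier N \<Longrightarrow> p (x \<oplus>\<^bsub>N\<^esub> y) = p x \<oplus>\<^bsub>N\<^esub> p y"
    "\<And>c x. x \<in> carrier N \<Longrightarrow> p (cst c \<odot>\<^bsub>N\<^esub> x) = cst c \<odot>\<^bsub>N\<^esub> p x"
proof -
  interpret N: module "mpoly_ring V" N by (rule N)
  obtain C where C: "subspace N C" "C \<inter> H = {\<zero>\<^bsub>N\<^esub>}"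
    "\<And>x. x \<in> carrier N \<Longrightarrow> \<exists>h\<in>H. \<exists>c\<in>C. x = h \<oplus>\<^bsub>N\<^esub> c"
    using subspace_complement[OF N H] by blast
  have H': "H \<subseteq> carrier N" "\<zero>\<^bsub>N\<^esub> \<in> H" "\<And>x y. x \<in> H \<Longrightarrow> y \<in> H \<Longrightarrow> x \<oplus>\<^bsub>N\<^esub> y \<in> H"
     "\<And>x c. x \<in> H \<Longrightarrow> cst c \<odot>\<^bsub>N\<^esub> x \<in> H"
    using H by (auto simp: subspace_def)
  have C': "C \<subseteq> carrier N" "\<zero>\<^bsub>N\<^esub> \<in> C" "\<And>x y. x \<in> C \<Longrightarrow> y \<in> C \<Longrightarrow> x \<oplus>\<^bsub>N\<^esub> y \<in> C"
     "\<And>x c. x \<in> C \<Longrightarrow> cst c \<odot>\<^bsub>N\<^esub> x \<in> C"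
    using C(1) by (auto simp: subspace_def)
  have neg: "\<ominus>\<^bsub>N\<^esub> x = cst (- 1) \<odot>\<^bsub>N\<^esub> x" if "x \<in> carrier N" for x
    using N.smult_l_minus[of 1 x] N.smult_one[OF that] that by (simp add: a_inv_mpoly_ring carrier_mpoly_ring one_in_mon_ideal_iff single_uminus)
  have uniq: "h = h'" if "h \<in> H" "h' \<in> H" "c \<in> C" "c' \<in> C" "h \<oplus>\<^bsub>N\<^esub> c = h' \<oplus>\<^bsub>N\<^esub> c'" for h h' c c'
  proof -
    note cl = subsetD[OF H'(1) that(1)] subsetD[OF H'(1) that(2)] subsetD[OF C'(1) that(3)] subsetD[OF C'(1) that(4)]
    have "h \<oplus>\<^bsub>N\<^esub> \<ominus>\<^bsub>N\<^esub> h' = (h \<oplus>\<^bsub>N\<^esub> c) \<oplus>\<^bsub>N\<^esub> \<ominus>\<^bsub>N\<^esub> c \<oplus>\<^bsub>N\<^esub> \<ominus>\<^bsub>N\<^esub> h'"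
      using cl by (simp add: N.M.a_assoc N.M.r_neg)
    also have "\<dots> = (h' \<oplus>\<^bsub>N\<^esub> \<ominus>\<^bsub>N\<^esub> h') \<oplus>\<^bsub>N\<^esub> (c' \<oplus>\<^bsub>N\<^esub> \<ominus>\<^bsub>N\<^esub> c)"
      unfolding that(5) using cl by (simp add: N.M.a_ac)
    also have "\<dots> = c' \<oplus>\<^bsub>N\<^esub> \<ominus>\<^bsub>N\<^esub> c"
      using cl by (simp add: N.M.r_neg)
    finally have *: "h \<oplus>\<^bsub>N\<^esub> \<ominus>\<^bsub>N\<^esub> h' = c' \<oplus>\<^bsub>N\<^esub> \<ominus>\<^bsub>N\<^esub> c" .
    have "h \<oplus>\<^bsub>N\<^esub> \<ominus>\<^bsub>N\<^esub> h' \<in> H"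
      unfolding neg[OF cl(2)] using that H' by blast
    moreover have "c' \<oplus>\<^bsub>N\<^esub> \<ominus>\<^bsub>N\<^esub> c \<in> C"
      unfolding neg[OF cl(3)] using that C' by blast
    ultimately have "h \<oplus>\<^bsub>N\<^esub> \<ominus>\<^bsub>N\<^esub> h' = \<zero>\<^bsub>N\<^esub>" using C(2) * by auto
    then have "h \<oplus>\<^bsub>N\<^esub> (\<ominus>\<^bsub>N\<^esub> h' \<oplus>\<^bsub>N\<^esub> h') = h'" using cl by (simp flip: N.M.a_assoc)
    then show ?thesis using cl by (simp add: N.M.l_neg)
  qed
  define p where "p x = (SOME h. h \<in> H \<and> (\<exists>c\<in>C. x = h \<oplus>\<^bsub>N\<^esub> c))" for x
  have ex: "p x \<in> H" "\<exists>c\<in>C. x = p x \<oplus>\<^bsub>N\<^esub> c" if "x \<in> carrier N" for x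
  proof -
    have "\<exists>h. h \<in> H \<and> (\<exists>c\<in>C. x = h \<oplus>\<^bsub>N\<^esub> c)" using C(3)[OF that] by blast
    from someI_ex[OF this] show "p x \<in> H" "\<exists>c\<in>C. x = p x \<oplus>\<^bsub>N\<^esub> c" by (auto simp: p_def)
  qed
  have eq: "p (h \<oplus>\<^bsub>N\<^esub> c) = h" if "h \<in> H" "c \<in> C" for h c
  proof -
    have "h \<oplus>\<^bsub>N\<^esub> c \<in> carrier N" using that H' C' by auto
    from ex[OF this] obtain c' where "p (h \<oplus>\<^bsub>N\<^esub> c) \<in> H" "c' \<in> C" "p (h \<oplus>\<^bsub>N\<^esub> c) \<oplus>\<^bsub>N\<^esub> c' = h \<oplus>\<^bsub>N\<^esub> c" by auto
    then show ?thesis using uniq that by blast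
  qed
  show ?thesis
  proof (rule that[of p])
    fix x assume "x \<in> carrier N" then show "p x \<in> H" by (rule ex)
  next
    fix x assume "x \<in> H" then show "p x = x" using eq[of x "\<zero>\<^bsub>N\<^esub>"] H' C' by auto
  next
    fix x y assume xy: "x \<in> carrier N" "y \<in> carrier N"
    obtain c d where cd: "c \<in> C" "x = p x \<oplus>\<^bsub>N\<^esub> c" "d \<in> C" "y = p y \<oplus>\<^bsub>N\<^esub> d" using ex xy by meson
    have cl: "c \<in> carrier N" "d \<in> carrier N" "p x \<in> carrier N" "p y \<in> carrier N"
      using cd C'(1) H'(1) ex(1) xy by auto
    have "x \<oplus>\<^bsub>N\<^esub> y = (p x \<oplus>\<^bsub>N\<^esub> c) \<oplus>\<^bsub>N\<^esub> (p y \<oplus>\<^bsub>N\<^esub> d)" using cd by simp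
    also have "\<dots> = (p x \<oplus>\<^bsub>N\<^esub> p y) \<oplus>\<^bsub>N\<^esub> (c \<oplus>\<^bsub>N\<^esub> d)" using cl by (simp add: N.M.a_ac)
    finally show "p (x \<oplus>\<^bsub>N\<^esub> y) = p x \<oplus>\<^bsub>N\<^esub> p y"
      using eq[of "p x \<oplus>\<^bsub>N\<^esub> p y" "c \<oplus>\<^bsub>N\<^esub> d"] ex(1) xy cd H'(3) C'(3) by simp
  next
    fix a x assume x: "x \<in> carrier N"
    obtain c where c: "c \<in> C" "x = p x \<oplus>\<^bsub>N\<^esub> c" using ex x by meson
    have cl: "c \<in> carrier N" "p x \<in> carrier N" using c C'(1) H'(1) ex(1) x by auto
    have "cst a \<odot>\<^bsub>N\<^esub> x = cst a \<odot>\<^bsub>N\<^esub> (p x \<oplus>\<^bsub>N\<^esub> c)" using c by simp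
    also have "\<dots> = cst a \<odot>\<^bsub>N\<^esub> p x \<oplus>\<^bsub>N\<^esub> cst a \<odot>\<^bsub>N\<^esub> c" using cl by (simp add: N.smult_r_distr)
    finally show "p (cst a \<odot>\<^bsub>N\<^esub> x) = cst a \<odot>\<^bsub>N\<^esub> p x"
      using eq[of "cst a \<odot>\<^bsub>N\<^esub> p x" "cst a \<odot>\<^bsub>N\<^esub> c"] ex(1) x c H'(4) C'(4) by simp
  qed
qed


definition lin_maps ::
  "'v set \<Rightarrow> (('v, 'k::field) mpoly, 'm) module \<Rightarrow> (('v, 'k) mpoly \<Rightarrow> 'm) set" where
  "lin_maps V M = {\<phi> \<in> extensional (carrier (mpoly_ring V)) \<inter> (carrier (mpoly_ring V) \<rightarrow> carrier M).
     (\<forall>r\<in>carrier (mpoly_ring V). \<forall>s\<in>carrier (mpoly_ring V). \<phi> (r + s) = \<phi> r \<oplus>\<^bsub>M\<^esub> \<phi> s) \<and>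
     (\<forall>c. \<forall>r\<in>carrier (mpoly_ring V). \<phi> (cst c * r) = cst c \<odot>\<^bsub>M\<^esub> \<phi> r)}"

text \<open>This is \<open>Hom_k(S, M)\<close> with the ring acting on the argument. The maps are
  extensional, so agreement on the ring is the same as equality.\<close>

definition coind ::
  "'v set \<Rightarrow> (('v, 'k::field) mpoly, 'm) module \<Rightarrow>
    (('v, 'k) mpoly, ('v, 'k) mpoly \<Rightarrow> 'm) module" where
  "coind V M = \<lparr>carrier = lin_maps V M, mult = undefined, one = undefined,
     zero = (\<lambda>r\<in>carrier (mpoly_ring V). \<zero>\<^bsub>M\<^esub>),
     add = (\<lambda>\<phi> \<psi>. \<lambda>r\<in>carrier (mpoly_ring V). \<phi> r \<oplus>\<^bsub>M\<^esub> \<psi> r),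
     smult = (\<lambda>a \<phi>. \<lambda>r\<in>carrier (mpoly_ring V). \<phi> (a * r))\<rparr>"

lemma poly_closed:
  "r \<in> carrier (mpoly_ring V) \<Longrightarrow> s \<in> carrier (mpoly_ring V) \<Longrightarrow> r + s \<in> carrier (mpoly_ring V)"
  "r \<in> carrier (mpoly_ring V) \<Longrightarrow> s \<in> carrier (mpoly_ring V) \<Longrightarrow> r - s \<in> carrier (mpoly_ring V)"
  "r \<in> carrier (mpoly_ring V) \<Longrightarrow> s \<in> carrier (mpoly_ring V) \<Longrightarrow> r * s \<in> carrier (mpoly_ring V)"
  "r \<in> carrier (mpoly_ring V) \<Longrightarrow> - r \<in> carrier (mpoly_ring V)"
  "0 \<in> carrier (mpoly_ring V)" "1 \<in> carrier (mpoly_ring V)"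
  by (auto simp: carrier_mpoly_ring mon_ideal_add mon_ideal_diff mon_ideal_mult mon_ideal_uminus
      one_in_mon_ideal_iff)

lemma lin_mapsD:
  assumes "\<phi> \<in> lin_maps V M"
  shows "r \<in> carrier (mpoly_ring V) \<Longrightarrow> \<phi> r \<in> carrier M"
    and "r \<in> carrier (mpoly_ring V) \<Longrightarrow> s \<in> carrier (mpoly_ring V) \<Longrightarrow> \<phi> (r + s) = \<phi> r \<oplus>\<^bsub>M\<^esub> \<phi> s"
    and "r \<in> carrier (mpoly_ring V) \<Longrightarrow> \<phi> (cst c * r) = cst c \<odot>\<^bsub>M\<^esub> \<phi> r"
    and "r \<notin> carrier (mpoly_ring V) \<Longrightarrow> \<phi> r = undefined"
  using assms by (auto simp: lin_maps_def extensional_def)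

lemma lin_maps_restrictI:
  assumes "\<And>r. r \<in> carrier (mpoly_ring V) \<Longrightarrow> \<phi> r \<in> carrier M"
    and "\<And>r s. r \<in> carrier (mpoly_ring V) \<Longrightarrow> s \<in> carrier (mpoly_ring V) \<Longrightarrow> \<phi> (r + s) = \<phi> r \<oplus>\<^bsub>M\<^esub> \<phi> s"
    and "\<And>c r. r \<in> carrier (mpoly_ring V) \<Longrightarrow> \<phi> (cst c * r) = cst c \<odot>\<^bsub>M\<^esub> \<phi> r"
  shows "restrict \<phi> (carrier (mpoly_ring V)) \<in> lin_maps V M"
  using assms by (auto simp: lin_maps_def poly_closed)

context
  fixes V :: "'v set" and M :: "(('v, 'k::field) mpoly, 'm) module"
  assumes M: "module (mpoly_ring V) M"
begin

interpretation M: module "mpoly_ring V" M by (rule M)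

lemma module_coind: "module (mpoly_ring V) (coind V M)"
proof (rule moduleI)
  let ?R = "mpoly_ring V :: ('v, 'k) mpoly ring"
  show "cring ?R" by (rule cring_mpoly_ring)
  have add: "\<phi> \<oplus>\<^bsub>coind V M\<^esub> \<psi> \<in> carrier (coind V M)"
    if "\<phi> \<in> carrier (coind V M)" "\<psi> \<in> carrier (coind V M)" for \<phi> \<psi>
  proof -
    have "\<phi> \<in> lin_maps V M" "\<psi> \<in> lin_maps V M" using that by (auto simp: coind_def)
    then show ?thesis
      by (auto simp: coind_def lin_mapsD M.M.a_ac M.smult_r_distr intro!: lin_maps_restrictI)
  qed
  show smult: "a \<odot>\<^bsub>coind V M\<^esub> \<phi> \<in> carrier (coind V M)"
    if "a \<in> carrier ?R" "\<phi> \<in> carrier (coind V M)" for a \<phi>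
  proof -
    have "\<phi> \<in> lin_maps V M" using that by (auto simp: coind_def)
    moreover from this have "\<phi> (a * (cst c * r)) = cst c \<odot>\<^bsub>M\<^esub> \<phi> (a * r)" if "r \<in> carrier ?R" for c r
      using lin_mapsD(3)[of \<phi> V M "a * r" c] that \<open>a \<in> carrier ?R\<close>
      by (simp add: poly_closed mult.left_commute)
    ultimately show ?thesis
      using that(1)
      by (auto simp: coind_def lin_mapsD poly_closed distrib_left intro!: lin_maps_restrictI)
  qed
  have zero: "\<zero>\<^bsub>coind V M\<^esub> \<in> carrier (coind V M)"
    by (auto simp: coind_def intro!: lin_maps_restrictI)
  note ext = lin_mapsD(4)
  show "abelian_group (coind V M)"
  proof (rule abelian_groupI)
    fix \<phi> assume "\<phi> \<in> carrier (coind V M)"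
    then have \<phi>: "\<phi> \<in> lin_maps V M" by (simp add: coind_def)
    have "(\<lambda>r\<in>carrier ?R. \<ominus>\<^bsub>M\<^esub> \<phi> r) \<in> carrier (coind V M)"
      using \<phi> by (auto simp: coind_def lin_mapsD M.M.minus_add M.smult_r_minus intro!: lin_maps_restrictI)
    moreover have "(\<lambda>r\<in>carrier ?R. \<ominus>\<^bsub>M\<^esub> \<phi> r) \<oplus>\<^bsub>coind V M\<^esub> \<phi> = \<zero>\<^bsub>coind V M\<^esub>"
      using \<phi> by (auto simp: coind_def lin_mapsD M.M.l_neg restrict_def)
    ultimately show "\<exists>\<psi>\<in>carrier (coind V M). \<psi> \<oplus>\<^bsub>coind V M\<^esub> \<phi> = \<zero>\<^bsub>coind V M\<^esub>" by blast
  qed (use add zero in \<open>auto simp: coind_def lin_mapsD M.M.a_ac restrict_def fun_eq_iff\<close>)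
  show "(a \<otimes>\<^bsub>?R\<^esub> b) \<odot>\<^bsub>coind V M\<^esub> \<phi> = a \<odot>\<^bsub>coind V M\<^esub> (b \<odot>\<^bsub>coind V M\<^esub> \<phi>)"
    if "a \<in> carrier ?R" "b \<in> carrier ?R" "\<phi> \<in> carrier (coind V M)" for a b \<phi>
    using that by (auto simp: coind_def fun_eq_iff poly_closed mult_ac)
qed (auto simp: coind_def lin_mapsD poly_closed distrib_right fun_eq_iff)

text \<open>A module map into the coinduced module amounts to a linear map into \<open>M\<close>,
  obtained by evaluation at 1. Linear maps extend along a projection onto the subspace
  \<open>H\<close>, so module maps extend too.\<close>

lemma coind_extend:
  assumes N: "module (mpoly_ring V) N" and H: "submodule H (mpoly_ring V) N"
    and f: "f \<in> module_hom (mpoly_ring V) (N\<lparr>carrier := H\<rparr>) (coind V M)"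
  shows "\<exists>g \<in> module_hom (mpoly_ring V) N (coind V M). \<forall>x\<in>H. g x = f x"
proof -
  let ?R = "mpoly_ring V :: ('v, 'k) mpoly ring"
  interpret N: module ?R N by (rule N)
  note H' = N.submoduleE[OF H]
  have "\<zero>\<^bsub>N\<^esub> \<in> H" by (rule submodule_zero[OF H])
  then have "subspace N H" using H' by (auto simp: subspace_def)
  from subspace_projection[OF N this] obtain p where p: "\<And>x. x \<in> carrier N \<Longrightarrow> p x \<in> H" "\<And>x. x \<in> H \<Longrightarrow> p x = x"
    "\<And>x y. x \<in> carrier N \<Longrightarrow> y \<in> carrier N \<Longrightarrow> p (x \<oplus>\<^bsub>N\<^esub> y) = p x \<oplus>\<^bsub>N\<^esub> p y"
    "\<And>c x. x \<in> carrier N \<Longrightarrow> p (cst c \<odot>\<^bsub>N\<^esub> x) = cst c \<odot>\<^bsub>N\<^esub> p x" by blast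
  have fl: "f h \<in> lin_maps V M" if "h \<in> H" for h
    using module_homD(1)[OF f] that by (simp add: coind_def)
  have fadd: "f (h \<oplus>\<^bsub>N\<^esub> h') = (\<lambda>r\<in>carrier ?R. f h r \<oplus>\<^bsub>M\<^esub> f h' r)" if "h \<in> H" "h' \<in> H" for h h'
    using module_homD(2)[OF f] that by (simp add: coind_def)
  have fsmult: "f (a \<odot>\<^bsub>N\<^esub> h) = (\<lambda>r\<in>carrier ?R. f h (a * r))" if "h \<in> H" "a \<in> carrier ?R" for h a
    using module_homD(3)[OF f] that by (simp add: coind_def)
  have fcst: "f (cst c \<odot>\<^bsub>N\<^esub> h) 1 = cst c \<odot>\<^bsub>M\<^esub> f h 1" if "h \<in> H" for c h
    using fsmult[OF that cst_carrier] lin_mapsD(3)[OF fl[OF that], of 1] by (simp add: poly_closed)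
  \<comment> \<open>Forced by linearity: \<open>g n r\<close> has to be \<open>g (r n)\<close>
    evaluated at 1.\<close>
  define g where "g n = (\<lambda>r\<in>carrier ?R. f (p (r \<odot>\<^bsub>N\<^esub> n)) 1)" for n
  have assoc: "(a * b) \<odot>\<^bsub>N\<^esub> n = a \<odot>\<^bsub>N\<^esub> (b \<odot>\<^bsub>N\<^esub> n)" if "a \<in> carrier ?R" "b \<in> carrier ?R" "n \<in> carrier N" for a b n
    using N.smult_assoc1[of a b n] that by simp
  have distr: "(a + b) \<odot>\<^bsub>N\<^esub> n = a \<odot>\<^bsub>N\<^esub> n \<oplus>\<^bsub>N\<^esub> b \<odot>\<^bsub>N\<^esub> n" if "a \<in> carrier ?R" "b \<in> carrier ?R" "n \<in> carrier N" for a b n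
    using N.smult_l_distr[of a b n] that by simp
  have one: "1 \<in> carrier ?R" by (rule poly_closed)
  have "g \<in> module_hom ?R N (coind V M)"
  proof (rule module_homI)
    fix n assume n: "n \<in> carrier N"
    have "g n \<in> lin_maps V M"
      unfolding g_def using n one
      by (intro lin_maps_restrictI)
        (auto simp: p assoc distr fadd fcst intro!: lin_mapsD(1)[OF fl])
    then show "g n \<in> carrier (coind V M)" by (simp add: coind_def)
  next
    fix n n' assume "n \<in> carrier N" "n' \<in> carrier N"
    then show "g (n \<oplus>\<^bsub>N\<^esub> n') = g n \<oplus>\<^bsub>coind V M\<^esub> g n'"
      using one by (auto simp: g_def coind_def p N.smult_r_distr fadd fun_eq_iff)
  next
    fix a n assume "a \<in> carrier ?R" "n \<in> carrier N"
    then show "g (a \<odot>\<^bsub>N\<^esub> n) = a \<odot>\<^bsub>coind V M\<^esub> g n"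
      by (auto simp: g_def coind_def poly_closed fun_eq_iff mult.commute[of a] simp flip: assoc)
  qed
  moreover have "g x = f x" if "x \<in> H" for x
  proof
    fix r
    show "g x r = f x r"
    proof (cases "r \<in> carrier ?R")
      case True
      then show ?thesis using that one H' by (simp add: g_def p fsmult)
    next
      case False
      then show ?thesis using lin_mapsD(4)[OF fl[OF that]] by (simp add: g_def)
    qed
  qed
  ultimately show ?thesis by blast
qed

text \<open>The unit of the coinduction adjunction; evaluation at 1 recovers the element.\<close>

lemma coind_embed:
  defines "\<eta> \<equiv> \<lambda>x. \<lambda>r\<in>carrier (mpoly_ring V). r \<odot>\<^bsub>M\<^esub> x"
  shows "\<eta> \<in> module_hom (mpoly_ring V) M (coind V M)" "inj_on \<eta> (carrier M)"
proof -
  let ?R = "mpoly_ring V :: ('v, 'k) mpoly ring"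
  have assoc: "(a * b) \<odot>\<^bsub>M\<^esub> n = a \<odot>\<^bsub>M\<^esub> (b \<odot>\<^bsub>M\<^esub> n)" if "a \<in> carrier ?R" "b \<in> carrier ?R" "n \<in> carrier M" for a b n
    using M.smult_assoc1[of a b n] that by simp
  have distr: "(a + b) \<odot>\<^bsub>M\<^esub> n = a \<odot>\<^bsub>M\<^esub> n \<oplus>\<^bsub>M\<^esub> b \<odot>\<^bsub>M\<^esub> n" if "a \<in> carrier ?R" "b \<in> carrier ?R" "n \<in> carrier M" for a b n
    using M.smult_l_distr[of a b n] that by simp
  show "\<eta> \<in> module_hom ?R M (coind V M)"
  proof (rule module_homI)
    fix n assume n: "n \<in> carrier M"
    have "\<eta> n \<in> lin_maps V M"
      unfolding \<eta>_def using n by (intro lin_maps_restrictI) (auto simp: assoc distr)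
    then show "\<eta> n \<in> carrier (coind V M)" by (simp add: coind_def)
  next
    fix n n' assume "n \<in> carrier M" "n' \<in> carrier M"
    then show "\<eta> (n \<oplus>\<^bsub>M\<^esub> n') = \<eta> n \<oplus>\<^bsub>coind V M\<^esub> \<eta> n'"
      by (auto simp: \<eta>_def coind_def M.smult_r_distr fun_eq_iff)
  next
    fix a n assume "a \<in> carrier ?R" "n \<in> carrier M"
    then show "\<eta> (a \<odot>\<^bsub>M\<^esub> n) = a \<odot>\<^bsub>coind V M\<^esub> \<eta> n"
      by (auto simp: \<eta>_def coind_def poly_closed fun_eq_iff mult.commute[of a] simp flip: assoc)
  qed
  show "inj_on \<eta> (carrier M)"
  proof (rule inj_onI)
    fix x y assume xy: "x \<in> carrier M" "y \<in> carrier M" "\<eta> x = \<eta> y"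
    have "\<eta> x 1 = \<eta> y 1" using xy by simp
    then show "x = y"
      using M.smult_one xy(1,2) by (simp add: \<eta>_def poly_closed)
  qed
qed

end

subsection \<open>The coinduced resolution\<close>

text \<open>Nonempty lists turn \<open>'a \<Rightarrow> 'a list \<Rightarrow> 'l\<close> into a part of \<open>'a list \<Rightarrow> 'l\<close>, so the type used in
  \<open>local_cohomology\<close> is closed under coinduction.\<close>

definition enc :: "('a \<Rightarrow> 'a list \<Rightarrow> 'l) \<Rightarrow> 'a list \<Rightarrow> 'l" where
  "enc \<phi> = (\<lambda>l. case l of [] \<Rightarrow> undefined | a # as \<Rightarrow> \<phi> a as)"

definition dec :: "('a list \<Rightarrow> 'l) \<Rightarrow> 'a \<Rightarrow> 'a list \<Rightarrow> 'l" where
  "dec g = (\<lambda>a as. g (a # as))"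

lemma dec_enc [simp]: "dec (enc \<phi>) = \<phi>"
  by (simp add: dec_def enc_def)

definition coind_enc ::
  "'v set \<Rightarrow> (('v, 'k::field) mpoly, ('v, 'k) mpoly list \<Rightarrow> 'l) module \<Rightarrow>
    (('v, 'k) mpoly, ('v, 'k) mpoly list \<Rightarrow> 'l) module" where
  "coind_enc V M = \<lparr>carrier = enc ` carrier (coind V M), mult = undefined, one = undefined,
     zero = enc \<zero>\<^bsub>coind V M\<^esub>, add = (\<lambda>g h. enc (dec g \<oplus>\<^bsub>coind V M\<^esub> dec h)),
     smult = (\<lambda>a g. enc (a \<odot>\<^bsub>coind V M\<^esub> dec g))\<rparr>"

definition coind_emb ::
  "'v set \<Rightarrow> (('v, 'k::field) mpoly, ('v, 'k) mpoly list \<Rightarrow> 'l) module \<Rightarrow>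
    (('v, 'k) mpoly list \<Rightarrow> 'l) \<Rightarrow> ('v, 'k) mpoly list \<Rightarrow> 'l" where
  "coind_emb V M x = enc (\<lambda>r\<in>carrier (mpoly_ring V). r \<odot>\<^bsub>M\<^esub> x)"

context
  fixes V :: "'v set"
    and M :: "(('v, 'k::field) mpoly, ('v, 'k) mpoly list \<Rightarrow> 'l) module"
  assumes M: "module (mpoly_ring V) M"
begin

lemma module_coind_enc: "module (mpoly_ring V) (coind_enc V M)"
  by (rule image_module[OF module_coind[OF M], where \<pi> = enc]) (simp_all add: coind_enc_def)

lemma injective_coind_enc: "injective_module (mpoly_ring V) (coind_enc V M)"
  unfolding injective_module_def
proof (intro conjI allI impI)
  let ?R = "mpoly_ring V :: ('v, 'k) mpoly ring"
  fix N :: "(('v, 'k) mpoly, ('v, 'k) mpoly) module" and H f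
  assume N: "module ?R N" "submodule H ?R N"
    and f: "f \<in> module_hom ?R (N\<lparr>carrier := H\<rparr>) (coind_enc V M)"
  have f': "f x \<in> enc ` carrier (coind V M)" if "x \<in> H" for x
    using module_homD(1)[OF f] that by (simp add: coind_enc_def)
  have ed: "enc (dec (f x)) = f x" if "x \<in> H" for x
    using f'[OF that] by auto
  have "dec \<circ> f \<in> module_hom ?R (N\<lparr>carrier := H\<rparr>) (coind V M)"
  proof (rule module_homI)
    show "(dec \<circ> f) x \<in> carrier (coind V M)" if "x \<in> carrier (N\<lparr>carrier := H\<rparr>)" for x
      using f'[of x] that by auto
  qed (use module_homD[OF f] in \<open>auto simp: coind_enc_def\<close>)
  from coind_extend[OF M N this] obtain g where
    g: "g \<in> module_hom ?R N (coind V M)" "\<forall>x\<in>H. g x = dec (f x)" by auto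
  have "enc \<circ> g \<in> module_hom ?R N (coind_enc V M)"
    by (rule module_homI) (use module_homD[OF g(1)] in \<open>auto simp: coind_enc_def\<close>)
  moreover have "\<forall>x\<in>H. (enc \<circ> g) x = f x" using g(2) ed by simp
  ultimately show "\<exists>g\<in>module_hom ?R N (coind_enc V M). \<forall>x\<in>H. g x = f x" by blast
qed (rule module_coind_enc)

lemma coind_emb_hom: "coind_emb V M \<in> module_hom (mpoly_ring V) M (coind_enc V M)"
  by (rule module_homI) (use module_homD[OF coind_embed(1)[OF M]] in \<open>auto simp: coind_enc_def coind_emb_def\<close>)

lemma inj_on_coind_emb: "inj_on (coind_emb V M) (carrier M)"
  using coind_embed(2)[OF M] unfolding coind_emb_def inj_on_def by (metis dec_enc)

lemma submodule_coind_emb: "submodule (coind_emb V M ` carrier M) (mpoly_ring V) (coind_enc V M)"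
  by (rule submodule_image[OF M module_coind_enc coind_emb_hom submodule_carrier[OF M]])

end

text \<open>Every module embeds into its coinduced module; dividing by the image and repeating gives
  the resolution. Existence is what makes the \<open>SOME\<close> in \<open>local_cohomology\<close>
  return a resolution.\<close>

lemma exists_injective_resolution:
  fixes V :: "'v set" and L :: "(('v, 'k::field) mpoly, 'l) module"
  assumes L: "module (mpoly_ring V) L"
  shows "\<exists>(E :: nat \<Rightarrow> (('v, 'k) mpoly, ('v, 'k) mpoly list \<Rightarrow> 'l) module) \<delta> \<epsilon>.
    injective_resolution (mpoly_ring V) L E \<delta> \<epsilon>"
proof -
  let ?R = "mpoly_ring V :: ('v, 'k) mpoly ring"
  \<comment> \<open>Constant functions move \<open>L\<close> to the type that carries all later
    terms.\<close>
  let ?c = "\<lambda>x::'l. \<lambda>_::('v, 'k) mpoly list. x"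
  define M0 :: "(('v, 'k) mpoly, ('v, 'k) mpoly list \<Rightarrow> 'l) module"
    where "M0 = \<lparr>carrier = ?c ` carrier L, mult = undefined, one = undefined,
     zero = ?c \<zero>\<^bsub>L\<^esub>, add = (\<lambda>g h. ?c (g [] \<oplus>\<^bsub>L\<^esub> h [])),
     smult = (\<lambda>a g. ?c (a \<odot>\<^bsub>L\<^esub> g []))\<rparr>"
  have M0: "module ?R M0"
    by (rule image_module[OF L, where \<pi> = ?c]) (simp_all add: M0_def)
  have c_hom: "?c \<in> module_hom ?R L M0"
    by (rule module_homI) (simp_all add: M0_def)
  define nxt where "nxt M = rep_quot (coind_enc V M) (coind_emb V M ` carrier M)"
    for M :: "(('v, 'k) mpoly, ('v, 'k) mpoly list \<Rightarrow> 'l) module"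
  define M where "M i = (nxt ^^ i) M0" for i
  have M_0: "M 0 = M0" and M_Suc: "M (Suc i) = nxt (M i)" for i
    by (simp_all add: M_def)
  have M: "module ?R (M i)" for i
  proof (induction i)
    case (Suc i)
    then show ?case
      unfolding M_Suc nxt_def by (intro module_rep_quot module_coind_enc submodule_coind_emb)
  qed (simp add: M_0 M0)
  define E where "E i = coind_enc V (M i)" for i
  define \<eta> where "\<eta> i = coind_emb V (M i)" for i
  define \<rho> where "\<rho> i = rep (E i) (\<eta> i ` carrier (M i))" for i
  have E: "module ?R (E i)" for i unfolding E_def by (rule module_coind_enc[OF M])
  have sm: "submodule (\<eta> i ` carrier (M i)) ?R (E i)" for i
    unfolding \<eta>_def E_def by (rule submodule_coind_emb[OF M])
  have \<eta>: "\<eta> i \<in> module_hom ?R (M i) (E i)" "inj_on (\<eta> i) (carrier (M i))" for i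
    unfolding \<eta>_def E_def by (rule coind_emb_hom[OF M], rule inj_on_coind_emb[OF M])
  have M_Suc': "M (Suc i) = rep_quot (E i) (\<eta> i ` carrier (M i))" for i
    by (simp add: M_Suc nxt_def E_def \<eta>_def)
  have \<rho>: "\<rho> i \<in> module_hom ?R (E i) (M (Suc i))" for i
    unfolding M_Suc' \<rho>_def by (rule rep_hom[OF E sm])
  have \<rho>_surj: "\<rho> i ` carrier (E i) = carrier (M (Suc i))" for i
    unfolding M_Suc' \<rho>_def by (simp add: carrier_rep_quot)
  have \<rho>_zero: "\<rho> i x = \<zero>\<^bsub>M (Suc i)\<^esub> \<longleftrightarrow> x \<in> \<eta> i ` carrier (M i)" if "x \<in> carrier (E i)" for i x
    unfolding M_Suc' \<rho>_def by (rule rep_eq_zero_iff[OF E sm that])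
  define \<delta> where "\<delta> i = \<eta> (Suc i) \<circ> \<rho> i" for i
  have comp: "g \<circ> f \<in> module_hom ?R A C" if "f \<in> module_hom ?R A B" "g \<in> module_hom ?R B C"
    for f g and A :: "(('v, 'k) mpoly, 'x) module"
      and B C :: "(('v, 'k) mpoly, ('v, 'k) mpoly list \<Rightarrow> 'l) module"
    by (rule module_homI) (use module_homD[OF that(1)] module_homD[OF that(2)] in auto)
  have \<delta>_zero: "\<delta> i x = \<zero>\<^bsub>E (Suc i)\<^esub> \<longleftrightarrow> x \<in> \<eta> i ` carrier (M i)" if x: "x \<in> carrier (E i)" for i x
  proof -
    interpret M': module ?R "M (Suc i)" by (rule M)
    have "\<delta> i x = \<eta> (Suc i) \<zero>\<^bsub>M (Suc i)\<^esub> \<longleftrightarrow> \<rho> i x = \<zero>\<^bsub>M (Suc i)\<^esub>"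
      unfolding \<delta>_def comp_def using inj_on_eq_iff[OF \<eta>(2)] module_homD(1)[OF \<rho> x] by simp
    then show ?thesis
      unfolding module_hom_zero[OF M E \<eta>(1)] \<rho>_zero[OF x] .
  qed
  have ker: "a_kernel (E i) (E (Suc i)) (\<delta> i) = \<eta> i ` carrier (M i)" for i
    unfolding a_kernel_def' using \<delta>_zero module_homD(1)[OF \<eta>(1)[of i]] by blast
  have "injective_resolution ?R L E \<delta> (\<eta> 0 \<circ> ?c)"
    unfolding injective_resolution_def
  proof (intro conjI allI)
    show "injective_module ?R (E i)" for i
      unfolding E_def by (rule injective_coind_enc[OF M])
    show "\<delta> i \<in> module_hom ?R (E i) (E (Suc i))" for i
      unfolding \<delta>_def by (rule comp[OF \<rho> \<eta>(1)])
    show "\<eta> 0 \<circ> ?c \<in> module_hom ?R L (E 0)"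
      using comp[OF c_hom] \<eta>(1)[of 0] by (simp add: M_0)
    have "inj_on (\<eta> 0) (?c ` carrier L)"
      using \<eta>(2)[of 0] by (simp add: M_0 M0_def)
    moreover have "inj_on ?c (carrier L)" by (rule inj_onI) (meson fun_cong)
    ultimately show "inj_on (\<eta> 0 \<circ> ?c) (carrier L)"
      by (rule comp_inj_on[rotated])
    show "(\<eta> 0 \<circ> ?c) ` carrier L = a_kernel (E 0) (E 1) (\<delta> 0)"
      using ker[of 0] unfolding image_comp[symmetric] by (simp add: M_0 M0_def)
    show "\<delta> i ` carrier (E i) = a_kernel (E (Suc i)) (E (Suc (Suc i))) (\<delta> (Suc i))" for i
      unfolding ker unfolding \<delta>_def image_comp[symmetric] \<rho>_surj by (rule refl)
  qed
  then show ?thesis by blast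
qed

subsection \<open>The quotient by an ideal\<close>

lemma ring_module_sel [simp]:
  "carrier (ring_module R) = carrier R" "zero (ring_module R) = zero R"
  "add (ring_module R) = add R" "smult (ring_module R) = mult R"
  by (simp_all add: ring_module_def)

lemma module_ring_module:
  assumes "cring R"
  shows "module R (ring_module R)"
proof -
  interpret cring R by fact
  show ?thesis
  proof (rule moduleI)
    show "abelian_group (ring_module R)"
    proof (rule abelian_groupI)
      fix x assume "x \<in> carrier (ring_module R)"
      then have "\<ominus>\<^bsub>R\<^esub> x \<in> carrier R \<and> \<ominus>\<^bsub>R\<^esub> x \<oplus>\<^bsub>R\<^esub> x = \<zero>\<^bsub>R\<^esub>" by (simp add: l_neg)
      then show "\<exists>y\<in>carrier (ring_module R). y \<oplus>\<^bsub>ring_module R\<^esub> x = \<zero>\<^bsub>ring_module R\<^esub>"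
        unfolding ring_module_sel by blast
    qed (simp_all add: a_ac)
  qed (simp_all add: l_distr r_distr m_assoc assms)
qed

context
  fixes R :: "('a, 'r) ring_scheme" and J
  assumes R: "cring R" and J: "ideal J R"
begin

interpretation cring R by (rule R)
interpretation J: ideal J R by (rule J)

lemma coset_ring_module: "J +>\<^bsub>ring_module R\<^esub> x = J +>\<^bsub>R\<^esub> x"
  by (simp add: a_r_coset_def')

lemma carrier_quot_ring_module:
  "carrier (quot_module (ring_module R) J) = (\<lambda>x. J +>\<^bsub>R\<^esub> x) ` carrier R"
  by (simp add: quot_module_def A_RCOSETS_def' a_r_coset_def' UNION_singleton_eq_range)

lemma quot_ring_module_add:
  assumes "x \<in> carrier R" "y \<in> carrier R"
  shows "J +>\<^bsub>R\<^esub> (x \<oplus>\<^bsub>R\<^esub> y) = (J +>\<^bsub>R\<^esub> x) \<oplus>\<^bsub>quot_module (ring_module R) J\<^esub> (J +>\<^bsub>R\<^esub> y)"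
  using J.a_rcos_sum[OF assms] by (simp add: quot_module_def set_add_def')

lemma coset_eq_iff:
  assumes "x \<in> carrier R" "y \<in> carrier R"
  shows "J +>\<^bsub>R\<^esub> x = J +>\<^bsub>R\<^esub> y \<longleftrightarrow> x \<ominus>\<^bsub>R\<^esub> y \<in> J"
proof
  assume "J +>\<^bsub>R\<^esub> x = J +>\<^bsub>R\<^esub> y"
  then have "x \<in> J +>\<^bsub>R\<^esub> y" using J.a_rcos_self[OF assms(1)] by simp
  then obtain j where j: "j \<in> J" "x = j \<oplus>\<^bsub>R\<^esub> y" unfolding a_r_coset_def' by blast
  then have "x \<ominus>\<^bsub>R\<^esub> y = j" using assms J.a_Hcarr[of j] by (simp add: a_minus_def a_assoc r_neg)
  then show "x \<ominus>\<^bsub>R\<^esub> y \<in> J" using j by simp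
next
  assume j: "x \<ominus>\<^bsub>R\<^esub> y \<in> J"
  have "(x \<ominus>\<^bsub>R\<^esub> y) \<oplus>\<^bsub>R\<^esub> y = x"
    using assms by (simp add: a_minus_def a_assoc l_neg)
  then have "x \<in> J +>\<^bsub>R\<^esub> y" using j unfolding a_r_coset_def' by blast
  from a_repr_independence[OF this assms(2) J.a_subgroup] show "J +>\<^bsub>R\<^esub> x = J +>\<^bsub>R\<^esub> y" ..
qed

text \<open>The union defining the scalar product runs over cosets that are all equal, because
  multiples of elements of the ideal stay in it.\<close>

lemma quot_ring_module_smult:
  assumes "a \<in> carrier R" "x \<in> carrier R"
  shows "J +>\<^bsub>R\<^esub> (a \<otimes>\<^bsub>R\<^esub> x) = a \<odot>\<^bsub>quot_module (ring_module R) J\<^esub> (J +>\<^bsub>R\<^esub> x)"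
proof -
  have "J +>\<^bsub>R\<^esub> (a \<otimes>\<^bsub>R\<^esub> y) = J +>\<^bsub>R\<^esub> (a \<otimes>\<^bsub>R\<^esub> x)" if y: "y \<in> J +>\<^bsub>R\<^esub> x" for y
  proof -
    obtain j where j: "j \<in> J" "y = j \<oplus>\<^bsub>R\<^esub> x" using y unfolding a_r_coset_def' by blast
    have jc: "j \<in> carrier R" using j J.a_Hcarr by blast
    have "a \<otimes>\<^bsub>R\<^esub> y \<ominus>\<^bsub>R\<^esub> (a \<otimes>\<^bsub>R\<^esub> x) = a \<otimes>\<^bsub>R\<^esub> j"
      using jc j assms by (simp add: r_distr a_minus_def a_assoc r_neg)
    then show ?thesis
      using j jc assms J.I_l_closed by (subst coset_eq_iff) auto
  qed
  moreover have "x \<in> J +>\<^bsub>R\<^esub> x" by (rule J.a_rcos_self[OF assms(2)])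
  ultimately have "(\<Union>y\<in>J +>\<^bsub>R\<^esub> x. J +>\<^bsub>R\<^esub> (a \<otimes>\<^bsub>R\<^esub> y)) = J +>\<^bsub>R\<^esub> (a \<otimes>\<^bsub>R\<^esub> x)"
    by blast
  then show ?thesis
    by (simp add: quot_module_def coset_ring_module)
qed

lemma quot_ring_module_zero: "\<zero>\<^bsub>quot_module (ring_module R) J\<^esub> = J +>\<^bsub>R\<^esub> \<zero>\<^bsub>R\<^esub>"
  using a_coset_add_zero[OF J.a_subset] by (simp add: quot_module_def)

lemma module_quot_ring_module: "module R (quot_module (ring_module R) J)"
  by (rule image_module[OF module_ring_module[OF R], where \<pi> = "\<lambda>x. J +>\<^bsub>R\<^esub> x"])
    (simp_all add: carrier_quot_ring_module quot_ring_module_add quot_ring_module_smult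
      quot_ring_module_zero)

lemma coset_hom: "(\<lambda>x. J +>\<^bsub>R\<^esub> x) \<in> module_hom R (ring_module R) (quot_module (ring_module R) J)"
  by (rule module_homI)
    (simp_all add: carrier_quot_ring_module quot_ring_module_add quot_ring_module_smult)

lemma coset_eq_zero_iff:
  assumes "x \<in> carrier R"
  shows "J +>\<^bsub>R\<^esub> x = \<zero>\<^bsub>quot_module (ring_module R) J\<^esub> \<longleftrightarrow> x \<in> J"
  using coset_eq_iff[OF assms zero_closed] assms by (simp add: quot_ring_module_zero a_minus_def)

end

section \<open>Koszul cohomology\<close>

text \<open>A Boolean list marks a subset of the positions of \<open>xs\<close>.  The Koszul complex of \<open>x # xs\<close> is the
  mapping cone of multiplication by \<open>x\<close> on the Koszul complex of \<open>xs\<close>; this is the recursion.\<close>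

fun kdiff :: "('a, 'm) module \<Rightarrow> 'a list \<Rightarrow> (bool list \<Rightarrow> 'm) \<Rightarrow> bool list \<Rightarrow> 'm" where
  "kdiff M [] c bs = \<zero>\<^bsub>M\<^esub>"
| "kdiff M (x # xs) c [] = \<zero>\<^bsub>M\<^esub>"
| "kdiff M (x # xs) c (False # bs) = kdiff M xs (\<lambda>b. c (False # b)) bs"
| "kdiff M (x # xs) c (True # bs) = x \<odot>\<^bsub>M\<^esub> c (False # bs) \<ominus>\<^bsub>M\<^esub> kdiff M xs (\<lambda>b. c (True # b)) bs"

text \<open>Degrees are integers because cochains of degree \<open>-1\<close> vanish, which makes degree \<open>0\<close> no special
  case of exactness.\<close>

definition cochains :: "'m \<Rightarrow> 'm set \<Rightarrow> nat \<Rightarrow> int \<Rightarrow> (bool list \<Rightarrow> 'm) set" where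
  "cochains z H n p =
     {c. \<forall>bs. c bs \<in> H \<and> (c bs \<noteq> z \<longrightarrow> length bs = n \<and> int (count_list bs True) = p)}"

lemma cochainsD:
  assumes "c \<in> cochains z H n p"
  shows "c bs \<in> H" and "length bs \<noteq> n \<or> int (count_list bs True) \<noteq> p \<Longrightarrow> c bs = z"
  using assms by (auto simp: cochains_def)

lemma cochains_Cons:
  assumes "c \<in> cochains z H (Suc n) p"
  shows "(\<lambda>b. c (False # b)) \<in> cochains z H n p" "(\<lambda>b. c (True # b)) \<in> cochains z H n (p - 1)"
  using assms by (fastforce simp: cochains_def)+

lemma cochains_mono: "H \<subseteq> H' \<Longrightarrow> cochains z H n p \<subseteq> cochains z H' n p"
  by (auto simp: cochains_def)

lemma cochains_negative:
  assumes "c \<in> cochains z H n p" "p < 0"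
  shows "c = (\<lambda>bs. z)"
proof
  fix bs show "c bs = z" by (rule cochainsD(2)[OF assms(1)]) (use assms(2) in auto)
qed

lemma bool_list_cases:
  obtains "bs = []" | bs' where "bs = False # bs'" | bs' where "bs = True # bs'"
  by (metis (full_types) neq_Nil_conv)

lemma kdiff_hom:
  assumes "module R M" "module R N" "f \<in> module_hom R M N" "set xs \<subseteq> carrier R"
    and "\<And>b. c b \<in> carrier M"
  shows "kdiff M xs c bs \<in> carrier M" "kdiff N xs (\<lambda>b. f (c b)) bs = f (kdiff M xs c bs)"
proof -
  interpret M: module R M by fact
  interpret N: module R N by fact
  have "kdiff M xs c bs \<in> carrier M \<and> kdiff N xs (\<lambda>b. f (c b)) bs = f (kdiff M xs c bs)"
    using assms(4,5)
  proof (induction xs arbitrary: c bs)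
    case Nil
    then show ?case using module_hom_zero[OF assms(1-3)] by simp
  next
    case (Cons x xs)
    note IH = Cons.IH[of "\<lambda>b. c (_ # b)"]
    consider "bs = []" | bs' where "bs = False # bs'" | bs' where "bs = True # bs'" by (rule bool_list_cases)
    then show ?case
    proof cases
      case 1
      then show ?thesis using module_hom_zero[OF assms(1-3)] by simp
    next
      case 2
      then show ?thesis using Cons.prems IH by simp
    next
      case 3
      then show ?thesis using Cons.prems IH module_homD[OF assms(3)]
        by (simp add: module_hom_minus[OF assms(1-3)])
    qed
  qed
  then show "kdiff M xs c bs \<in> carrier M" "kdiff N xs (\<lambda>b. f (c b)) bs = f (kdiff M xs c bs)"
    by auto
qed

lemma id_module_hom: "(\<lambda>x. x) \<in> module_hom R M M"
  by (simp add: module_hom_def)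

text \<open>The dual of a regular sequence.\<close>

fun koszul_surj :: "('a, 'm) module \<Rightarrow> 'm set \<Rightarrow> 'a list \<Rightarrow> bool" where
  "koszul_surj M H [] \<longleftrightarrow> True"
| "koszul_surj M H (x # xs) \<longleftrightarrow> (\<forall>m\<in>H. \<exists>m'\<in>H. x \<odot>\<^bsub>M\<^esub> m' = m) \<and>
     koszul_surj M {m \<in> H. x \<odot>\<^bsub>M\<^esub> m = \<zero>\<^bsub>M\<^esub>} xs"

context
  fixes R :: "('a, 'r) ring_scheme" and M :: "('a, 'm) module"
  assumes M: "module R M"
begin

interpretation M: module R M by (rule M)

lemmas kdiff_carrier = kdiff_hom(1)[OF M M id_module_hom]

lemma smult_hom: "a \<in> carrier R \<Longrightarrow> (\<lambda>x. a \<odot>\<^bsub>M\<^esub> x) \<in> module_hom R M M"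
  by (rule module_homI) (auto simp: M.smult_r_distr M.R.m_comm simp flip: M.smult_assoc1)

lemma uminus_hom: "(\<lambda>x. \<ominus>\<^bsub>M\<^esub> x) \<in> module_hom R M M"
  by (rule module_homI) (auto simp: M.M.minus_add M.smult_r_minus)

lemma kdiff_smult:
  "set xs \<subseteq> carrier R \<Longrightarrow> a \<in> carrier R \<Longrightarrow> (\<And>b. c b \<in> carrier M) \<Longrightarrow>
    kdiff M xs (\<lambda>b. a \<odot>\<^bsub>M\<^esub> c b) bs = a \<odot>\<^bsub>M\<^esub> kdiff M xs c bs"
  by (rule kdiff_hom(2)[OF M M smult_hom])

lemma kdiff_uminus:
  "set xs \<subseteq> carrier R \<Longrightarrow> (\<And>b. c b \<in> carrier M) \<Longrightarrow> kdiff M xs (\<lambda>b. \<ominus>\<^bsub>M\<^esub> c b) bs = \<ominus>\<^bsub>M\<^esub> kdiff M xs c bs"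
  by (rule kdiff_hom(2)[OF M M uminus_hom])

lemma minus_zero_module: "\<ominus>\<^bsub>M\<^esub> \<zero>\<^bsub>M\<^esub> = \<zero>\<^bsub>M\<^esub>"
  by (rule M.M.minus_equality) auto

lemma kdiff_add:
  "set xs \<subseteq> carrier R \<Longrightarrow> (\<And>b. c b \<in> carrier M) \<Longrightarrow> (\<And>b. d b \<in> carrier M) \<Longrightarrow>
    kdiff M xs (\<lambda>b. c b \<oplus>\<^bsub>M\<^esub> d b) bs = kdiff M xs c bs \<oplus>\<^bsub>M\<^esub> kdiff M xs d bs"
proof (induction xs arbitrary: c d bs)
  case (Cons x xs)
  note kc = kdiff_hom(1)[OF M M id_module_hom, of xs "\<lambda>b. _ (_ # b)"]
  consider "bs = []" | bs' where "bs = False # bs'" | bs' where "bs = True # bs'" by (rule bool_list_cases)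
  then show ?case
  proof cases
    case 3
    then show ?thesis using Cons.prems Cons.IH[of "\<lambda>b. c (_ # b)" "\<lambda>b. d (_ # b)"] kc
      by (simp add: M.smult_r_distr a_minus_def M.M.minus_add M.M.a_ac)
  qed (use Cons in auto)
qed simp

lemma kdiff_minus:
  assumes "set xs \<subseteq> carrier R" "\<And>b. c b \<in> carrier M" "\<And>b. d b \<in> carrier M"
  shows "kdiff M xs (\<lambda>b. c b \<ominus>\<^bsub>M\<^esub> d b) bs = kdiff M xs c bs \<ominus>\<^bsub>M\<^esub> kdiff M xs d bs"
  unfolding a_minus_def using assms by (simp add: kdiff_add kdiff_uminus)

lemma kdiff_zero: "set xs \<subseteq> carrier R \<Longrightarrow> kdiff M xs (\<lambda>b. \<zero>\<^bsub>M\<^esub>) bs = \<zero>\<^bsub>M\<^esub>"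
proof -
  assume xs: "set xs \<subseteq> carrier R"
  have "kdiff M xs (\<lambda>b. \<zero>\<^bsub>R\<^esub> \<odot>\<^bsub>M\<^esub> \<zero>\<^bsub>M\<^esub>) bs = \<zero>\<^bsub>R\<^esub> \<odot>\<^bsub>M\<^esub> kdiff M xs (\<lambda>b. \<zero>\<^bsub>M\<^esub>) bs"
    by (rule kdiff_smult[OF xs]) auto
  then show ?thesis using kdiff_carrier[OF xs, of "\<lambda>b. \<zero>\<^bsub>M\<^esub>"] by simp
qed

lemma kdiff_cochains:
  assumes xs: "set xs \<subseteq> carrier R" and H: "submodule H R M" and c: "c \<in> cochains \<zero>\<^bsub>M\<^esub> H (length xs) p"
  shows "kdiff M xs c \<in> cochains \<zero>\<^bsub>M\<^esub> H (length xs) (p + 1)"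
proof -
  note H' = M.submoduleE[OF H]
  have z: "\<zero>\<^bsub>M\<^esub> \<in> H" by (rule submodule_zero[OF H])
  have "kdiff M xs c bs \<in> H \<and> (kdiff M xs c bs \<noteq> \<zero>\<^bsub>M\<^esub> \<longrightarrow>
    length bs = length xs \<and> int (count_list bs True) = p + 1)" for bs
    using c xs
  proof (induction xs arbitrary: c p bs)
    case Nil
    then show ?case using z by simp
  next
    case (Cons x xs)
    consider "bs = []" | bs' where "bs = False # bs'" | bs' where "bs = True # bs'" by (rule bool_list_cases)
    then show ?case
    proof cases
      case 1
      then show ?thesis using z by simp
    next
      case 2
      then show ?thesis using Cons.IH[OF cochains_Cons(1)] Cons.prems by simp
    next
      case 3
      have c: "c \<in> cochains \<zero>\<^bsub>M\<^esub> H (Suc (length xs)) p" using Cons.prems by simp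
      have x: "x \<in> carrier R" using Cons.prems by simp
      note IH = Cons.IH[OF cochains_Cons(2)[OF c], of bs']
      let ?d = "kdiff M xs (\<lambda>b. c (True # b)) bs'"
      have d: "?d \<in> H" "?d \<noteq> \<zero>\<^bsub>M\<^esub> \<Longrightarrow> length bs' = length xs \<and> int (count_list bs' True) = p"
        using IH Cons.prems by auto
      have e: "c (False # bs') \<in> H" "c (False # bs') \<noteq> \<zero>\<^bsub>M\<^esub> \<Longrightarrow>
         length bs' = length xs \<and> int (count_list bs' True) = p"
        using cochainsD[OF c, of "False # bs'"] by auto
      have "x \<odot>\<^bsub>M\<^esub> c (False # bs') \<ominus>\<^bsub>M\<^esub> ?d \<in> H"
        unfolding a_minus_def using d(1) e(1) H' x by blast
      moreover have "length bs' = length xs \<and> int (count_list bs' True) = p"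
        if "x \<odot>\<^bsub>M\<^esub> c (False # bs') \<ominus>\<^bsub>M\<^esub> ?d \<noteq> \<zero>\<^bsub>M\<^esub>"
      proof (cases "c (False # bs') = \<zero>\<^bsub>M\<^esub>")
        case True
        then have "?d \<noteq> \<zero>\<^bsub>M\<^esub>" using that x by (auto simp: a_minus_def minus_zero_module)
        then show ?thesis by (rule d)
      qed (rule e)
      ultimately show ?thesis using 3 by auto
    qed
  qed
  then show ?thesis by (simp add: cochains_def)
qed

lemma kdiff_kdiff:
  "set xs \<subseteq> carrier R \<Longrightarrow> (\<And>b. c b \<in> carrier M) \<Longrightarrow> kdiff M xs (kdiff M xs c) bs = \<zero>\<^bsub>M\<^esub>"
proof (induction xs arbitrary: c bs)
  case (Cons x xs)
  have xs: "set xs \<subseteq> carrier R" "x \<in> carrier R" using Cons.prems by auto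
  note kc = kdiff_carrier[OF xs(1)]
  note IH = Cons.IH[OF xs(1)]
  consider "bs = []" | bs' where "bs = False # bs'" | bs' where "bs = True # bs'" by (rule bool_list_cases)
  then show ?case
  proof cases
    case 2
    then show ?thesis using Cons.prems IH by simp
  next
    case 3
    let ?c0 = "\<lambda>b. c (False # b)" and ?c1 = "\<lambda>b. c (True # b)"
    have c: "?c0 b \<in> carrier M" "?c1 b \<in> carrier M" for b using Cons.prems by auto
    have "kdiff M xs (\<lambda>b. x \<odot>\<^bsub>M\<^esub> ?c0 b \<ominus>\<^bsub>M\<^esub> kdiff M xs ?c1 b) bs' =
      x \<odot>\<^bsub>M\<^esub> kdiff M xs ?c0 bs' \<ominus>\<^bsub>M\<^esub> \<zero>\<^bsub>M\<^esub>"
      using c kc[of ?c1] xs IH[of ?c1] by (simp add: kdiff_minus kdiff_smult)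
    then show ?thesis
      using 3 c kc[of ?c0] xs
      by (simp add: a_minus_def minus_zero_module M.M.r_neg)
  qed simp
qed simp

lemma submodule_annihilated:
  assumes H: "submodule H R M" and x: "x \<in> carrier R"
  shows "submodule {m \<in> H. x \<odot>\<^bsub>M\<^esub> m = \<zero>\<^bsub>M\<^esub>} R M"
proof -
  note H' = M.submoduleE[OF H]
  have z: "\<zero>\<^bsub>M\<^esub> \<in> H" by (rule submodule_zero[OF H])
  show ?thesis
  proof (rule M.submoduleI)
    fix a m assume am: "a \<in> carrier R" "m \<in> {m \<in> H. x \<odot>\<^bsub>M\<^esub> m = \<zero>\<^bsub>M\<^esub>}"
    have m: "m \<in> carrier M" using am H'(1) by auto
    have "x \<odot>\<^bsub>M\<^esub> (a \<odot>\<^bsub>M\<^esub> m) = a \<odot>\<^bsub>M\<^esub> (x \<odot>\<^bsub>M\<^esub> m)"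
      unfolding M.smult_assoc1[OF x am(1) m, symmetric] M.smult_assoc1[OF am(1) x m, symmetric]
      using am x by (simp add: M.R.m_comm)
    with am show "a \<odot>\<^bsub>M\<^esub> m \<in> {m \<in> H. x \<odot>\<^bsub>M\<^esub> m = \<zero>\<^bsub>M\<^esub>}"
      using H'(4) by simp
  next
    fix m n assume "m \<in> {m \<in> H. x \<odot>\<^bsub>M\<^esub> m = \<zero>\<^bsub>M\<^esub>}" "n \<in> {m \<in> H. x \<odot>\<^bsub>M\<^esub> m = \<zero>\<^bsub>M\<^esub>}"
    then show "m \<oplus>\<^bsub>M\<^esub> n \<in> {m \<in> H. x \<odot>\<^bsub>M\<^esub> m = \<zero>\<^bsub>M\<^esub>}"
      using x H'(5) subsetD[OF H'(1)] by (simp add: M.smult_r_distr)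
  next
    fix m assume "m \<in> {m \<in> H. x \<odot>\<^bsub>M\<^esub> m = \<zero>\<^bsub>M\<^esub>}"
    then show "\<ominus>\<^bsub>M\<^esub> m \<in> {m \<in> H. x \<odot>\<^bsub>M\<^esub> m = \<zero>\<^bsub>M\<^esub>}"
      using x H'(3) subsetD[OF H'(1)] by (simp add: M.smult_r_minus minus_zero_module)
  qed (use H'(1) z x in auto)
qed

text \<open>Induction on the sequence. The part of \<open>c\<close> that contains \<open>x\<close>
  is divided by \<open>x\<close> using surjectivity, and what is left of the other part after
  subtracting a coboundary is annihilated by \<open>x\<close>. By definition of
  \<open>koszul_surj\<close> the rest of the sequence is again surjective on that
  annihilator.\<close>

lemma koszul_acyclic:
  assumes "submodule H R M" "set xs \<subseteq> carrier R" "koszul_surj M H xs"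
    "c \<in> cochains \<zero>\<^bsub>M\<^esub> H (length xs) p" "0 < p" "kdiff M xs c = (\<lambda>bs. \<zero>\<^bsub>M\<^esub>)"
  shows "\<exists>b \<in> cochains \<zero>\<^bsub>M\<^esub> H (length xs) (p - 1). kdiff M xs b = c"
  using assms
proof (induction xs arbitrary: H c)
  case Nil
  have "c bs = \<zero>\<^bsub>M\<^esub>" for bs
    by (rule cochainsD(2)[OF Nil(4)]) (use Nil(5) in \<open>cases bs; auto\<close>)
  moreover have "\<zero>\<^bsub>M\<^esub> \<in> H" by (rule submodule_zero[OF Nil(1)])
  ultimately show ?case
    by (intro bexI[of _ "\<lambda>bs. \<zero>\<^bsub>M\<^esub>"]) (auto simp: cochains_def)
next
  case (Cons x xs)
  let ?z = "\<zero>\<^bsub>M\<^esub>"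
  let ?H' = "{m \<in> H. x \<odot>\<^bsub>M\<^esub> m = ?z}"
  let ?n = "length xs"
  have xs: "set xs \<subseteq> carrier R" "x \<in> carrier R" using Cons.prems by auto
  note H = Cons.prems(1)
  note sub = M.submoduleE[OF H]
  have z: "?z \<in> H" by (rule submodule_zero[OF H])
  note H' = submodule_annihilated[OF H xs(2)]
  have c: "c \<in> cochains ?z H (Suc ?n) p" using Cons.prems by simp
  define c0 c1 where "c0 = (\<lambda>b. c (False # b))" and "c1 = (\<lambda>b. c (True # b))"
  have c0: "c0 \<in> cochains ?z H ?n p" and c1: "c1 \<in> cochains ?z H ?n (p - 1)"
    using cochains_Cons[OF c] by (simp_all add: c0_def c1_def)
  have cc: "c0 b \<in> carrier M" "c1 b \<in> carrier M" for b
    using cochainsD(1)[OF c0] cochainsD(1)[OF c1] sub(1) by auto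
  have dc0: "kdiff M xs c0 bs = ?z" for bs
    using fun_cong[OF Cons.prems(6), of "False # bs"] by (simp add: c0_def)
  have dc1: "kdiff M xs c1 bs = x \<odot>\<^bsub>M\<^esub> c0 bs" for bs
  proof -
    have "x \<odot>\<^bsub>M\<^esub> c0 bs \<ominus>\<^bsub>M\<^esub> kdiff M xs c1 bs = ?z"
      using fun_cong[OF Cons.prems(6), of "True # bs"] by (simp add: c0_def c1_def)
    then have "x \<odot>\<^bsub>M\<^esub> c0 bs \<oplus>\<^bsub>M\<^esub> (\<ominus>\<^bsub>M\<^esub> kdiff M xs c1 bs \<oplus>\<^bsub>M\<^esub> kdiff M xs c1 bs) = kdiff M xs c1 bs"
      using xs cc kdiff_carrier[OF xs(1), of c1] by (simp add: a_minus_def flip: M.M.a_assoc)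
    then show ?thesis
      using xs cc kdiff_carrier[OF xs(1), of c1] by (simp add: M.M.l_neg)
  qed
  \<comment> \<open>Zero is divided as zero, so that \<open>b\<close> keeps the support of
    \<open>c1\<close>.\<close>
  define b where "b bs = (if c1 bs = ?z then ?z else (SOME m. m \<in> H \<and> x \<odot>\<^bsub>M\<^esub> m = c1 bs))" for bs
  have surj: "\<exists>m. m \<in> H \<and> x \<odot>\<^bsub>M\<^esub> m = c1 bs" for bs
    using Cons.prems(3) cochainsD(1)[OF c1] by auto
  have b: "b bs \<in> H" "x \<odot>\<^bsub>M\<^esub> b bs = c1 bs" for bs
    using someI_ex[OF surj[of bs]] z xs by (auto simp: b_def)
  have b_coch: "b \<in> cochains ?z H ?n (p - 1)"
    using b(1) cochainsD(2)[OF c1] unfolding cochains_def b_def by auto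
  have bc: "b bs \<in> carrier M" for bs using b(1) sub(1) by auto
  \<comment> \<open>Since \<open>x\<close> times \<open>b\<close> is \<open>c1\<close>, the
    coboundary of \<open>b\<close> and the cochain \<open>c0\<close> have the same multiple by
    \<open>x\<close>; hence \<open>e\<close> takes values in the annihilator of
    \<open>x\<close>.\<close>
  define e where "e bs = c0 bs \<ominus>\<^bsub>M\<^esub> kdiff M xs b bs" for bs
  have db: "kdiff M xs b \<in> cochains ?z H ?n p"
    using kdiff_cochains[OF xs(1) H b_coch] by simp
  have dbc: "kdiff M xs b bs \<in> carrier M" for bs
    using kdiff_carrier[OF xs(1)] bc by auto
  have xdb: "x \<odot>\<^bsub>M\<^esub> kdiff M xs b bs = x \<odot>\<^bsub>M\<^esub> c0 bs" for bs
  proof -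
    have "x \<odot>\<^bsub>M\<^esub> kdiff M xs b bs = kdiff M xs (\<lambda>bs. x \<odot>\<^bsub>M\<^esub> b bs) bs"
      by (rule kdiff_smult[symmetric]) (use xs bc in auto)
    also have "\<dots> = kdiff M xs c1 bs" by (simp add: b(2))
    finally show ?thesis by (simp add: dc1)
  qed
  have eH: "e bs \<in> ?H'" for bs
  proof -
    have "x \<odot>\<^bsub>M\<^esub> e bs = ?z"
      using xs cc dbc by (simp add: e_def a_minus_def M.smult_r_distr M.smult_r_minus xdb M.M.r_neg)
    moreover have "e bs \<in> H"
      unfolding e_def a_minus_def using cochainsD(1)[OF c0] cochainsD(1)[OF db] sub by blast
    ultimately show ?thesis by simp
  qed
  have "length bs = ?n \<and> int (count_list bs True) = p" if "e bs \<noteq> ?z" for bs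
  proof -
    have "c0 bs \<noteq> ?z \<or> kdiff M xs b bs \<noteq> ?z"
      using that by (auto simp: e_def a_minus_def minus_zero_module)
    then show ?thesis
      using cochainsD(2)[OF c0] cochainsD(2)[OF db] by blast
  qed
  with eH have "e \<in> cochains ?z ?H' ?n p"
    unfolding cochains_def by blast
  moreover have "kdiff M xs e = (\<lambda>bs. ?z)"
  proof
    fix bs
    have "kdiff M xs e bs = kdiff M xs c0 bs \<ominus>\<^bsub>M\<^esub> kdiff M xs (kdiff M xs b) bs"
      unfolding e_def by (rule kdiff_minus) (use xs cc dbc in auto)
    then show "kdiff M xs e bs = ?z"
      using xs bc by (simp add: dc0 kdiff_kdiff a_minus_def minus_zero_module)
  qed
  moreover have "koszul_surj M ?H' xs" using Cons.prems(3) by simp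
  ultimately obtain b' where b': "b' \<in> cochains ?z ?H' ?n (p - 1)" "kdiff M xs b' = e"
    using Cons.IH[OF H' xs(1)] Cons.prems(5) by blast
  have b'H: "b' bs \<in> H" "x \<odot>\<^bsub>M\<^esub> b' bs = ?z" for bs
    using cochainsD(1)[OF b'(1), of bs] by auto
  have b'c: "b' bs \<in> carrier M" for bs using b'H(1) sub(1) by auto
  \<comment> \<open>The component at \<open>True\<close> is zero, because \<open>x (b + b')\<close>
    is already \<open>c1\<close>: the correction \<open>b'\<close> is annihilated by
    \<open>x\<close>.\<close>
  define B where "B bs = (case bs of False # bs' \<Rightarrow> b bs' \<oplus>\<^bsub>M\<^esub> b' bs' | _ \<Rightarrow> ?z)" for bs
  have B_simps: "B [] = ?z" "B (False # bs) = b bs \<oplus>\<^bsub>M\<^esub> b' bs" "B (True # bs) = ?z" for bs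
    by (simp_all add: B_def)
  have "B \<in> cochains ?z H (Suc ?n) (p - 1)"
    unfolding cochains_def
  proof (intro CollectI allI)
    fix bs
    consider "bs = []" | bs' where "bs = False # bs'" | bs' where "bs = True # bs'" by (rule bool_list_cases)
    then show "B bs \<in> H \<and> (B bs \<noteq> ?z \<longrightarrow> length bs = Suc ?n \<and> int (count_list bs True) = p - 1)"
    proof cases
      case 2
      have "b bs' \<noteq> ?z \<or> b' bs' \<noteq> ?z" if "B bs \<noteq> ?z"
        using that 2 by (auto simp: B_simps)
      then show ?thesis
        using cochainsD(2)[OF b_coch, of bs'] cochainsD(2)[OF b'(1), of bs'] b(1) b'H(1) sub(5) 2
        by (auto simp: B_simps)
    qed (use z in \<open>auto simp: B_simps\<close>)
  qed
  moreover have "kdiff M (x # xs) B bs = c bs" for bs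
  proof -
    consider "bs = []" | bs' where "bs = False # bs'" | bs' where "bs = True # bs'" by (rule bool_list_cases)
    then show ?thesis
    proof cases
      case 1
      then show ?thesis using cochainsD(2)[OF c, of "[]"] by simp
    next
      case 2
      have "kdiff M (x # xs) B bs = kdiff M xs b bs' \<oplus>\<^bsub>M\<^esub> e bs'"
        using 2 xs bc b'c by (simp add: B_simps kdiff_add b'(2))
      also have "\<dots> = c0 bs' \<oplus>\<^bsub>M\<^esub> (kdiff M xs b bs' \<oplus>\<^bsub>M\<^esub> \<ominus>\<^bsub>M\<^esub> kdiff M xs b bs')"
        using dbc cc by (simp add: e_def a_minus_def M.M.a_ac)
      also have "\<dots> = c0 bs'"
        using dbc cc by (simp add: M.M.r_neg)
      finally show ?thesis using 2 by (simp add: c0_def)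
    next
      case 3
      then show ?thesis
        using xs bc b'c cc by (simp add: B_simps kdiff_zero M.smult_r_distr b b'H a_minus_def minus_zero_module c1_def)
    qed
  qed
  ultimately show ?case by auto
qed

end

subsection \<open>Dimension shifting\<close>

definition koszul_exact :: "('a, 'm) module \<Rightarrow> 'm set \<Rightarrow> 'a list \<Rightarrow> int \<Rightarrow> bool" where
  "koszul_exact M H xs p \<longleftrightarrow>
     (\<forall>c\<in>cochains \<zero>\<^bsub>M\<^esub> H (length xs) p. kdiff M xs c = (\<lambda>bs. \<zero>\<^bsub>M\<^esub>) \<longrightarrow>
       (\<exists>b\<in>cochains \<zero>\<^bsub>M\<^esub> H (length xs) (p - 1). kdiff M xs b = c))"

text \<open>Surjectivity from the cohomology of \<open>M\<close> to that of the image, phrased with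
  cocycles. In the long exact sequence of kernel, \<open>M\<close> and image it lies between the
  vanishing statements for the two ends, so no connecting homomorphism has to be
  constructed.\<close>

definition koszul_lift :: "('a, 'm) module \<Rightarrow> ('a, 'n) module \<Rightarrow> ('m \<Rightarrow> 'n) \<Rightarrow> 'a list \<Rightarrow> int \<Rightarrow> bool" where
  "koszul_lift M N \<delta> xs p \<longleftrightarrow>
     (\<forall>c\<in>cochains \<zero>\<^bsub>N\<^esub> (\<delta> ` carrier M) (length xs) p. kdiff N xs c = (\<lambda>bs. \<zero>\<^bsub>N\<^esub>) \<longrightarrow>
       (\<exists>b\<in>cochains \<zero>\<^bsub>M\<^esub> (carrier M) (length xs) p.
          kdiff M xs b = (\<lambda>bs. \<zero>\<^bsub>M\<^esub>) \<and> (\<forall>bs. \<delta> (b bs) = c bs)))"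

lemma cochains_lift:
  assumes c: "c \<in> cochains z' (\<delta> ` H) n p" and z: "z \<in> H" "\<delta> z = z'"
  obtains b where "b \<in> cochains z H n p" "\<And>bs. \<delta> (b bs) = c bs"
proof -
  define b where "b bs = (if c bs = z' then z else (SOME m. m \<in> H \<and> \<delta> m = c bs))" for bs
  have ex: "\<exists>m. m \<in> H \<and> \<delta> m = c bs" for bs
    using cochainsD(1)[OF c, of bs] by auto
  have b: "b bs \<in> H" "\<delta> (b bs) = c bs" for bs
    using someI_ex[OF ex[of bs]] z by (auto simp: b_def)
  have "b \<in> cochains z H n p"
    using b(1) cochainsD(2)[OF c] unfolding cochains_def b_def by auto
  then show ?thesis using b that by blast
qed

lemma cochains_map:
  assumes "c \<in> cochains z H n p" "f z = z'" "\<And>m. m \<in> H \<Longrightarrow> f m \<in> H'"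
  shows "(\<lambda>bs. f (c bs)) \<in> cochains z' H' n p"
  using assms by (fastforce simp: cochains_def)

lemma submodule_kernel:
  assumes M: "module R M" and N: "module R N" and \<delta>: "\<delta> \<in> module_hom R M N"
  shows "submodule (a_kernel M N \<delta>) R M"
proof -
  interpret M: module R M by fact
  interpret N: module R N by fact
  show ?thesis
    by (rule M.submoduleI)
      (auto simp: a_kernel_def' module_hom_zero[OF M N \<delta>] module_hom_uminus[OF M N \<delta>] minus_zero_module[OF N]
        module_homD[OF \<delta>])
qed

context
  fixes R :: "('a, 'r) ring_scheme" and M :: "('a, 'm) module" and N :: "('a, 'n) module" and \<delta> xs
  assumes M: "module R M" and N: "module R N" and \<delta>: "\<delta> \<in> module_hom R M N"
    and xs: "set xs \<subseteq> carrier R"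
    and acyclic: "\<And>p. 0 < p \<Longrightarrow> koszul_exact M (carrier M) xs p"
begin

interpretation M: module R M by (rule M)
interpretation N: module R N by (rule N)

lemma cochains_minus:
  assumes "a \<in> cochains \<zero>\<^bsub>M\<^esub> (carrier M) n p" "b \<in> cochains \<zero>\<^bsub>M\<^esub> (carrier M) n p"
  shows "(\<lambda>bs. a bs \<ominus>\<^bsub>M\<^esub> b bs) \<in> cochains \<zero>\<^bsub>M\<^esub> (carrier M) n p"
  unfolding cochains_def
proof (intro CollectI allI conjI impI)
  fix bs
  show "a bs \<ominus>\<^bsub>M\<^esub> b bs \<in> carrier M"
    using cochainsD(1)[OF assms(1)] cochainsD(1)[OF assms(2)] by simp
  assume "a bs \<ominus>\<^bsub>M\<^esub> b bs \<noteq> \<zero>\<^bsub>M\<^esub>"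
  then have "a bs \<noteq> \<zero>\<^bsub>M\<^esub> \<or> b bs \<noteq> \<zero>\<^bsub>M\<^esub>"
    by (auto simp: a_minus_def minus_zero_module[OF M])
  then show "length bs = n" "int (count_list bs True) = p"
    using cochainsD(2)[OF assms(1)] cochainsD(2)[OF assms(2)] by blast+
qed

text \<open>The snake argument. A cochain whose coboundary lies in the kernel maps to a cocycle of
  the image, and a lift of that cocycle corrects the cochain to one with values in the kernel.
  Conversely, any cochain over a cocycle of the image has its coboundary in the kernel and can be
  corrected there.\<close>

lemma koszul_lift_iff_kernel: "koszul_lift M N \<delta> xs p \<longleftrightarrow> koszul_exact M (a_kernel M N \<delta>) xs (p + 1)"
  if p: "0 \<le> p"
proof
  let ?Z = "a_kernel M N \<delta>" and ?n = "length xs"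
  have Z: "?Z \<subseteq> carrier M" by (auto simp: a_kernel_def')
  assume lift: "koszul_lift M N \<delta> xs p"
  show "koszul_exact M ?Z xs (p + 1)"
    unfolding koszul_exact_def
  proof (intro ballI impI)
    fix c assume c: "c \<in> cochains \<zero>\<^bsub>M\<^esub> ?Z ?n (p + 1)" "kdiff M xs c = (\<lambda>bs. \<zero>\<^bsub>M\<^esub>)"
    then have "c \<in> cochains \<zero>\<^bsub>M\<^esub> (carrier M) ?n (p + 1)" using cochains_mono[OF Z] by blast
    then obtain b where b: "b \<in> cochains \<zero>\<^bsub>M\<^esub> (carrier M) ?n p" "kdiff M xs b = c"
      using acyclic[of "p + 1"] p c(2) unfolding koszul_exact_def by auto
    have "(\<lambda>bs. \<delta> (b bs)) \<in> cochains \<zero>\<^bsub>N\<^esub> (\<delta> ` carrier M) ?n p"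
      using b(1) by (rule cochains_map) (auto simp: module_hom_zero[OF M N \<delta>])
    moreover have "kdiff N xs (\<lambda>bs. \<delta> (b bs)) = (\<lambda>bs. \<zero>\<^bsub>N\<^esub>)"
      using kdiff_hom(2)[OF M N \<delta> xs cochainsD(1)[OF b(1)]] cochainsD(1)[OF c(1)]
      by (auto simp: b(2) a_kernel_def')
    ultimately obtain b1 where b1: "b1 \<in> cochains \<zero>\<^bsub>M\<^esub> (carrier M) ?n p"
      "kdiff M xs b1 = (\<lambda>bs. \<zero>\<^bsub>M\<^esub>)" "\<And>bs. \<delta> (b1 bs) = \<delta> (b bs)"
      using lift unfolding koszul_lift_def by blast
    have bc: "b bs \<in> carrier M" "b1 bs \<in> carrier M" for bs
      using cochainsD(1)[OF b(1)] cochainsD(1)[OF b1(1)] by auto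
    let ?z = "\<lambda>bs. b bs \<ominus>\<^bsub>M\<^esub> b1 bs"
    have "?z bs \<in> ?Z" for bs
    proof -
      have "\<delta> (?z bs) = \<delta> (b bs) \<ominus>\<^bsub>N\<^esub> \<delta> (b1 bs)"
        by (rule module_hom_minus[OF M N \<delta> bc])
      then show ?thesis
        using bc module_homD(1)[OF \<delta> bc(1)] by (simp add: a_kernel_def' b1(3) a_minus_def N.M.r_neg)
    qed
    then have "?z \<in> cochains \<zero>\<^bsub>M\<^esub> ?Z ?n p"
      using cochains_minus[OF b(1) b1(1)] by (auto simp: cochains_def)
    moreover have "kdiff M xs ?z bs = c bs" for bs
      using kdiff_minus[OF M xs, of b b1 bs] bc kdiff_carrier[OF M xs, of b bs]
      by (simp add: b(2) b1(2) a_minus_def minus_zero_module[OF M])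
    ultimately show "\<exists>b\<in>cochains \<zero>\<^bsub>M\<^esub> ?Z ?n (p + 1 - 1). kdiff M xs b = c"
      by (intro bexI[of _ ?z]) auto
  qed
next
  let ?Z = "a_kernel M N \<delta>" and ?n = "length xs"
  assume ex: "koszul_exact M ?Z xs (p + 1)"
  show "koszul_lift M N \<delta> xs p"
    unfolding koszul_lift_def
  proof (intro ballI impI)
    fix c assume c: "c \<in> cochains \<zero>\<^bsub>N\<^esub> (\<delta> ` carrier M) ?n p" "kdiff N xs c = (\<lambda>bs. \<zero>\<^bsub>N\<^esub>)"
    obtain b where b: "b \<in> cochains \<zero>\<^bsub>M\<^esub> (carrier M) ?n p" "\<And>bs. \<delta> (b bs) = c bs"
      using cochains_lift[OF c(1) M.M.zero_closed module_hom_zero[OF M N \<delta>]] by blast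
    have bc: "b bs \<in> carrier M" for bs using cochainsD(1)[OF b(1)] .
    note db = kdiff_cochains[OF M xs submodule_carrier[OF M] b(1)]
    have "\<delta> (kdiff M xs b bs) = \<zero>\<^bsub>N\<^esub>" for bs
      using kdiff_hom(2)[OF M N \<delta> xs, of b bs] bc c(2) by (simp add: b(2))
    then have "kdiff M xs b \<in> cochains \<zero>\<^bsub>M\<^esub> ?Z ?n (p + 1)"
      using db by (auto simp: cochains_def a_kernel_def')
    moreover have "kdiff M xs (kdiff M xs b) = (\<lambda>bs. \<zero>\<^bsub>M\<^esub>)"
      using kdiff_kdiff[OF M xs bc] by auto
    ultimately obtain z where z: "z \<in> cochains \<zero>\<^bsub>M\<^esub> ?Z ?n p" "kdiff M xs z = kdiff M xs b"
      using ex unfolding koszul_exact_def by fastforce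
    have zc: "z bs \<in> carrier M" "\<delta> (z bs) = \<zero>\<^bsub>N\<^esub>" for bs
      using cochainsD(1)[OF z(1), of bs] by (auto simp: a_kernel_def')
    have "z \<in> cochains \<zero>\<^bsub>M\<^esub> (carrier M) ?n p"
      using z(1) zc(1) by (auto simp: cochains_def)
    note cochains_minus[OF b(1) this]
    moreover have "kdiff M xs (\<lambda>bs. b bs \<ominus>\<^bsub>M\<^esub> z bs) = (\<lambda>bs. \<zero>\<^bsub>M\<^esub>)"
      using kdiff_minus[OF M xs, of b z] bc zc kdiff_carrier[OF M xs bc]
      by (auto simp: z(2) a_minus_def M.M.r_neg)
    moreover have "\<delta> (b bs \<ominus>\<^bsub>M\<^esub> z bs) = c bs" for bs
    proof -
      have "\<delta> (b bs \<ominus>\<^bsub>M\<^esub> z bs) = \<delta> (b bs) \<ominus>\<^bsub>N\<^esub> \<delta> (z bs)"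
        by (rule module_hom_minus[OF M N \<delta> bc zc(1)])
      then show ?thesis
        using module_homD(1)[OF \<delta> bc[of bs]] zc(2) by (simp add: a_minus_def minus_zero_module[OF N] b(2))
    qed
    ultimately show "\<exists>b\<in>cochains \<zero>\<^bsub>M\<^esub> (carrier M) ?n p.
        kdiff M xs b = (\<lambda>bs. \<zero>\<^bsub>M\<^esub>) \<and> (\<forall>bs. \<delta> (b bs) = c bs)"
      by blast
  qed
qed

text \<open>In positive degree the cocycles of \<open>M\<close> are coboundaries, so lifting a
  cocycle of the image and bounding it amount to the same.\<close>

lemma koszul_lift_iff_image: "koszul_lift M N \<delta> xs p \<longleftrightarrow> koszul_exact N (\<delta> ` carrier M) xs p"
  if p: "0 < p"
proof
  let ?n = "length xs"
  assume lift: "koszul_lift M N \<delta> xs p"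
  show "koszul_exact N (\<delta> ` carrier M) xs p"
    unfolding koszul_exact_def
  proof (intro ballI impI)
    fix c assume c: "c \<in> cochains \<zero>\<^bsub>N\<^esub> (\<delta> ` carrier M) ?n p" "kdiff N xs c = (\<lambda>bs. \<zero>\<^bsub>N\<^esub>)"
    then obtain b where b: "b \<in> cochains \<zero>\<^bsub>M\<^esub> (carrier M) ?n p" "kdiff M xs b = (\<lambda>bs. \<zero>\<^bsub>M\<^esub>)"
      "\<And>bs. \<delta> (b bs) = c bs"
      using lift unfolding koszul_lift_def by blast
    then obtain a where a: "a \<in> cochains \<zero>\<^bsub>M\<^esub> (carrier M) ?n (p - 1)" "kdiff M xs a = b"
      using acyclic[OF p] unfolding koszul_exact_def by blast
    have "(\<lambda>bs. \<delta> (a bs)) \<in> cochains \<zero>\<^bsub>N\<^esub> (\<delta> ` carrier M) ?n (p - 1)"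
      using a(1) by (rule cochains_map) (auto simp: module_hom_zero[OF M N \<delta>])
    moreover have "kdiff N xs (\<lambda>bs. \<delta> (a bs)) = c"
      using kdiff_hom(2)[OF M N \<delta> xs cochainsD(1)[OF a(1)]] by (auto simp: a(2) b(3))
    ultimately show "\<exists>b\<in>cochains \<zero>\<^bsub>N\<^esub> (\<delta> ` carrier M) ?n (p - 1). kdiff N xs b = c"
      by blast
  qed
next
  let ?n = "length xs"
  assume ex: "koszul_exact N (\<delta> ` carrier M) xs p"
  show "koszul_lift M N \<delta> xs p"
    unfolding koszul_lift_def
  proof (intro ballI impI)
    fix c assume c: "c \<in> cochains \<zero>\<^bsub>N\<^esub> (\<delta> ` carrier M) ?n p" "kdiff N xs c = (\<lambda>bs. \<zero>\<^bsub>N\<^esub>)"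
    then obtain a' where a': "a' \<in> cochains \<zero>\<^bsub>N\<^esub> (\<delta> ` carrier M) ?n (p - 1)" "kdiff N xs a' = c"
      using ex unfolding koszul_exact_def by blast
    obtain a where a: "a \<in> cochains \<zero>\<^bsub>M\<^esub> (carrier M) ?n (p - 1)" "\<And>bs. \<delta> (a bs) = a' bs"
      using cochains_lift[OF a'(1) M.M.zero_closed module_hom_zero[OF M N \<delta>]] by blast
    have ac: "a bs \<in> carrier M" for bs using cochainsD(1)[OF a(1)] .
    have "kdiff M xs a \<in> cochains \<zero>\<^bsub>M\<^esub> (carrier M) ?n p"
      using kdiff_cochains[OF M xs submodule_carrier[OF M] a(1)] by simp
    moreover have "kdiff M xs (kdiff M xs a) = (\<lambda>bs. \<zero>\<^bsub>M\<^esub>)"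
      using kdiff_kdiff[OF M xs ac] by auto
    moreover have "\<delta> (kdiff M xs a bs) = c bs" for bs
      using kdiff_hom(2)[OF M N \<delta> xs, of a bs] ac by (simp add: a(2) a'(2))
    ultimately show "\<exists>b\<in>cochains \<zero>\<^bsub>M\<^esub> (carrier M) ?n p.
        kdiff M xs b = (\<lambda>bs. \<zero>\<^bsub>M\<^esub>) \<and> (\<forall>bs. \<delta> (b bs) = c bs)"
      by blast
  qed
qed

end

lemma count_list_zero_iff: "count_list bs True = 0 \<longleftrightarrow> bs = replicate (length bs) False"
  by (induction bs) auto

text \<open>In degree 0 a cochain is a single element and the differential multiplies it by each
  entry of the sequence; this is the link between Koszul cohomology and socles.\<close>

lemma kdiff_degree_0:
  assumes "module R M" "set xs \<subseteq> carrier R" "c \<in> cochains \<zero>\<^bsub>M\<^esub> (carrier M) (length xs) 0"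
  shows "kdiff M xs c = (\<lambda>bs. \<zero>\<^bsub>M\<^esub>) \<longleftrightarrow> (\<forall>x\<in>set xs. x \<odot>\<^bsub>M\<^esub> c (replicate (length xs) False) = \<zero>\<^bsub>M\<^esub>)"
  using assms(2,3)
proof (induction xs arbitrary: c)
  case Nil
  then show ?case by auto
next
  case (Cons x xs)
  interpret M: module R M by fact
  let ?c0 = "\<lambda>b. c (False # b)" and ?f = "replicate (length xs) False"
  have c: "c \<in> cochains \<zero>\<^bsub>M\<^esub> (carrier M) (Suc (length xs)) 0" using Cons.prems by simp
  have c0: "?c0 \<in> cochains \<zero>\<^bsub>M\<^esub> (carrier M) (length xs) 0"
    and c1: "(\<lambda>b. c (True # b)) = (\<lambda>bs. \<zero>\<^bsub>M\<^esub>)"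
    using cochains_Cons[OF c] cochains_negative[OF cochains_Cons(2)[OF c]] by auto
  have xs: "set xs \<subseteq> carrier R" "x \<in> carrier R" using Cons.prems by auto
  have T: "kdiff M (x # xs) c (True # bs) = x \<odot>\<^bsub>M\<^esub> ?c0 bs" for bs
    using cochainsD(1)[OF c0, of bs] xs
    by (simp add: c1 kdiff_zero[OF assms(1)] a_minus_def minus_zero_module[OF assms(1)])
  have F: "kdiff M (x # xs) c (False # bs) = kdiff M xs ?c0 bs" for bs by simp
  have nz: "bs = ?f" if "?c0 bs \<noteq> \<zero>\<^bsub>M\<^esub>" for bs
    using cochainsD(2)[OF c0, of bs] that count_list_zero_iff[of bs] by auto
  have "kdiff M (x # xs) c = (\<lambda>bs. \<zero>\<^bsub>M\<^esub>) \<longleftrightarrow>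
     (\<forall>bs. kdiff M (x # xs) c (True # bs) = \<zero>\<^bsub>M\<^esub> \<and> kdiff M (x # xs) c (False # bs) = \<zero>\<^bsub>M\<^esub>)"
  proof
    assume *: "\<forall>bs. kdiff M (x # xs) c (True # bs) = \<zero>\<^bsub>M\<^esub> \<and> kdiff M (x # xs) c (False # bs) = \<zero>\<^bsub>M\<^esub>"
    show "kdiff M (x # xs) c = (\<lambda>bs. \<zero>\<^bsub>M\<^esub>)"
    proof
      fix bs
      consider "bs = []" | bs' where "bs = False # bs'" | bs' where "bs = True # bs'" by (rule bool_list_cases)
      then show "kdiff M (x # xs) c bs = \<zero>\<^bsub>M\<^esub>" using * by cases (simp_all del: kdiff.simps(3,4))
    qed
  qed auto
  also have "\<dots> \<longleftrightarrow> x \<odot>\<^bsub>M\<^esub> ?c0 ?f = \<zero>\<^bsub>M\<^esub> \<and> kdiff M xs ?c0 = (\<lambda>bs. \<zero>\<^bsub>M\<^esub>)"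
    unfolding T F using nz xs by (metis M.smult_r_null)
  finally show ?case using Cons.IH[OF xs(1) c0] by simp
qed

definition point_cochain :: "'m \<Rightarrow> nat \<Rightarrow> 'm \<Rightarrow> bool list \<Rightarrow> 'm" where
  "point_cochain z n m bs = (if bs = replicate n False then m else z)"

lemma point_cochain: "z \<in> H \<Longrightarrow> m \<in> H \<Longrightarrow> point_cochain z n m \<in> cochains z H n 0"
  by (auto simp: cochains_def point_cochain_def)

lemma cochains_0_eq_point:
  assumes "c \<in> cochains z H n 0"
  shows "c = point_cochain z n (c (replicate n False))"
proof
  fix bs
  show "c bs = point_cochain z n (c (replicate n False)) bs"
    using cochainsD(2)[OF assms, of bs] count_list_zero_iff[of bs] by (auto simp: point_cochain_def)
qed

text \<open>Exactness at place \<open>i\<close> of the complex \<open>Hom(S/(A), E)\<close>. If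
  \<open>E\<close> is an injective resolution of \<open>L\<close> and \<open>A\<close> consists of
  the variables, it says that \<open>Ext^i(k, L)\<close> vanishes.\<close>

definition ann_exact ::
  "(nat \<Rightarrow> ('a, 'm) module) \<Rightarrow> (nat \<Rightarrow> 'm \<Rightarrow> 'm) \<Rightarrow> 'a set \<Rightarrow> nat \<Rightarrow> bool" where
  "ann_exact E \<delta> A i \<longleftrightarrow>
     (\<forall>z\<in>a_kernel (E i) (E (Suc i)) (\<delta> i). (\<forall>a\<in>A. a \<odot>\<^bsub>E i\<^esub> z = \<zero>\<^bsub>E i\<^esub>) \<longrightarrow>
       z \<in> (case i of 0 \<Rightarrow> {\<zero>\<^bsub>E 0\<^esub>}
             | Suc k \<Rightarrow> \<delta> k ` {e \<in> carrier (E k). \<forall>a\<in>A. a \<odot>\<^bsub>E k\<^esub> e = \<zero>\<^bsub>E k\<^esub>}))"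

lemma koszul_lift_0_iff:
  assumes M: "module R M" and N: "module R N" and \<delta>: "\<delta> \<in> module_hom R M N" and xs: "set xs \<subseteq> carrier R"
  shows "koszul_lift M N \<delta> xs 0 \<longleftrightarrow>
    (\<forall>z\<in>\<delta> ` carrier M. (\<forall>x\<in>set xs. x \<odot>\<^bsub>N\<^esub> z = \<zero>\<^bsub>N\<^esub>) \<longrightarrow>
       z \<in> \<delta> ` {e \<in> carrier M. \<forall>x\<in>set xs. x \<odot>\<^bsub>M\<^esub> e = \<zero>\<^bsub>M\<^esub>})"
proof -
  interpret M: module R M by fact
  interpret N: module R N by fact
  let ?n = "length xs" let ?f = "replicate ?n False"
  have sub: "\<delta> ` carrier M \<subseteq> carrier N" using module_homD(1)[OF \<delta>] by auto
  note \<delta>0 = module_hom_zero[OF M N \<delta>]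
  have z: "\<zero>\<^bsub>N\<^esub> \<in> \<delta> ` carrier M" using \<delta>0 imageI[OF M.M.zero_closed, of \<delta>] by simp
  show ?thesis
  proof (intro iffI ballI impI)
    fix z assume lift: "koszul_lift M N \<delta> xs 0" and zz: "z \<in> \<delta> ` carrier M" "\<forall>x\<in>set xs. x \<odot>\<^bsub>N\<^esub> z = \<zero>\<^bsub>N\<^esub>"
    let ?c = "point_cochain \<zero>\<^bsub>N\<^esub> ?n z"
    have c: "?c \<in> cochains \<zero>\<^bsub>N\<^esub> (\<delta> ` carrier M) ?n 0"
      using z zz by (intro point_cochain)
    then have "?c \<in> cochains \<zero>\<^bsub>N\<^esub> (carrier N) ?n 0" using cochains_mono[OF sub] by blast
    moreover have "?c ?f = z" by (simp add: point_cochain_def)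
    ultimately have "kdiff N xs ?c = (\<lambda>bs. \<zero>\<^bsub>N\<^esub>)"
      using iffD2[OF kdiff_degree_0[OF N xs, of ?c]] zz(2) by (simp only: simp_thms) 
    with lift c obtain b where b: "b \<in> cochains \<zero>\<^bsub>M\<^esub> (carrier M) ?n 0"
      "kdiff M xs b = (\<lambda>bs. \<zero>\<^bsub>M\<^esub>)" "\<And>bs. \<delta> (b bs) = ?c bs"
      unfolding koszul_lift_def by blast
    have "\<forall>x\<in>set xs. x \<odot>\<^bsub>M\<^esub> b ?f = \<zero>\<^bsub>M\<^esub>"
      using kdiff_degree_0[OF M xs b(1)] b(2) by blast
    moreover have "\<delta> (b ?f) = z" by (simp add: b(3) point_cochain_def)
    ultimately show "z \<in> \<delta> ` {e \<in> carrier M. \<forall>x\<in>set xs. x \<odot>\<^bsub>M\<^esub> e = \<zero>\<^bsub>M\<^esub>}"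
      using cochainsD(1)[OF b(1), of ?f] by blast
  next
    assume *: "\<forall>z\<in>\<delta> ` carrier M. (\<forall>x\<in>set xs. x \<odot>\<^bsub>N\<^esub> z = \<zero>\<^bsub>N\<^esub>) \<longrightarrow>
       z \<in> \<delta> ` {e \<in> carrier M. \<forall>x\<in>set xs. x \<odot>\<^bsub>M\<^esub> e = \<zero>\<^bsub>M\<^esub>}"
    show "koszul_lift M N \<delta> xs 0"
      unfolding koszul_lift_def
    proof (intro ballI impI)
      fix c assume c: "c \<in> cochains \<zero>\<^bsub>N\<^esub> (\<delta> ` carrier M) ?n 0" "kdiff N xs c = (\<lambda>bs. \<zero>\<^bsub>N\<^esub>)"
      have "\<forall>x\<in>set xs. x \<odot>\<^bsub>N\<^esub> c ?f = \<zero>\<^bsub>N\<^esub>"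
        using iffD1[OF kdiff_degree_0[OF N xs subsetD[OF cochains_mono[OF sub] c(1)]] c(2)] .
      then have "c ?f \<in> \<delta> ` {e \<in> carrier M. \<forall>x\<in>set xs. x \<odot>\<^bsub>M\<^esub> e = \<zero>\<^bsub>M\<^esub>}"
        by (rule mp[OF bspec[OF * cochainsD(1)[OF c(1)]]])
      then obtain e where e: "e \<in> carrier M"
        "\<forall>x\<in>set xs. x \<odot>\<^bsub>M\<^esub> e = \<zero>\<^bsub>M\<^esub>" "c ?f = \<delta> e" by blast
      let ?b = "point_cochain \<zero>\<^bsub>M\<^esub> ?n e"
      have b: "?b \<in> cochains \<zero>\<^bsub>M\<^esub> (carrier M) ?n 0" using e by (intro point_cochain) auto
      moreover have "kdiff M xs ?b = (\<lambda>bs. \<zero>\<^bsub>M\<^esub>)"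
      proof (rule iffD2[OF kdiff_degree_0[OF M xs b]])
        show "\<forall>x\<in>set xs. x \<odot>\<^bsub>M\<^esub> ?b ?f = \<zero>\<^bsub>M\<^esub>" using e(2) by (simp add: point_cochain_def)
      qed
      moreover have "\<delta> (?b bs) = c bs" for bs
        using fun_cong[OF cochains_0_eq_point[OF c(1)], of bs] e(3) \<delta>0 by (simp add: point_cochain_def)
      ultimately show "\<exists>b\<in>cochains \<zero>\<^bsub>M\<^esub> (carrier M) ?n 0.
        kdiff M xs b = (\<lambda>bs. \<zero>\<^bsub>M\<^esub>) \<and> (\<forall>bs. \<delta> (b bs) = c bs)" by blast
    qed
  qed
qed

lemma koszul_exact_0_iff:
  assumes M: "module R M" and xs: "set xs \<subseteq> carrier R" and H: "submodule H R M"
  shows "koszul_exact M H xs 0 \<longleftrightarrow> (\<forall>z\<in>H. (\<forall>x\<in>set xs. x \<odot>\<^bsub>M\<^esub> z = \<zero>\<^bsub>M\<^esub>) \<longrightarrow> z = \<zero>\<^bsub>M\<^esub>)"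
proof -
  interpret M: module R M by fact
  let ?n = "length xs" let ?f = "replicate ?n False"
  have sub: "H \<subseteq> carrier M" using M.submoduleE[OF H] by blast
  have z: "\<zero>\<^bsub>M\<^esub> \<in> H" by (rule submodule_zero[OF H])
  show ?thesis
  proof (intro iffI ballI impI)
    fix z assume ex: "koszul_exact M H xs 0" and zz: "z \<in> H" "\<forall>x\<in>set xs. x \<odot>\<^bsub>M\<^esub> z = \<zero>\<^bsub>M\<^esub>"
    let ?c = "point_cochain \<zero>\<^bsub>M\<^esub> ?n z"
    have c: "?c \<in> cochains \<zero>\<^bsub>M\<^esub> H ?n 0"
      using z zz by (intro point_cochain)
    then have "?c \<in> cochains \<zero>\<^bsub>M\<^esub> (carrier M) ?n 0" using cochains_mono[OF sub] by blast
    moreover have "?c ?f = z" by (simp add: point_cochain_def)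
    ultimately have "kdiff M xs ?c = (\<lambda>bs. \<zero>\<^bsub>M\<^esub>)"
      using iffD2[OF kdiff_degree_0[OF M xs, of ?c]] zz(2) by (simp only: simp_thms)
    with ex c obtain b where b: "b \<in> cochains \<zero>\<^bsub>M\<^esub> H ?n (0 - 1)" "kdiff M xs b = ?c"
      unfolding koszul_exact_def by blast
    have "b = (\<lambda>bs. \<zero>\<^bsub>M\<^esub>)" using cochains_negative[OF b(1)] by simp
    then have "?c ?f = \<zero>\<^bsub>M\<^esub>" using fun_cong[OF b(2), of ?f] kdiff_zero[OF M xs, of ?f] by simp
    then show "z = \<zero>\<^bsub>M\<^esub>" by (simp add: point_cochain_def)
  next
    assume *: "\<forall>z\<in>H. (\<forall>x\<in>set xs. x \<odot>\<^bsub>M\<^esub> z = \<zero>\<^bsub>M\<^esub>) \<longrightarrow> z = \<zero>\<^bsub>M\<^esub>"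
    show "koszul_exact M H xs 0"
      unfolding koszul_exact_def
    proof (intro ballI impI)
      fix c assume c: "c \<in> cochains \<zero>\<^bsub>M\<^esub> H ?n 0" "kdiff M xs c = (\<lambda>bs. \<zero>\<^bsub>M\<^esub>)"
      have "\<forall>x\<in>set xs. x \<odot>\<^bsub>M\<^esub> c ?f = \<zero>\<^bsub>M\<^esub>"
        using iffD1[OF kdiff_degree_0[OF M xs subsetD[OF cochains_mono[OF sub] c(1)]] c(2)] .
      then have "c ?f = \<zero>\<^bsub>M\<^esub>" by (rule mp[OF bspec[OF * cochainsD(1)[OF c(1)]]])
      then have "c bs = \<zero>\<^bsub>M\<^esub>" for bs
        using fun_cong[OF cochains_0_eq_point[OF c(1)], of bs] by (simp add: point_cochain_def)
      then show "\<exists>b\<in>cochains \<zero>\<^bsub>M\<^esub> H ?n (0 - 1). kdiff M xs b = c"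
        using z kdiff_zero[OF M xs] by (intro bexI[of _ "\<lambda>bs. \<zero>\<^bsub>M\<^esub>"]) (auto simp: cochains_def)
    qed
  qed
qed

text \<open>Each kernel is the image of the preceding term, so the two descriptions of lifting can
  be used in turn: one step along the resolution lowers the Koszul degree by one. In degree 0
  lifting is a statement about annihilators.\<close>

lemma koszul_exact_iff_ann_exact:
  assumes E: "\<And>i. module R (E i)" and \<delta>: "\<And>i. \<delta> i \<in> module_hom R (E i) (E (Suc i))"
    and exact: "\<And>i. \<delta> i ` carrier (E i) = a_kernel (E (Suc i)) (E (Suc (Suc i))) (\<delta> (Suc i))"
    and xs: "set xs \<subseteq> carrier R"
    and acyclic: "\<And>i p. 0 < p \<Longrightarrow> koszul_exact (E i) (carrier (E i)) xs p"
  shows "koszul_exact (E 0) (a_kernel (E 0) (E 1) (\<delta> 0)) xs (int i) \<longleftrightarrow> ann_exact E \<delta> (set xs) i"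
proof (cases i)
  case 0
  then show ?thesis
    using koszul_exact_0_iff[OF E xs submodule_kernel[OF E E \<delta>], of 0] by (simp add: ann_exact_def)
next
  case (Suc k)
  note ker = koszul_lift_iff_kernel[OF E E \<delta> xs acyclic] and im = koszul_lift_iff_image[OF E E \<delta> xs acyclic]
  \<comment> \<open>Degree \<open>p + 1\<close> at place \<open>j\<close> turns into degree 0 at
    place \<open>j + p\<close>. The chain ends in a lifting statement, since lifting and exactness
    of the image were shown equivalent in positive degree only.\<close>
  have "koszul_exact (E j) (a_kernel (E j) (E (Suc j)) (\<delta> j)) xs (int p + 1) \<longleftrightarrow>
    koszul_lift (E (j + p)) (E (Suc (j + p))) (\<delta> (j + p)) xs 0" for j p
  proof (induction p arbitrary: j)
    case 0
    then show ?case using ker[of 0 j] by simp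
  next
    case (Suc p)
    have "koszul_exact (E j) (a_kernel (E j) (E (Suc j)) (\<delta> j)) xs (int (Suc p) + 1) \<longleftrightarrow>
      koszul_lift (E j) (E (Suc j)) (\<delta> j) xs (int p + 1)"
      using ker[of "int p + 1" j] by (simp add: add_ac)
    also have "\<dots> \<longleftrightarrow> koszul_exact (E (Suc j)) (a_kernel (E (Suc j)) (E (Suc (Suc j))) (\<delta> (Suc j))) xs (int p + 1)"
      using im[of "int p + 1" j] exact by simp
    also have "\<dots> \<longleftrightarrow> koszul_lift (E (Suc j + p)) (E (Suc (Suc j + p))) (\<delta> (Suc j + p)) xs 0"
      by (rule Suc.IH)
    finally show ?case by simp
  qed
  from this[of 0 k] show ?thesis
    using koszul_lift_0_iff[OF E E \<delta> xs, of k] exact[of k] Suc by (simp add: ann_exact_def add.commute)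
qed

section \<open>Injective modules over the polynomial ring\<close>

text \<open>Division by the monomial \<open>f\<close> that discards the terms not divisible by it.
  Being total and additive, it applies to cochains entry by entry without choices.\<close>

definition shift :: "'v monomial \<Rightarrow> ('v, 'k::field) mpoly \<Rightarrow> ('v, 'k) mpoly" where
  "shift f p = Poly_Mapping.map_key (\<lambda>m. m + f) p"

lemma lookup_shift: "lookup (shift f p) m = lookup p (m + f)"
proof -
  have "inj (\<lambda>m. m + f)" by (rule injI) simp
  then show ?thesis by (simp add: shift_def map_key.rep_eq)
qed

lemma lookup_xpow_mult_add: "lookup (xpow f * q) (m + f) = lookup q m"
proof -
  have "xpow f * q = (\<Sum>k\<in>keys q. Poly_Mapping.single (f + k) (lookup q k))"
    by (subst (1) poly_mapping_sum_single[of q, symmetric]) (simp add: sum_distrib_left mult_single)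
  then have "lookup (xpow f * q) (m + f) = (\<Sum>k\<in>keys q. lookup q k when f + k = m + f)"
    by (simp add: lookup_sum lookup_single)
  also have "\<dots> = (\<Sum>k\<in>keys q. lookup q k when k = m)"
    by (simp add: add.commute[of f])
  also have "\<dots> = lookup q m"
    by (simp add: when_def in_keys_iff)
  finally show ?thesis .
qed

lemma lookup_xpow_mult_eq_0:
  assumes "\<And>m. k \<noteq> m + f"
  shows "lookup (xpow f * q) k = 0"
proof -
  have "k \<notin> keys (xpow f * q)"
    using keys_mult[of "xpow f" q] assms by (auto simp: add.commute)
  then show ?thesis by (simp add: in_keys_iff)
qed

lemma shift_add: "shift f (p + q) = shift f p + shift f q"
  by (rule poly_mapping_eqI) (simp add: lookup_shift lookup_add)

lemma shift_0 [simp]: "shift f 0 = 0"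
  by (rule poly_mapping_eqI) (simp add: lookup_shift)

lemma shift_xpow_mult [simp]: "shift f (xpow f * q) = q"
  by (rule poly_mapping_eqI) (simp add: lookup_shift lookup_xpow_mult_add)

lemma shift_mon_ideal:
  assumes "p \<in> mon_ideal V U"
  shows "shift f p \<in> mon_ideal V {g. g + f \<in> U}"
  unfolding mon_ideal_def
proof (intro CollectI ballI)
  fix m assume "m \<in> keys (shift f p)"
  then have "m + f \<in> keys p" by (simp add: in_keys_iff lookup_shift)
  then have "keys (m + f) \<subseteq> V \<and> m + f \<in> U"
    using assms unfolding mon_ideal_def by blast
  then show "keys m \<subseteq> V \<and> m \<in> {g. g + f \<in> U}"
    by (simp add: keys_add_nat)
qed

text \<open>Subtracting all multiples of \<open>f\<close> leaves only terms from \<open>U\<close>: a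
  canonical splitting of the elements of \<open>J + (f)\<close>.\<close>

lemma minus_shift_mon_ideal:
  assumes "p \<in> mon_ideal V (U \<union> up_closure {f})"
  shows "p - xpow f * shift f p \<in> mon_ideal V U"
  unfolding mon_ideal_def
proof (intro CollectI ballI)
  fix k assume k: "k \<in> keys (p - xpow f * shift f p)"
  have no: "k \<noteq> m + f" for m
    using k by (auto simp: in_keys_iff lookup_minus lookup_xpow_mult_add lookup_shift)
  then have "lookup p k \<noteq> 0"
    using k lookup_xpow_mult_eq_0[of k f "shift f p"] by (simp add: in_keys_iff lookup_minus)
  then have "keys k \<subseteq> V \<and> k \<in> U \<union> up_closure {f}"
    using assms by (auto simp: mon_ideal_def in_keys_iff)
  then show "keys k \<subseteq> V \<and> k \<in> U" using no by (auto simp: up_closure_def)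
qed

lemma annihilated_by_mon_ideal:
  fixes E :: "(('v, 'k::field) mpoly, 'e) module"
  assumes E: "module (mpoly_ring V) E" and e: "e \<in> carrier E"
    and ann: "\<And>g. keys g \<subseteq> V \<Longrightarrow> g \<in> U \<Longrightarrow> xpow g \<odot>\<^bsub>E\<^esub> e = \<zero>\<^bsub>E\<^esub>"
    and p: "p \<in> mon_ideal V U"
  shows "p \<odot>\<^bsub>E\<^esub> e = \<zero>\<^bsub>E\<^esub>"
proof -
  interpret E: module "mpoly_ring V" E by (rule E)
  have *: "finite M \<Longrightarrow> (\<And>m. m \<in> M \<Longrightarrow> keys m \<subseteq> V \<and> m \<in> U) \<Longrightarrow>
      (\<Sum>m\<in>M. Poly_Mapping.single m (c m)) \<odot>\<^bsub>E\<^esub> e = \<zero>\<^bsub>E\<^esub>" for M and c :: "_ \<Rightarrow> 'k"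
  proof (induction M rule: finite_induct)
    case empty
    show ?case using E.smult_l_null[OF e] by simp
  next
    case (insert m M)
    have mem: "cst (c m) \<in> carrier (mpoly_ring V)" "(xpow m :: _ \<Rightarrow>\<^sub>0 'k) \<in> carrier (mpoly_ring V)"
      using insert.prems[of m] by (auto simp: carrier_mpoly_ring mon_in_mon_ideal_iff)
    have 1: "Poly_Mapping.single m (c m) \<odot>\<^bsub>E\<^esub> e = \<zero>\<^bsub>E\<^esub>"
      using E.smult_assoc1[OF mem e] mem ann[of m] insert.prems[of m] by (simp add: mult_single)
    have "(\<Sum>m\<in>M. Poly_Mapping.single m (c m)) \<in> carrier (mpoly_ring V)"
      "Poly_Mapping.single m (c m) \<in> carrier (mpoly_ring V)"
      using insert.prems by (auto simp: carrier_mpoly_ring mon_in_mon_ideal_iff intro!: mon_ideal_sum)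
    with E.smult_l_distr[of "Poly_Mapping.single m (c m)" "\<Sum>m\<in>M. Poly_Mapping.single m (c m)" e]
    show ?case using insert e 1 by simp
  qed
  show ?thesis
    using *[of "keys p" "lookup p"] p by (auto simp: poly_mapping_sum_single mon_ideal_def)
qed

text \<open>On the ideal generated by \<open>U\<close> and \<open>f\<close>, send \<open>r\<close>
  to its quotient by \<open>f\<close> times \<open>e'\<close>. The hypothesis \<open>ann\<close>
  makes this vanish on \<open>U\<close> and thereby linear; injectivity extends it to the whole
  ring, and the value at 1 is the required \<open>e\<close>.\<close>

lemma injective_module_divide:
  fixes E :: "(('v, 'k::field) mpoly, 'e) module"
  assumes inj: "injective_module (mpoly_ring V) E" and U: "upset U" and f: "keys f \<subseteq> V"
    and e': "e' \<in> carrier E"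
    and ann: "\<And>g. keys g \<subseteq> V \<Longrightarrow> g + f \<in> U \<Longrightarrow> xpow g \<odot>\<^bsub>E\<^esub> e' = \<zero>\<^bsub>E\<^esub>"
  obtains e where "e \<in> carrier E" "xpow f \<odot>\<^bsub>E\<^esub> e = e'" "\<And>p. p \<in> mon_ideal V U \<Longrightarrow> p \<odot>\<^bsub>E\<^esub> e = \<zero>\<^bsub>E\<^esub>"
proof -
  let ?R = "mpoly_ring V :: ('v, 'k) mpoly ring"
  have E: "module ?R E" using inj by (simp add: injective_module_def)
  interpret E: module ?R E by (rule E)
  have N: "module ?R (ring_module ?R)" by (rule module_ring_module[OF cring_mpoly_ring])
  let ?U = "U \<union> up_closure {f}"
  let ?I = "mon_ideal V ?U :: ('v, 'k) mpoly set"
  have U': "upset ?U" using U upset_up_closure[of "{f}"] by (auto simp: upset_def)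
  interpret I: ideal ?I ?R by (rule ideal_mon_ideal[OF U'])
  have I: "?I \<subseteq> carrier ?R" by (simp add: carrier_mpoly_ring mon_ideal_mono)
  interpret N: module ?R "ring_module ?R" by (rule N)
  have sub: "submodule ?I ?R (ring_module ?R)"
  proof (rule N.submoduleI)
    fix a assume "a \<in> ?I"
    moreover have "\<ominus>\<^bsub>ring_module ?R\<^esub> a = - a"
      by (rule N.M.minus_equality)
        (use I \<open>a \<in> ?I\<close> in \<open>auto simp: carrier_mpoly_ring intro!: mon_ideal_uminus\<close>)
    ultimately show "\<ominus>\<^bsub>ring_module ?R\<^esub> a \<in> ?I" by (simp add: mon_ideal_uminus)
  qed (use I in \<open>auto simp: mon_ideal_add carrier_mpoly_ring intro!: mon_ideal_mult[OF U']\<close>)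
  have sc: "shift f r \<in> carrier ?R" if "r \<in> carrier ?R" for r
    using shift_mon_ideal[of r V UNIV f] that by (simp add: carrier_mpoly_ring)
  have kill: "shift f r \<odot>\<^bsub>E\<^esub> e' = \<zero>\<^bsub>E\<^esub>" if "r \<in> mon_ideal V U" for r
    using annihilated_by_mon_ideal[OF E e' _ shift_mon_ideal[OF that, of f]] ann by auto
  have xf: "(xpow f :: _ \<Rightarrow>\<^sub>0 'k) \<in> carrier ?R" using f by (simp add: carrier_mpoly_ring mon_in_mon_ideal_iff)
  \<comment> \<open>Division by \<open>f\<close> does not commute with multiplication by
    \<open>a\<close>, but the discrepancy comes from the part of \<open>r\<close> in
    \<open>U\<close>, and quotients of such elements annihilate \<open>e'\<close>.\<close>
  have lin: "shift f (a * r) \<odot>\<^bsub>E\<^esub> e' = a \<odot>\<^bsub>E\<^esub> (shift f r \<odot>\<^bsub>E\<^esub> e')"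
    if a: "a \<in> carrier ?R" and r: "r \<in> ?I" for a r
  proof -
    let ?r = "r - xpow f * shift f r"
    have r1: "?r \<in> mon_ideal V U" by (rule minus_shift_mon_ideal[OF r])
    have ar1: "a * ?r \<in> mon_ideal V U" using a r1 by (auto simp: carrier_mpoly_ring intro: mon_ideal_mult[OF U])
    have "a * r = a * ?r + xpow f * (a * shift f r)" by (simp add: algebra_simps)
    then have "shift f (a * r) = shift f (a * ?r) + a * shift f r"
      by (simp only: shift_add shift_xpow_mult)
    moreover have "shift f (a * ?r) \<in> carrier ?R" "shift f r \<in> carrier ?R" "r \<in> carrier ?R"
      using sc I r subsetD[OF mon_ideal_mono[of U UNIV V] ar1] by (auto simp: carrier_mpoly_ring)
    ultimately show ?thesis
      using E.smult_l_distr[of "shift f (a * ?r)" "a * shift f r" e']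
        E.smult_assoc1[of a "shift f r" e'] kill[OF ar1] a e' by (simp add: poly_closed)
  qed
  have "(\<lambda>r. shift f r \<odot>\<^bsub>E\<^esub> e') \<in> module_hom ?R (ring_module ?R\<lparr>carrier := ?I\<rparr>) E"
  proof (rule module_homI)
    fix r s assume rs: "r \<in> carrier (ring_module ?R\<lparr>carrier := ?I\<rparr>)" "s \<in> carrier (ring_module ?R\<lparr>carrier := ?I\<rparr>)"
    show "shift f (r \<oplus>\<^bsub>ring_module ?R\<lparr>carrier := ?I\<rparr>\<^esub> s) \<odot>\<^bsub>E\<^esub> e' =
      shift f r \<odot>\<^bsub>E\<^esub> e' \<oplus>\<^bsub>E\<^esub> shift f s \<odot>\<^bsub>E\<^esub> e'"
      using E.smult_l_distr[of "shift f r" "shift f s" e'] rs I sc e' by (auto simp: shift_add)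
  qed (use lin I sc e' in auto)
  with inj N sub obtain g where g: "g \<in> module_hom ?R (ring_module ?R) E"
    "\<And>x. x \<in> ?I \<Longrightarrow> g x = shift f x \<odot>\<^bsub>E\<^esub> e'"
    unfolding injective_module_def by blast
  have one: "1 \<in> carrier ?R" by (rule poly_closed)
  have gs: "r \<odot>\<^bsub>E\<^esub> g 1 = g r" if "r \<in> carrier ?R" for r
    using module_homD(3)[OF g(1), of r 1] that one by simp
  show ?thesis
  proof (rule that[of "g 1"])
    show "g 1 \<in> carrier E" using module_homD(1)[OF g(1), of 1] one by simp
    have "xpow f \<in> ?I"
      using f by (simp add: mon_in_mon_ideal_iff up_closure_def)
    then have "xpow f \<odot>\<^bsub>E\<^esub> g 1 = shift f (xpow f * 1) \<odot>\<^bsub>E\<^esub> e'"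
      using g(2) gs xf by simp
    then show "xpow f \<odot>\<^bsub>E\<^esub> g 1 = e'"
      unfolding shift_xpow_mult using E.smult_one[OF e'] by simp
    show "p \<odot>\<^bsub>E\<^esub> g 1 = \<zero>\<^bsub>E\<^esub>" if p: "p \<in> mon_ideal V U" for p
    proof -
      have "p \<in> ?I" using p mon_ideal_mono[of U ?U V] by blast
      then show ?thesis using g(2) gs I kill[OF p] by auto
    qed
  qed
qed

lemma xpow_carrier: "keys m \<subseteq> V \<Longrightarrow> xpow m \<in> carrier (mpoly_ring V)"
  by (simp add: carrier_mpoly_ring mon_in_mon_ideal_iff)

lemma mvar_carrier: "v \<in> V \<Longrightarrow> mvar v \<in> carrier (mpoly_ring V)"
  by (simp add: mvar_def xpow_carrier)

lemma var_add_minus: "v \<in> keys m \<Longrightarrow> m - var v + var v = (m :: 'v monomial)"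
  by (rule poly_mapping_eqI) (auto simp: lookup_add lookup_minus lookup_single when_def in_keys_iff)

lemma xpow_annihilates:
  fixes E :: "(('v, 'k::field) mpoly, 'e) module"
  assumes E: "module (mpoly_ring V) E" and e: "e \<in> carrier E" and v: "v \<in> keys m" and m: "keys m \<subseteq> V"
    and ann: "mvar v \<odot>\<^bsub>E\<^esub> e = \<zero>\<^bsub>E\<^esub>"
  shows "xpow m \<odot>\<^bsub>E\<^esub> e = \<zero>\<^bsub>E\<^esub>"
proof -
  interpret E: module "mpoly_ring V" E by (rule E)
  have "keys (m - var v) \<subseteq> V"
    using m by (auto simp: in_keys_iff lookup_minus subset_iff)
  then have *: "(xpow (m - var v) :: _ \<Rightarrow>\<^sub>0 'k) \<in> carrier (mpoly_ring V)"
    "(mvar v :: _ \<Rightarrow>\<^sub>0 'k) \<in> carrier (mpoly_ring V)"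
    using v m by (auto intro: xpow_carrier mvar_carrier)
  have "xpow m = xpow (m - var v) * (mvar v :: _ \<Rightarrow>\<^sub>0 'k)"
    by (simp add: mvar_def mult_single var_add_minus[OF v, simplified])
  then show ?thesis using E.smult_assoc1[OF * e] ann * by simp
qed

text \<open>\<open>W\<close> collects the variables already treated. Since \<open>v\<close> is not
  in \<open>W\<close>, a monomial times \<open>v\<close> meets \<open>W\<close> only if the monomial
  does, and such monomials annihilate the given element; so it can be divided by \<open>v\<close>
  inside the annihilator of \<open>W\<close>.\<close>

lemma koszul_surj_injective:
  fixes E :: "(('v, 'k::field) mpoly, 'e) module"
  assumes inj: "injective_module (mpoly_ring V) E" and "distinct vs" "set vs \<inter> W = {}" "set vs \<union> W \<subseteq> V"
  shows "koszul_surj E {e \<in> carrier E. \<forall>w\<in>W. mvar w \<odot>\<^bsub>E\<^esub> e = \<zero>\<^bsub>E\<^esub>} (map mvar vs)"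
  using assms(2-)
proof (induction vs arbitrary: W)
  case (Cons v vs)
  have E: "module (mpoly_ring V) E" using inj by (simp add: injective_module_def)
  interpret E: module "mpoly_ring V" E by (rule E)
  let ?H = "\<lambda>W. {e \<in> carrier E. \<forall>w\<in>W. mvar w \<odot>\<^bsub>E\<^esub> e = \<zero>\<^bsub>E\<^esub>}"
  have "\<exists>e\<in>?H W. mvar v \<odot>\<^bsub>E\<^esub> e = e'" if e': "e' \<in> ?H W" for e'
  proof -
    let ?U = "{m :: 'v monomial. keys m \<inter> W \<noteq> {}}"
    have "upset ?U" by (auto simp: upset_def keys_add_nat)
    moreover have "xpow g \<odot>\<^bsub>E\<^esub> e' = \<zero>\<^bsub>E\<^esub>" if g: "keys g \<subseteq> V" "g + var v \<in> ?U" for g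
    proof -
      obtain w where "w \<in> W" "w \<in> keys g"
        using g(2) Cons.prems(2) by (auto simp: keys_add_nat)
      then show ?thesis using xpow_annihilates[OF E _ \<open>w \<in> keys g\<close> g(1)] e' by auto
    qed
    ultimately obtain e where e: "e \<in> carrier E" "xpow (var v) \<odot>\<^bsub>E\<^esub> e = e'"
      "\<And>p. p \<in> mon_ideal V ?U \<Longrightarrow> p \<odot>\<^bsub>E\<^esub> e = \<zero>\<^bsub>E\<^esub>"
      using injective_module_divide[OF inj, of ?U "var v" e'] e' Cons.prems(3) by auto
    have "mvar w \<odot>\<^bsub>E\<^esub> e = \<zero>\<^bsub>E\<^esub>" if "w \<in> W" for w
      using e(3)[of "mvar w"] that Cons.prems(3) by (auto simp: mvar_def mon_in_mon_ideal_iff)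
    then show ?thesis using e(1,2) by (auto simp: mvar_def)
  qed
  then have "\<forall>e'\<in>?H W. \<exists>e\<in>?H W. mvar v \<odot>\<^bsub>E\<^esub> e = e'" by (rule ballI)
  moreover have "koszul_surj E (?H (insert v W)) (map mvar vs)"
    using Cons.prems by (intro Cons.IH) auto
  moreover have "?H (insert v W) = {m \<in> ?H W. mvar v \<odot>\<^bsub>E\<^esub> m = \<zero>\<^bsub>E\<^esub>}" by auto
  ultimately show ?case unfolding list.map koszul_surj.simps by (simp only: simp_thms)
qed simp

lemma koszul_exact_injective:
  fixes E :: "(('v, 'k::field) mpoly, 'e) module"
  assumes inj: "injective_module (mpoly_ring V) E" and "distinct vs" "set vs \<subseteq> V" "0 < p"
  shows "koszul_exact E (carrier E) (map mvar vs) p"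
proof -
  have E: "module (mpoly_ring V) E" using inj by (simp add: injective_module_def)
  have "koszul_surj E (carrier E) (map mvar vs)"
    using koszul_surj_injective[OF inj assms(2), of "{}"] assms(3) by simp
  moreover have "set (map mvar vs) \<subseteq> carrier (mpoly_ring V)"
    using assms(3) by (auto intro: mvar_carrier)
  ultimately show ?thesis
    unfolding koszul_exact_def
    using koszul_acyclic[OF E submodule_carrier[OF E]] assms(4) by blast
qed

subsection \<open>From the socle to local cohomology\<close>

definition tdeg :: "'v monomial \<Rightarrow> nat" where
  "tdeg m = (\<Sum>v\<in>keys m. lookup m v)"

lemma tdeg_add: "tdeg (m + n) = tdeg m + tdeg n"
proof -
  have *: "tdeg k = (\<Sum>v\<in>keys m \<union> keys n. lookup k v)" if "keys k \<subseteq> keys m \<union> keys n" for k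
    unfolding tdeg_def by (rule sum.mono_neutral_left) (use that in \<open>auto simp: in_keys_iff\<close>)
  show ?thesis
    using *[of m] *[of n] *[of "m + n"] by (simp add: keys_add_nat lookup_add sum.distrib)
qed

lemma tdeg_var: "tdeg (var v) = 1"
  by (simp add: tdeg_def)

lemmas tdeg_var_Suc [simp] = tdeg_var[simplified]

lemma tdeg_0 [simp]: "tdeg 0 = 0"
  by (simp add: tdeg_def)

lemma tdeg_eq_0_iff: "tdeg m = 0 \<longleftrightarrow> m = 0"
  by (auto simp: tdeg_def in_keys_iff intro: poly_mapping_eqI)

definition downset :: "'v monomial set \<Rightarrow> bool" where
  "downset D \<longleftrightarrow> (\<forall>m\<in>D. \<forall>a b. m = a + b \<longrightarrow> b \<in> D)"

lemma downset_iff: "downset D \<longleftrightarrow> upset (- D)"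
  by (auto simp: downset_def upset_def)

text \<open>The monomials spanning \<open>J_D\<close>. Finite downsets give the monomial ideals of
  finite colength; unlike the powers of the maximal ideal, these can be built up one monomial at a
  time, which suits induction on \<open>card D\<close>.\<close>

definition xpows_outside :: "'v set \<Rightarrow> 'v monomial set \<Rightarrow> ('v, 'k::field) mpoly set" where
  "xpows_outside V D = xpow ` {m. keys m \<subseteq> V \<and> m \<notin> D}"

lemma xpows_outside_mono: "D \<subseteq> D' \<Longrightarrow> xpows_outside V D' \<subseteq> xpows_outside V D"
  by (auto simp: xpows_outside_def)

lemma xpows_outside_remove:
  "a \<in> xpows_outside V (D - {f}) \<Longrightarrow> a \<in> xpows_outside V D \<or> a = xpow f"
  by (auto simp: xpows_outside_def)

lemma downset_remove_max:
  assumes "finite D" "D \<noteq> {}" "downset D"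
  obtains f where "f \<in> D" "downset (D - {f})" "\<And>g. g + f \<in> D \<Longrightarrow> g = 0"
proof -
  obtain f where f: "f \<in> D" "\<And>m. m \<in> D \<Longrightarrow> tdeg m \<le> tdeg f"
    using Max_in[of "tdeg ` D"] Max_ge[of "tdeg ` D"] assms(1,2) by (metis (no_types, lifting) finite_imageI image_iff image_is_empty)
  show ?thesis
  proof (rule that[of f])
    show g: "g = 0" if "g + f \<in> D" for g
      using f(2)[OF that] by (simp add: tdeg_add tdeg_eq_0_iff)
    show "downset (D - {f})"
      unfolding downset_def
    proof (intro ballI allI impI)
      fix m a b assume m: "m \<in> D - {f}" "m = a + b"
      then have "b \<in> D" using assms(3) by (auto simp: downset_def)
      moreover have "b \<noteq> f" using m g[of a] by auto
      ultimately show "b \<in> D - {f}" by simp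
    qed
  qed (rule f)
qed


section \<open>From socles to annihilators of ideals of finite colength\<close>

context
  fixes V :: "'v set" and E :: "nat \<Rightarrow> (('v, 'k::field) mpoly, 'e) module"
    and \<delta> :: "nat \<Rightarrow> 'e \<Rightarrow> 'e"
  assumes inj: "\<And>i. injective_module (mpoly_ring V) (E i)"
    and \<delta>: "\<And>i. \<delta> i \<in> module_hom (mpoly_ring V) (E i) (E (Suc i))"
    and exact: "\<And>i. \<delta> i ` carrier (E i) = a_kernel (E (Suc i)) (E (Suc (Suc i))) (\<delta> (Suc i))"
begin

lemma E_module: "module (mpoly_ring V) (E i)"
  using inj[of i] by (simp add: injective_module_def)

abbreviation "cocycles i \<equiv> a_kernel (E i) (E (Suc i)) (\<delta> i)"

abbreviation "Ann A i \<equiv> {e \<in> carrier (E i). \<forall>a\<in>A. a \<odot>\<^bsub>E i\<^esub> e = \<zero>\<^bsub>E i\<^esub>}"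

text \<open>With \<open>J\<^sub>D\<close> spanned by the monomials outside \<open>D\<close> and \<open>f\<close> maximal in \<open>D\<close>, this is the surjectivity in
  the exact sequence \<open>0 \<rightarrow> (0 : J\<^sub>D + (f)) \<rightarrow> (0 : J\<^sub>D) \<rightarrow> (0 : \<mm>) \<rightarrow> 0\<close> given by multiplication by \<open>f\<close>,
  along which exactness is transported from the socle to all \<open>(0 : J\<^sub>D)\<close>.\<close>

lemma ann_lift:
  assumes D: "downset D" and f: "f \<in> D" "keys f \<subseteq> V" "\<And>g. g + f \<in> D \<Longrightarrow> g = 0"
    and e': "e' \<in> Ann (mvar ` V) i"
  obtains e where "e \<in> Ann (xpows_outside V D) i" "xpow f \<odot>\<^bsub>E i\<^esub> e = e'"
proof -
  have "xpow g \<odot>\<^bsub>E i\<^esub> e' = \<zero>\<^bsub>E i\<^esub>" if g: "keys g \<subseteq> V" "g + f \<in> - D" for g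
  proof -
    have "g \<noteq> 0" using g(2) f(1) by auto
    then obtain v where v: "v \<in> keys g" by (metis keys_eq_empty all_not_in_conv)
    then show ?thesis using xpow_annihilates[OF E_module _ v g(1)] e' g(1) by auto
  qed
  then obtain e where e: "e \<in> carrier (E i)" "xpow f \<odot>\<^bsub>E i\<^esub> e = e'"
    "\<And>p. p \<in> mon_ideal V (- D) \<Longrightarrow> p \<odot>\<^bsub>E i\<^esub> e = \<zero>\<^bsub>E i\<^esub>"
    using injective_module_divide[OF inj, of "- D" f e' i] D f(2) e' by (auto simp: downset_iff)
  moreover have "xpows_outside V D \<subseteq> mon_ideal V (- D)"
    by (auto simp: xpows_outside_def mon_in_mon_ideal_iff)
  ultimately have "e \<in> Ann (xpows_outside V D) i" by blast
  with e(2) show ?thesis using that by blast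
qed

lemma cocycles_closed:
  "z \<in> cocycles i \<Longrightarrow> z \<in> carrier (E i)"
  "a \<in> carrier (mpoly_ring V) \<Longrightarrow> z \<in> cocycles i \<Longrightarrow> a \<odot>\<^bsub>E i\<^esub> z \<in> cocycles i"
proof -
  interpret E: module "mpoly_ring V" "E i" by (rule E_module)
  note sub = E.submoduleE[OF submodule_kernel[OF E_module E_module \<delta>]]
  show "z \<in> cocycles i \<Longrightarrow> z \<in> carrier (E i)" using sub(1) by blast
  show "a \<in> carrier (mpoly_ring V) \<Longrightarrow> z \<in> cocycles i \<Longrightarrow> a \<odot>\<^bsub>E i\<^esub> z \<in> cocycles i" using sub(4) by blast
qed

lemma \<delta>_closed: "e \<in> carrier (E i) \<Longrightarrow> \<delta> i e \<in> cocycles (Suc i)"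
  using exact by blast

lemma \<delta>_ann:
  assumes "A \<subseteq> carrier (mpoly_ring V)" "e \<in> Ann A i"
  shows "\<delta> i e \<in> Ann A (Suc i)"
proof -
  have "a \<odot>\<^bsub>E (Suc i)\<^esub> \<delta> i e = \<zero>\<^bsub>E (Suc i)\<^esub>" if "a \<in> A" for a
    using module_homD(3)[OF \<delta>, of a e i] assms that module_hom_zero[OF E_module E_module \<delta>[of i]] by auto
  then show ?thesis using assms module_homD(1)[OF \<delta>, of e i] by auto
qed

lemma ann_minus:
  assumes "A \<subseteq> carrier (mpoly_ring V)" "e \<in> Ann A i" "e' \<in> Ann A i"
  shows "e \<ominus>\<^bsub>E i\<^esub> e' \<in> Ann A i"
proof -
  interpret E: module "mpoly_ring V" "E i" by (rule E_module)
  have "a \<odot>\<^bsub>E i\<^esub> (e \<ominus>\<^bsub>E i\<^esub> e') = \<zero>\<^bsub>E i\<^esub>" if "a \<in> A" for a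
    using assms that by (auto simp: a_minus_def E.smult_r_distr E.smult_r_minus minus_zero_module[OF E_module])
  then show ?thesis using assms by auto
qed

lemma xpows_outside_carrier: "xpows_outside V D \<subseteq> carrier (mpoly_ring V)"
  by (auto simp: xpows_outside_def xpow_carrier)

lemma minus_ann_remove:
  assumes "e \<in> Ann (xpows_outside V D) i" "e' \<in> Ann (xpows_outside V D) i" "keys f \<subseteq> V"
    and "xpow f \<odot>\<^bsub>E i\<^esub> e = xpow f \<odot>\<^bsub>E i\<^esub> e'"
  shows "e \<ominus>\<^bsub>E i\<^esub> e' \<in> Ann (xpows_outside V (D - {f})) i"
proof -
  interpret E: module "mpoly_ring V" "E i" by (rule E_module)
  have f: "(xpow f :: _ \<Rightarrow>\<^sub>0 'k) \<in> carrier (mpoly_ring V)" using assms(3) by (rule xpow_carrier)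
  have "xpow f \<odot>\<^bsub>E i\<^esub> (e \<ominus>\<^bsub>E i\<^esub> e') = \<zero>\<^bsub>E i\<^esub>"
    using assms f by (simp add: a_minus_def E.smult_r_distr E.smult_r_minus E.M.r_neg)
  then show ?thesis
    using ann_minus[OF xpows_outside_carrier assms(1,2)] xpows_outside_remove[of _ V D f] by blast
qed

lemma mult_max_ann:
  assumes e: "e \<in> Ann (xpows_outside V D) i" and f: "keys f \<subseteq> V" "\<And>g. g + f \<in> D \<Longrightarrow> g = 0"
  shows "xpow f \<odot>\<^bsub>E i\<^esub> e \<in> Ann (mvar ` V) i"
proof -
  interpret E: module "mpoly_ring V" "E i" by (rule E_module)
  have fc: "(xpow f :: _ \<Rightarrow>\<^sub>0 'k) \<in> carrier (mpoly_ring V)" using f(1) by (rule xpow_carrier)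
  have "mvar v \<odot>\<^bsub>E i\<^esub> (xpow f \<odot>\<^bsub>E i\<^esub> e) = \<zero>\<^bsub>E i\<^esub>" if v: "v \<in> V" for v
  proof -
    have "var v + f \<notin> D" using f(2)[of "var v"] by (metis tdeg_var tdeg_0 zero_neq_one)
    moreover have "keys (var v + f) \<subseteq> V" using v f by (simp add: keys_add_nat)
    ultimately have "xpow (var v + f) \<in> xpows_outside V D" by (simp add: xpows_outside_def)
    then have "xpow (var v + f) \<odot>\<^bsub>E i\<^esub> e = \<zero>\<^bsub>E i\<^esub>" using e by blast
    moreover have "mvar v * xpow f = (xpow (var v + f) :: _ \<Rightarrow>\<^sub>0 'k)" by (simp add: mvar_def mult_single)
    ultimately show ?thesis
      using E.smult_assoc1[OF mvar_carrier[OF v] fc, of e] e by simp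
  qed
  then show ?thesis using e fc by auto
qed

text \<open>For \<open>f\<close> maximal in \<open>D\<close> the product of \<open>f\<close> and
  \<open>z\<close> is a socle cocycle, so it is zero (\<open>i = 0\<close>) or the boundary of some
  socle element \<open>e'\<close>. Lifting \<open>e'\<close> to \<open>e\<close> with
  \<open>f e = e'\<close> and subtracting the boundary of \<open>e\<close> makes \<open>z\<close>
  annihilated by \<open>f\<close> as well, which is the case \<open>D - {f}\<close>.\<close>

lemma ann_exact_downset:
  assumes soc: "ann_exact E \<delta> (mvar ` V) i" and "finite D" "downset D" "\<And>m. m \<in> D \<Longrightarrow> keys m \<subseteq> V"
  shows "ann_exact E \<delta> (xpows_outside V D) i"
  using assms(2-)
proof (induction "card D" arbitrary: D)
  case 0
  then have D: "D = {}" by simp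
  interpret E: module "mpoly_ring V" "E i" by (rule E_module)
  show ?case
    unfolding ann_exact_def
  proof (intro ballI impI)
    fix z assume z: "z \<in> cocycles i" "\<forall>a\<in>xpows_outside V D. a \<odot>\<^bsub>E i\<^esub> z = \<zero>\<^bsub>E i\<^esub>"
    \<comment> \<open>The unit monomial lies outside the empty \<open>D\<close>, so the annihilator
      is zero.\<close>
    have "xpow 0 \<in> xpows_outside V D" unfolding D xpows_outside_def by (rule imageI) simp
    then have z0: "z = \<zero>\<^bsub>E i\<^esub>" using z E.smult_one[OF cocycles_closed(1)[OF z(1)]] by auto
    show "z \<in> (case i of 0 \<Rightarrow> {\<zero>\<^bsub>E 0\<^esub>} | Suc k \<Rightarrow> \<delta> k ` Ann (xpows_outside V D) k)"
    proof (cases i)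
      case (Suc k)
      interpret Ek: module "mpoly_ring V" "E k" by (rule E_module)
      have "\<zero>\<^bsub>E k\<^esub> \<in> Ann (xpows_outside V D) k"
        by (auto intro!: Ek.smult_r_null subsetD[OF xpows_outside_carrier])
      then show ?thesis
        using Suc z0 module_hom_zero[OF E_module E_module \<delta>[of k]] by (auto intro!: image_eqI[of _ _ "\<zero>\<^bsub>E k\<^esub>"])
    qed (use z0 in simp)
  qed
next
  case (Suc n)
  have "finite D" "D \<noteq> {}" using Suc.hyps(2) by (auto intro: card_ge_0_finite)
  then obtain f where f: "f \<in> D" "downset (D - {f})" "\<And>g. g + f \<in> D \<Longrightarrow> g = 0"
    using downset_remove_max[OF _ _ Suc.prems(2)] by blast
  have fV: "keys f \<subseteq> V" using Suc.prems f by blast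
  have fc: "(xpow f :: _ \<Rightarrow>\<^sub>0 'k) \<in> carrier (mpoly_ring V)" using fV by (rule xpow_carrier)
  have IH: "ann_exact E \<delta> (xpows_outside V (D - {f})) i"
    using Suc.hyps(2) Suc.prems f by (intro Suc.hyps(1)) auto
  interpret E: module "mpoly_ring V" "E i" by (rule E_module)
  show ?case
    unfolding ann_exact_def
  proof (intro ballI impI)
    fix z assume z: "z \<in> cocycles i" "\<forall>a\<in>xpows_outside V D. a \<odot>\<^bsub>E i\<^esub> z = \<zero>\<^bsub>E i\<^esub>"
    have zA: "z \<in> Ann (xpows_outside V D) i" using z cocycles_closed by blast
    let ?w = "xpow f \<odot>\<^bsub>E i\<^esub> z"
    have w: "?w \<in> cocycles i" "?w \<in> Ann (mvar ` V) i"
      using cocycles_closed(2)[OF fc z(1)] mult_max_ann[OF zA fV f(3)] by auto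
    show "z \<in> (case i of 0 \<Rightarrow> {\<zero>\<^bsub>E 0\<^esub>} | Suc k \<Rightarrow> \<delta> k ` Ann (xpows_outside V D) k)"
    proof (cases i)
      case 0
      have "?w = \<zero>\<^bsub>E i\<^esub>" using soc w 0 unfolding ann_exact_def by simp
      then have "\<forall>a\<in>xpows_outside V (D - {f}). a \<odot>\<^bsub>E i\<^esub> z = \<zero>\<^bsub>E i\<^esub>"
        using z(2) xpows_outside_remove[of _ V D f] by blast
      then show ?thesis using IH z(1) 0 unfolding ann_exact_def by simp
    next
      case (Suc k)
      interpret Ek: module "mpoly_ring V" "E k" by (rule E_module)
      have "?w \<in> \<delta> k ` Ann (mvar ` V) k" using soc w Suc unfolding ann_exact_def by simp
      then obtain e' where e': "e' \<in> Ann (mvar ` V) k" "?w = \<delta> k e'" by blast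
      obtain e where e: "e \<in> Ann (xpows_outside V D) k" "xpow f \<odot>\<^bsub>E k\<^esub> e = e'"
        using ann_lift[OF Suc.prems(2) f(1) fV f(3) e'(1)] by blast
      have ec: "e \<in> carrier (E k)" using e(1) by blast
      have \<delta>e: "\<delta> k e \<in> Ann (xpows_outside V D) i" "\<delta> k e \<in> cocycles i"
        using \<delta>_ann[OF xpows_outside_carrier e(1)] \<delta>_closed[OF ec] Suc by auto
      have "xpow f \<odot>\<^bsub>E i\<^esub> \<delta> k e = ?w"
        using module_homD(3)[OF \<delta> fc ec] e(2) e'(2) Suc by simp
      then have "z \<ominus>\<^bsub>E i\<^esub> \<delta> k e \<in> Ann (xpows_outside V (D - {f})) i"
        using minus_ann_remove[OF zA \<delta>e(1) fV] by simp
      moreover have "z \<ominus>\<^bsub>E i\<^esub> \<delta> k e \<in> cocycles i"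
        using E.submoduleE[OF submodule_kernel[OF E_module E_module \<delta>]] z(1) \<delta>e(2)
        unfolding a_minus_def by blast
      ultimately have "z \<ominus>\<^bsub>E i\<^esub> \<delta> k e \<in> \<delta> k ` Ann (xpows_outside V (D - {f})) k"
        using IH Suc unfolding ann_exact_def by simp
      then obtain e'' where e'': "e'' \<in> Ann (xpows_outside V (D - {f})) k" "z \<ominus>\<^bsub>E i\<^esub> \<delta> k e = \<delta> k e''"
        by blast
      have e''D: "e'' \<in> Ann (xpows_outside V D) k"
        using e''(1) xpows_outside_mono[of "D - {f}" D V] by blast
      have "\<delta> k (e'' \<oplus>\<^bsub>E k\<^esub> e) = \<delta> k e'' \<oplus>\<^bsub>E i\<^esub> \<delta> k e"
        using module_homD(2)[OF \<delta>, of e'' k e] e''D ec Suc by auto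
      also have "\<dots> = z"
        using cocycles_closed(1)[OF z(1)] cocycles_closed(1)[OF \<delta>e(2)]
        by (simp add: e''(2)[symmetric] a_minus_def E.M.a_assoc E.M.l_neg)
      finally have "z = \<delta> k (e'' \<oplus>\<^bsub>E k\<^esub> e)" ..
      moreover have "e'' \<oplus>\<^bsub>E k\<^esub> e \<in> Ann (xpows_outside V D) k"
      proof -
        have "a \<odot>\<^bsub>E k\<^esub> (e'' \<oplus>\<^bsub>E k\<^esub> e) = \<zero>\<^bsub>E k\<^esub>" if a: "a \<in> xpows_outside V D" for a
          using Ek.smult_r_distr[of a e'' e] a e''D e(1) subsetD[OF xpows_outside_carrier a] by auto
        then show ?thesis using e''D ec by auto
      qed
      ultimately show ?thesis using Suc by simp
    qed
  qed
qed

text \<open>This keeps a nonzero socle class alive in the torsion complex. The element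
  \<open>e\<close> is changed by boundaries from the previous term, which leaves
  \<open>\<delta> k e\<close> alone, until the whole maximal ideal annihilates it.\<close>

lemma socle_lift:
  assumes soc: "ann_exact E \<delta> (mvar ` V) k"
    and "finite D" "downset D" "\<And>m. m \<in> D \<Longrightarrow> keys m \<subseteq> V"
    and "e \<in> Ann (xpows_outside V D) k" and z: "\<delta> k e \<in> Ann (mvar ` V) (Suc k)"
  shows "\<delta> k e \<in> \<delta> k ` Ann (mvar ` V) k"
  using assms(2-)
proof (induction "card D" arbitrary: D e)
  case 0
  then have D: "D = {}" by simp
  interpret E: module "mpoly_ring V" "E k" by (rule E_module)
  have "xpow 0 \<in> xpows_outside V D" unfolding D xpows_outside_def by (rule imageI) simp
  then have "e = \<zero>\<^bsub>E k\<^esub>" using 0 E.smult_one[of e] by auto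
  moreover have "\<zero>\<^bsub>E k\<^esub> \<in> Ann (mvar ` V) k" by (auto intro!: E.smult_r_null mvar_carrier)
  ultimately show ?case by blast
next
  case (Suc n)
  have "finite D" "D \<noteq> {}" using Suc.hyps(2) by (auto intro: card_ge_0_finite)
  then obtain f where f: "f \<in> D" "downset (D - {f})" "\<And>g. g + f \<in> D \<Longrightarrow> g = 0"
    using downset_remove_max[OF _ _ Suc.prems(2)] by blast
  have fV: "keys f \<subseteq> V" using Suc.prems f by blast
  have fc: "(xpow f :: _ \<Rightarrow>\<^sub>0 'k) \<in> carrier (mpoly_ring V)" using fV by (rule xpow_carrier)
  interpret E: module "mpoly_ring V" "E k" by (rule E_module)
  note e = Suc.prems(4)
  have ec: "e \<in> carrier (E k)" using e by blast
  let ?w = "xpow f \<odot>\<^bsub>E k\<^esub> e"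
  have w: "?w \<in> Ann (mvar ` V) k" by (rule mult_max_ann[OF e fV f(3)])
  show ?case
  proof (cases "f = 0")
    case True
    then have "e \<in> Ann (mvar ` V) k" using w E.smult_one[OF ec] by simp
    then show ?thesis by blast
  next
    case False
    then obtain v where v: "v \<in> keys f" by (metis keys_eq_empty all_not_in_conv)
    \<comment> \<open>\<open>f\<close> is a nontrivial monomial and \<open>\<delta> k e\<close> lies
      in the socle, so \<open>f e\<close> is a cocycle, to which exactness at \<open>k\<close>
      applies.\<close>
    have "xpow f \<odot>\<^bsub>E (Suc k)\<^esub> \<delta> k e = \<zero>\<^bsub>E (Suc k)\<^esub>"
      using xpow_annihilates[OF E_module _ v fV, of "\<delta> k e" "Suc k"] Suc.prems(5) v fV by auto
    then have \<delta>w: "\<delta> k ?w = \<zero>\<^bsub>E (Suc k)\<^esub>"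
      using module_homD(3)[OF \<delta> fc ec] by simp
    then have wZ: "?w \<in> cocycles k" using w by (simp add: a_kernel_def')
    show ?thesis
    proof (cases k)
      case 0
      have "?w = \<zero>\<^bsub>E k\<^esub>" using soc w wZ 0 unfolding ann_exact_def by simp
      then have "e \<in> Ann (xpows_outside V (D - {f})) k"
        using e xpows_outside_remove[of _ V D f] by blast
      then show ?thesis using Suc.hyps(2) Suc.prems f by (intro Suc.hyps(1)[of "D - {f}"]) auto
    next
      case (Suc l)
      interpret El: module "mpoly_ring V" "E l" by (rule E_module)
      have "?w \<in> \<delta> l ` Ann (mvar ` V) l" using soc w wZ Suc unfolding ann_exact_def by simp
      then obtain e2 where e2: "e2 \<in> Ann (mvar ` V) l" "?w = \<delta> l e2" by blast
      obtain e3 where e3: "e3 \<in> Ann (xpows_outside V D) l" "xpow f \<odot>\<^bsub>E l\<^esub> e3 = e2"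
        using ann_lift[OF Suc.prems(2) f(1) fV f(3) e2(1)] by blast
      have e3c: "e3 \<in> carrier (E l)" using e3(1) by blast
      have \<delta>e: "\<delta> l e3 \<in> Ann (xpows_outside V D) k" "\<delta> l e3 \<in> cocycles k"
        using \<delta>_ann[OF xpows_outside_carrier e3(1)] \<delta>_closed[OF e3c] Suc by auto
      have "xpow f \<odot>\<^bsub>E k\<^esub> \<delta> l e3 = ?w"
        using module_homD(3)[OF \<delta> fc e3c] e3(2) e2(2) Suc by simp
      then have e4: "e \<ominus>\<^bsub>E k\<^esub> \<delta> l e3 \<in> Ann (xpows_outside V (D - {f})) k"
        using minus_ann_remove[OF e \<delta>e(1) fV] by simp
      interpret ES: module "mpoly_ring V" "E (Suc k)" by (rule E_module)
      have "\<delta> k (e \<ominus>\<^bsub>E k\<^esub> \<delta> l e3) = \<delta> k e \<ominus>\<^bsub>E (Suc k)\<^esub> \<delta> k (\<delta> l e3)"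
        by (rule module_hom_minus[OF E_module E_module \<delta> ec cocycles_closed(1)[OF \<delta>e(2)]])
      also have "\<dots> = \<delta> k e"
        using \<delta>e(2) Suc.prems(5) by (simp add: a_kernel_def' a_minus_def minus_zero_module[OF E_module])
      finally have eq: "\<delta> k (e \<ominus>\<^bsub>E k\<^esub> \<delta> l e3) = \<delta> k e" .
      have "\<delta> k (e \<ominus>\<^bsub>E k\<^esub> \<delta> l e3) \<in> \<delta> k ` Ann (mvar ` V) k"
        using Suc.hyps(2) Suc.prems f e4 unfolding eq[symmetric] by (intro Suc.hyps(1)[of "D - {f}"]) auto
      then show ?thesis by (simp only: eq)
    qed
  qed
qed

end

subsection \<open>Torsion with respect to the maximal homogeneous ideal\<close>

lemma tdeg_powset: "m \<in> powset (up_closure (var ` V)) n \<Longrightarrow> n \<le> tdeg m"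
proof (induction n arbitrary: m)
  case (Suc n)
  then obtain a r v where "m = a + (r + var v)" "a \<in> powset (up_closure (var ` V)) n"
    by (auto simp: sumset_def up_closure_def)
  then show ?case using Suc.IH[of a] by (simp add: tdeg_add)
qed simp

lemma powset_tdeg: "keys m \<subseteq> V \<Longrightarrow> n \<le> tdeg m \<Longrightarrow> m \<in> powset (up_closure (var ` V)) n"
proof (induction n arbitrary: m)
  case (Suc n)
  then have "m \<noteq> 0" by auto
  then obtain v where v: "v \<in> keys m" by (metis keys_eq_empty all_not_in_conv)
  have eq: "m - var v + var v = m" by (rule var_add_minus[OF v])
  have "tdeg (m - var v) + 1 = tdeg m" using tdeg_add[of "m - var v" "var v"] unfolding eq by simp
  moreover have "keys (m - var v) \<subseteq> V"
    using Suc.prems(1) by (auto simp: in_keys_iff lookup_minus subset_iff)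
  ultimately have "m - var v \<in> powset (up_closure (var ` V)) n"
    using Suc by simp
  moreover have "var v \<in> up_closure (var ` V)"
    unfolding up_closure_def
    by (intro CollectI exI[of _ 0] exI[of _ "var v"] conjI imageI) (use v Suc.prems(1) in auto)
  ultimately have "(m - var v) + var v \<in> powset (up_closure (var ` V)) (Suc n)"
    unfolding powset.simps sumset_def
    by (intro CollectI exI[of _ "m - var v"] exI[of _ "var v"] conjI refl)
  then show ?case by (simp only: eq)
qed simp

lemma finite_bounded_tdeg:
  assumes "finite V"
  shows "finite {m :: 'v monomial. keys m \<subseteq> V \<and> tdeg m < n}"
proof -
  have "lookup m v \<le> tdeg m" for m :: "'v monomial" and v
  proof (cases "v \<in> keys m")
    case True
    then show ?thesis unfolding tdeg_def by (intro member_le_sum) auto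
  qed (simp add: in_keys_iff)
  then have "lookup ` {m :: 'v monomial. keys m \<subseteq> V \<and> tdeg m < n} \<subseteq>
      {f. \<forall>x. (x \<in> V \<longrightarrow> f x \<in> {..n}) \<and> (x \<notin> V \<longrightarrow> f x = 0)}"
    by (auto simp: in_keys_iff subset_iff) (meson le_trans less_imp_le)
  then have "finite (lookup ` {m :: 'v monomial. keys m \<subseteq> V \<and> tdeg m < n})"
    using finite_set_of_finite_funs[OF assms, of "{..n}" 0] finite_subset by blast
  moreover have "inj lookup" by (rule injI) (simp add: poly_mapping_eqI)
  ultimately show ?thesis using finite_imageD inj_on_subset by blast
qed

text \<open>The ideals of finite colength and the powers of the maximal ideal are cofinal: the
  monomials outside a power form a finite downset because \<open>V\<close> is finite, and a finite
  downset lies below some total degree.\<close>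

lemma torsion_iff:
  fixes M :: "(('v, 'k::field) mpoly, 'e) module"
  assumes M: "module (mpoly_ring V) M" and V: "finite V"
  shows "x \<in> torsion (mpoly_ring V) (max_hom_ideal V) M \<longleftrightarrow> x \<in> carrier M \<and>
    (\<exists>D. finite D \<and> downset D \<and> (\<forall>m\<in>D. keys m \<subseteq> V) \<and>
       (\<forall>a\<in>xpows_outside V D. a \<odot>\<^bsub>M\<^esub> x = \<zero>\<^bsub>M\<^esub>))"
proof -
  let ?U = "up_closure (var ` V)"
  have pow: "max_hom_ideal V [^]\<^bsub>ideals_set (mpoly_ring V)\<^esub> n =
    (mon_ideal V (powset ?U n) :: ('v, 'k) mpoly set)" for n :: nat
    unfolding max_hom_ideal_eq_mon_ideal by (rule ideal_power_mon_ideal[OF upset_up_closure])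
  show ?thesis
  proof
    assume "x \<in> torsion (mpoly_ring V) (max_hom_ideal V) M"
    then obtain n where x: "x \<in> carrier M"
      and n: "\<And>a. a \<in> mon_ideal V (powset ?U n) \<Longrightarrow> a \<odot>\<^bsub>M\<^esub> x = \<zero>\<^bsub>M\<^esub>"
      by (auto simp: torsion_def pow)
    let ?D = "{m. keys m \<subseteq> V \<and> m \<notin> powset ?U n}"
    have "?D \<subseteq> {m. keys m \<subseteq> V \<and> tdeg m < n}"
      using powset_tdeg[of _ V n] by (auto simp: not_less[symmetric])
    then have "finite ?D" by (rule finite_subset) (rule finite_bounded_tdeg[OF V])
    moreover have "downset ?D"
      using upset_powset[of ?U n] by (auto simp: downset_def upset_def keys_add_nat)
    moreover have "\<forall>a\<in>xpows_outside V ?D. a \<odot>\<^bsub>M\<^esub> x = \<zero>\<^bsub>M\<^esub>"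
      by (auto simp: xpows_outside_def mon_in_mon_ideal_iff intro!: n)
    ultimately show "x \<in> carrier M \<and> (\<exists>D. finite D \<and> downset D \<and> (\<forall>m\<in>D. keys m \<subseteq> V) \<and>
       (\<forall>a\<in>xpows_outside V D. a \<odot>\<^bsub>M\<^esub> x = \<zero>\<^bsub>M\<^esub>))"
      using x by (intro conjI exI[of _ ?D]) auto
  next
    assume "x \<in> carrier M \<and> (\<exists>D. finite D \<and> downset D \<and> (\<forall>m\<in>D. keys m \<subseteq> V) \<and>
       (\<forall>a\<in>xpows_outside V D. a \<odot>\<^bsub>M\<^esub> x = \<zero>\<^bsub>M\<^esub>))"
    then obtain D where x: "x \<in> carrier M" and D: "finite D"
      "\<And>a. a \<in> xpows_outside V D \<Longrightarrow> a \<odot>\<^bsub>M\<^esub> x = \<zero>\<^bsub>M\<^esub>" by blast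
    obtain n where n: "\<And>m. m \<in> D \<Longrightarrow> tdeg m < n"
      using finite_nat_set_iff_bounded[of "tdeg ` D"] D(1) by auto
    have "a \<odot>\<^bsub>M\<^esub> x = \<zero>\<^bsub>M\<^esub>" if "a \<in> mon_ideal V (powset ?U n)" for a
    proof (rule annihilated_by_mon_ideal[OF M x _ that])
      fix g assume g: "keys g \<subseteq> V" "g \<in> powset ?U n"
      then have "g \<notin> D" using n[of g] tdeg_powset[of g V n] by auto
      then show "xpow g \<odot>\<^bsub>M\<^esub> x = \<zero>\<^bsub>M\<^esub>" using g by (intro D(2)) (auto simp: xpows_outside_def)
    qed
    then show "x \<in> torsion (mpoly_ring V) (max_hom_ideal V) M"
      using x by (auto simp: torsion_def pow)
  qed
qed

lemma submodule_torsion: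
  fixes M :: "(('v, 'k::field) mpoly, 'e) module"
  assumes M: "module (mpoly_ring V) M" and V: "finite V"
  shows "submodule (torsion (mpoly_ring V) (max_hom_ideal V) M) (mpoly_ring V) M"
proof -
  interpret M: module "mpoly_ring V" M by (rule M)
  let ?T = "torsion (mpoly_ring V) (max_hom_ideal V) M"
  have xc: "a \<in> carrier (mpoly_ring V)" if "a \<in> xpows_outside V D" for a :: "('v, 'k) mpoly" and D
    using that by (auto simp: xpows_outside_def xpow_carrier)
  have 1: "a \<odot>\<^bsub>M\<^esub> x \<oplus>\<^bsub>M\<^esub> b \<odot>\<^bsub>M\<^esub> y \<in> ?T"
    if "x \<in> ?T" "y \<in> ?T" "a \<in> carrier (mpoly_ring V)" "b \<in> carrier (mpoly_ring V)" for a b x y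
  proof -
    obtain D where D: "finite D" "downset D" "\<forall>m\<in>D. keys m \<subseteq> V"
      "\<forall>a\<in>xpows_outside V D. a \<odot>\<^bsub>M\<^esub> x = \<zero>\<^bsub>M\<^esub>" and x: "x \<in> carrier M"
      using \<open>x \<in> ?T\<close> unfolding torsion_iff[OF M V] by blast
    obtain D' where D': "finite D'" "downset D'" "\<forall>m\<in>D'. keys m \<subseteq> V"
      "\<forall>a\<in>xpows_outside V D'. a \<odot>\<^bsub>M\<^esub> y = \<zero>\<^bsub>M\<^esub>" and y: "y \<in> carrier M"
      using \<open>y \<in> ?T\<close> unfolding torsion_iff[OF M V] by blast
    have swap: "r \<odot>\<^bsub>M\<^esub> (s \<odot>\<^bsub>M\<^esub> z) = s \<odot>\<^bsub>M\<^esub> (r \<odot>\<^bsub>M\<^esub> z)"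
      if "r \<in> carrier (mpoly_ring V)" "s \<in> carrier (mpoly_ring V)" "z \<in> carrier M" for r s z
      using M.smult_assoc1[OF that] M.smult_assoc1[OF that(2,1,3)] by (simp add: mult.commute)
    have "r \<odot>\<^bsub>M\<^esub> (a \<odot>\<^bsub>M\<^esub> x \<oplus>\<^bsub>M\<^esub> b \<odot>\<^bsub>M\<^esub> y) = \<zero>\<^bsub>M\<^esub>" if r: "r \<in> xpows_outside V (D \<union> D')" for r
    proof -
      have "r \<odot>\<^bsub>M\<^esub> x = \<zero>\<^bsub>M\<^esub>" "r \<odot>\<^bsub>M\<^esub> y = \<zero>\<^bsub>M\<^esub>"
        using D(4) D'(4) r xpows_outside_mono[of D "D \<union> D'" V] xpows_outside_mono[of D' "D \<union> D'" V] by blast+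
      then show ?thesis
        using x y that xc[OF r] \<open>a \<in> _\<close> \<open>b \<in> _\<close> by (simp add: M.smult_r_distr swap[of r])
    qed
    moreover have "finite (D \<union> D')" "downset (D \<union> D')" "\<forall>m\<in>D \<union> D'. keys m \<subseteq> V"
      using D D' by (auto simp: downset_def)
    ultimately show ?thesis
      unfolding torsion_iff[OF M V] using x y that by blast
  qed
  have c: "x \<in> carrier M" if "x \<in> ?T" for x using that by (simp add: torsion_def)
  have one: "1 \<in> carrier (mpoly_ring V :: ('v, 'k) mpoly ring)"
    "0 \<in> carrier (mpoly_ring V :: ('v, 'k) mpoly ring)" by (simp_all add: poly_closed)
  have s1: "1 \<odot>\<^bsub>M\<^esub> x = x" and s0: "0 \<odot>\<^bsub>M\<^esub> x = \<zero>\<^bsub>M\<^esub>" if "x \<in> carrier M" for x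
    using M.smult_one[OF that] M.smult_l_null[OF that] by simp_all
  have z: "\<zero>\<^bsub>M\<^esub> \<in> ?T"
    unfolding torsion_iff[OF M V]
    by (intro conjI exI[of _ "{}"]) (auto simp: downset_def intro: M.smult_r_null xc)
  show ?thesis
  proof (rule M.submoduleI)
    show sm: "a \<odot>\<^bsub>M\<^esub> x \<in> ?T" if "a \<in> carrier (mpoly_ring V)" "x \<in> ?T" for a x
      using 1[OF that(2) that(2) that(1) one(2)] that c[OF that(2)] by (simp add: s0)
    show "\<ominus>\<^bsub>M\<^esub> x \<in> ?T" if "x \<in> ?T" for x
    proof -
      have "- 1 \<in> carrier (mpoly_ring V :: ('v, 'k) mpoly ring)" by (intro poly_closed)
      moreover have "\<ominus>\<^bsub>M\<^esub> x = (- 1) \<odot>\<^bsub>M\<^esub> x"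
        using M.smult_l_minus[of 1 x] c[OF that] one by (simp add: a_inv_mpoly_ring s1)
      ultimately show ?thesis using sm that by simp
    qed
    show "x \<oplus>\<^bsub>M\<^esub> y \<in> ?T" if "x \<in> ?T" "y \<in> ?T" for x y
      using 1[OF that one(1) one(1)] c[OF that(1)] c[OF that(2)] by (simp add: s1)
  qed (use c z in auto)
qed

lemma torsion_cohomology_trivial_iff:
  fixes E :: "nat \<Rightarrow> (('v, 'k::field) mpoly, 'e) module"
  assumes E: "\<And>i. module (mpoly_ring V) (E i)"
    and \<delta>: "\<And>i. \<delta> i \<in> module_hom (mpoly_ring V) (E i) (E (Suc i))"
    and V: "finite V"
  defines "T i \<equiv> torsion (mpoly_ring V) (max_hom_ideal V) (E i)"
    and "C i \<equiv> torsion_cohomology (mpoly_ring V) (max_hom_ideal V) E \<delta> i"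
  shows "carrier (C i) = {\<zero>\<^bsub>C i\<^esub>} \<longleftrightarrow>
    T i \<inter> a_kernel (E i) (E (Suc i)) (\<delta> i) \<subseteq> (case i of 0 \<Rightarrow> {\<zero>\<^bsub>E 0\<^esub>} | Suc k \<Rightarrow> \<delta> k ` T k)"
proof -
  interpret E: module "mpoly_ring V" "E i" by (rule E)
  let ?N = "case i of 0 \<Rightarrow> {\<zero>\<^bsub>E 0\<^esub>} | Suc k \<Rightarrow> \<delta> k ` T k"
  let ?K = "T i \<inter> a_kernel (E i) (E (Suc i)) (\<delta> i)"
  have N: "submodule ?N (mpoly_ring V) (E i)"
  proof (cases i)
    case 0
    interpret E0: module "mpoly_ring V" "E 0" by (rule E)
    show ?thesis using 0 by simp (rule E0.submoduleI, auto simp: minus_zero_module[OF E])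
  next
    case (Suc k)
    then show ?thesis using submodule_image[OF E E \<delta> submodule_torsion[OF E V], of k] by (simp add: T_def)
  qed
  note sub = E.submoduleE[OF N]
  have zN: "\<zero>\<^bsub>E i\<^esub> \<in> ?N" by (rule submodule_zero[OF N])
  have Ksub: "?K \<subseteq> carrier (E i)" by (auto simp: T_def torsion_def)
  have zK: "\<zero>\<^bsub>E i\<^esub> \<in> ?K"
    using submodule_zero[OF submodule_torsion[OF E V]] submodule_zero[OF submodule_kernel[OF E E \<delta>]]
    by (simp add: T_def)
  \<comment> \<open>Cosets are formed with the addition alone and ignore the restricted
    carrier.\<close>
  have "H +>\<^bsub>(E i)\<lparr>carrier := K\<rparr>\<^esub> x = H +>\<^bsub>E i\<^esub> x" for H K x
    by (simp add: a_r_coset_def')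
  then have car: "carrier (C i) = (\<lambda>x. ?N +>\<^bsub>E i\<^esub> x) ` ?K"
    unfolding C_def torsion_cohomology_def quot_module_def T_def
    by (simp add: A_RCOSETS_def' UNION_singleton_eq_range)
  have zero: "\<zero>\<^bsub>C i\<^esub> = ?N"
    unfolding C_def torsion_cohomology_def quot_module_def T_def by simp
  have coset: "?N +>\<^bsub>E i\<^esub> x = ?N \<longleftrightarrow> x \<in> ?N" if x: "x \<in> ?K" for x
  proof
    assume "?N +>\<^bsub>E i\<^esub> x = ?N"
    moreover have "\<zero>\<^bsub>E i\<^esub> \<oplus>\<^bsub>E i\<^esub> x \<in> ?N +>\<^bsub>E i\<^esub> x" unfolding a_r_coset_def' using zN by blast
    ultimately show "x \<in> ?N" using Ksub x by auto
  next
    assume "x \<in> ?N"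
    then show "?N +>\<^bsub>E i\<^esub> x = ?N"
      using E.M.a_coset_join2[OF _ submodule.axioms(1)[OF N]] Ksub x by auto
  qed
  show ?thesis
    unfolding car zero using coset zK by (auto simp: subset_iff) 
qed


section \<open>Depth of quotients by monomial ideals\<close>

text \<open>\<open>kdiff\<close> of the ring acting on itself, written with the operations of the
  type: its identities then hold by ring arithmetic, without carrier conditions.\<close>

fun pdiff :: "'r::comm_ring list \<Rightarrow> (bool list \<Rightarrow> 'r) \<Rightarrow> bool list \<Rightarrow> 'r" where
  "pdiff [] c bs = 0"
| "pdiff (x # xs) c [] = 0"
| "pdiff (x # xs) c (False # bs) = pdiff xs (\<lambda>b. c (False # b)) bs"
| "pdiff (x # xs) c (True # bs) = x * c (False # bs) - pdiff xs (\<lambda>b. c (True # b)) bs"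

lemma a_minus_ring_module:
  assumes "a \<in> carrier (mpoly_ring V)" "b \<in> carrier (mpoly_ring V)"
  shows "a \<ominus>\<^bsub>ring_module (mpoly_ring V)\<^esub> b = a - b"
proof -
  interpret N: module "mpoly_ring V" "ring_module (mpoly_ring V)"
    by (rule module_ring_module[OF cring_mpoly_ring])
  have "\<ominus>\<^bsub>ring_module (mpoly_ring V)\<^esub> b = - b"
    by (rule N.M.minus_equality) (use assms in \<open>auto simp: poly_closed\<close>)
  then show ?thesis by (simp add: a_minus_def)
qed

lemma kdiff_ring_module:
  fixes V :: "'v set" and c :: "bool list \<Rightarrow> ('v, 'k::field) mpoly"
  assumes "set xs \<subseteq> carrier (mpoly_ring V)" "\<And>b. c b \<in> carrier (mpoly_ring V)"
  shows "kdiff (ring_module (mpoly_ring V)) xs c bs = pdiff xs c bs"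
  using assms
proof (induction xs arbitrary: c bs)
  case (Cons x xs)
  have N: "module (mpoly_ring V) (ring_module (mpoly_ring V :: ('v, 'k) mpoly ring))"
    by (rule module_ring_module[OF cring_mpoly_ring])
  consider "bs = []" | bs' where "bs = False # bs'" | bs' where "bs = True # bs'" by (rule bool_list_cases)
  then show ?case
  proof cases
    case 3
    have "kdiff (ring_module (mpoly_ring V)) xs (\<lambda>b. c (True # b)) bs' \<in> carrier (mpoly_ring V)"
      using kdiff_carrier[OF N, of xs "\<lambda>b. c (True # b)"] Cons.prems by simp
    then show ?thesis
      using 3 Cons by (simp add: a_minus_ring_module poly_closed)
  qed (use Cons in auto)
qed simp

text \<open>Exactness of the Koszul complex of \<open>S/J\<close>, expressed on representatives in \<open>S\<close>.\<close>

definition koszul_exact_mod :: "'v set \<Rightarrow> ('v, 'k::field) mpoly list \<Rightarrow> ('v, 'k) mpoly set \<Rightarrow> int \<Rightarrow> bool" where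
  "koszul_exact_mod V xs J p \<longleftrightarrow>
     (\<forall>c\<in>cochains 0 (carrier (mpoly_ring V)) (length xs) p. (\<forall>bs. pdiff xs c bs \<in> J) \<longrightarrow>
       (\<exists>b\<in>cochains 0 (carrier (mpoly_ring V)) (length xs) (p - 1). \<forall>bs. c bs - pdiff xs b bs \<in> J))"

lemma koszul_exact_image_iff:
  fixes E :: "(('v, 'k::field) mpoly, 'e) module"
  assumes E: "module (mpoly_ring V) E" and \<phi>: "\<phi> \<in> module_hom (mpoly_ring V) (ring_module (mpoly_ring V)) E"
    and ker: "\<And>p. p \<in> carrier (mpoly_ring V) \<Longrightarrow> \<phi> p = \<zero>\<^bsub>E\<^esub> \<longleftrightarrow> p \<in> J" 
    and xs: "set xs \<subseteq> carrier (mpoly_ring V)"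
  shows "koszul_exact E (\<phi> ` carrier (mpoly_ring V)) xs p \<longleftrightarrow> koszul_exact_mod V xs J p"
proof -
  let ?R = "mpoly_ring V :: ('v, 'k) mpoly ring"
  have N: "module ?R (ring_module ?R)" by (rule module_ring_module[OF cring_mpoly_ring])
  interpret E: module ?R E by (rule E)
  have \<phi>0: "\<phi> 0 = \<zero>\<^bsub>E\<^esub>" using module_hom_zero[OF N E \<phi>] by simp
  have \<phi>m: "\<phi> (a - b) = \<phi> a \<ominus>\<^bsub>E\<^esub> \<phi> b" if "a \<in> carrier ?R" "b \<in> carrier ?R" for a b
    using module_hom_minus[OF N E \<phi>, of a b] that by (simp add: a_minus_ring_module)
  have \<phi>c: "\<phi> a \<in> carrier E" if "a \<in> carrier ?R" for a
    using module_homD(1)[OF \<phi>] that by simp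
  have \<phi>eq: "a - b \<in> J \<longleftrightarrow> \<phi> a = \<phi> b" if ab: "a \<in> carrier ?R" "b \<in> carrier ?R" for a b
  proof -
    have "a - b \<in> J \<longleftrightarrow> \<phi> a \<oplus>\<^bsub>E\<^esub> \<ominus>\<^bsub>E\<^esub> \<phi> b = \<zero>\<^bsub>E\<^esub>"
      using ker[of "a - b"] \<phi>m[OF ab] poly_closed(2)[OF ab] by (simp add: a_minus_def)
    also have "\<dots> \<longleftrightarrow> \<phi> a = \<phi> b"
    proof
      assume "\<phi> a \<oplus>\<^bsub>E\<^esub> \<ominus>\<^bsub>E\<^esub> \<phi> b = \<zero>\<^bsub>E\<^esub>"
      then have "\<ominus>\<^bsub>E\<^esub> (\<ominus>\<^bsub>E\<^esub> \<phi> b) = \<phi> a"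
        by (rule E.M.minus_equality) (use ab \<phi>c in auto)
      then show "\<phi> a = \<phi> b" using ab \<phi>c by simp
    qed (use ab \<phi>c in \<open>simp add: E.M.r_neg\<close>)
    finally show ?thesis .
  qed
  have pc: "pdiff xs c bs \<in> carrier ?R" and pk: "kdiff E xs (\<lambda>b. \<phi> (c b)) bs = \<phi> (pdiff xs c bs)"
    if "\<And>b. c b \<in> carrier ?R" for c bs
    using kdiff_hom[OF N E \<phi> xs, of c bs] that kdiff_ring_module[OF xs that] by auto
  show ?thesis
  proof
    assume ex: "koszul_exact E (\<phi> ` carrier ?R) xs p"
    show "koszul_exact_mod V xs J p"
      unfolding koszul_exact_mod_def
    proof (intro ballI impI)
      fix c assume c: "c \<in> cochains 0 (carrier ?R) (length xs) p" "\<forall>bs. pdiff xs c bs \<in> J"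
      have cc: "c bs \<in> carrier ?R" for bs by (rule cochainsD(1)[OF c(1)])
      have "(\<lambda>bs. \<phi> (c bs)) \<in> cochains \<zero>\<^bsub>E\<^esub> (\<phi> ` carrier ?R) (length xs) p"
        using c(1) by (rule cochains_map) (auto simp: \<phi>0)
      moreover have "kdiff E xs (\<lambda>bs. \<phi> (c bs)) = (\<lambda>bs. \<zero>\<^bsub>E\<^esub>)"
        using pk[of c, OF cc] ker pc[of c, OF cc] c(2) by auto
      ultimately obtain b' where b': "b' \<in> cochains \<zero>\<^bsub>E\<^esub> (\<phi> ` carrier ?R) (length xs) (p - 1)"
        "kdiff E xs b' = (\<lambda>bs. \<phi> (c bs))"
        using ex unfolding koszul_exact_def by blast
      obtain b where b: "b \<in> cochains 0 (carrier ?R) (length xs) (p - 1)" "\<And>bs. \<phi> (b bs) = b' bs"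
        using cochains_lift[OF b'(1) poly_closed(5) \<phi>0] by blast
      have bc: "b bs \<in> carrier ?R" for bs by (rule cochainsD(1)[OF b(1)])
      have "\<phi> (pdiff xs b bs) = \<phi> (c bs)" for bs
        using pk[of b bs, OF bc] by (simp add: b(2) b'(2))
      then have "c bs - pdiff xs b bs \<in> J" for bs
        using \<phi>eq[OF cc pc[of b, OF bc]] by simp
      then show "\<exists>b\<in>cochains 0 (carrier ?R) (length xs) (p - 1). \<forall>bs. c bs - pdiff xs b bs \<in> J"
        using b(1) by blast
    qed
  next
    assume ex: "koszul_exact_mod V xs J p"
    show "koszul_exact E (\<phi> ` carrier ?R) xs p"
      unfolding koszul_exact_def
    proof (intro ballI impI)
      fix c' assume c': "c' \<in> cochains \<zero>\<^bsub>E\<^esub> (\<phi> ` carrier ?R) (length xs) p" "kdiff E xs c' = (\<lambda>bs. \<zero>\<^bsub>E\<^esub>)"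
      obtain c where c: "c \<in> cochains 0 (carrier ?R) (length xs) p" "\<And>bs. \<phi> (c bs) = c' bs"
        using cochains_lift[OF c'(1) poly_closed(5) \<phi>0] by blast
      have cc: "c bs \<in> carrier ?R" for bs by (rule cochainsD(1)[OF c(1)])
      have "\<phi> (pdiff xs c bs) = \<zero>\<^bsub>E\<^esub>" for bs
        using pk[of c bs, OF cc] by (simp add: c(2) c'(2))
      then have "\<forall>bs. pdiff xs c bs \<in> J" using ker pc[of c, OF cc] by auto
      then obtain b where b: "b \<in> cochains 0 (carrier ?R) (length xs) (p - 1)"
        "\<And>bs. c bs - pdiff xs b bs \<in> J"
        using ex c(1) unfolding koszul_exact_mod_def by blast
      have bc: "b bs \<in> carrier ?R" for bs by (rule cochainsD(1)[OF b(1)])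
      have "(\<lambda>bs. \<phi> (b bs)) \<in> cochains \<zero>\<^bsub>E\<^esub> (\<phi> ` carrier ?R) (length xs) (p - 1)"
        using b(1) by (rule cochains_map) (auto simp: \<phi>0)
      moreover have "kdiff E xs (\<lambda>bs. \<phi> (b bs)) = c'"
        using pk[of b, OF bc] \<phi>eq[OF cc pc[of b, OF bc]] b(2) c(2) by auto
      ultimately show "\<exists>b\<in>cochains \<zero>\<^bsub>E\<^esub> (\<phi> ` carrier ?R) (length xs) (p - 1). kdiff E xs b = c'"
        by blast
    qed
  qed
qed

text \<open>Below the degree in question, exactness of the socles spreads to all annihilators of
  finite colength and hence to torsion. At the degree itself, \<open>socle_lift\<close> uses
  exactness one degree lower, which is why the depth has the form \<open>Suc t\<close>; all depths
  at issue are positive.\<close>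

lemma depth_eqI:
  fixes V :: "'v set" and J :: "('v, 'k::field) mpoly set"
  assumes V: "finite V" and J: "ideal J (mpoly_ring V)"
    and vs: "distinct vs" "set vs = V"
    and below: "\<And>i. i < Suc t \<Longrightarrow> koszul_exact_mod V (map mvar vs) J (int i)"
    and at: "\<not> koszul_exact_mod V (map mvar vs) J (int (Suc t))"
  shows "depth (mpoly_ring V) (max_hom_ideal V) (quot_module (ring_module (mpoly_ring V)) J) = Suc t"
proof -
  let ?R = "mpoly_ring V :: ('v, 'k) mpoly ring"
  let ?L = "quot_module (ring_module ?R) J"
  let ?\<mm> = "max_hom_ideal V :: ('v, 'k) mpoly set"
  have cr: "cring ?R" by (rule cring_mpoly_ring)
  have L: "module ?R ?L" by (rule module_quot_ring_module[OF cr J])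
  have N: "module ?R (ring_module ?R)" by (rule module_ring_module[OF cr])
  let ?P = "\<lambda>(E, \<delta>, \<epsilon>). injective_resolution ?R ?L E \<delta> \<epsilon>"
  \<comment> \<open>The choice is named once; from here on it enters only through being a
    resolution.\<close>
  define r where "r = (SOME x :: (nat \<Rightarrow> (_, ('v, 'k) mpoly list \<Rightarrow> ('v, 'k) mpoly set) module) \<times> _ \<times> _. ?P x)"
  have "\<exists>x :: (nat \<Rightarrow> (_, ('v, 'k) mpoly list \<Rightarrow> ('v, 'k) mpoly set) module) \<times> _ \<times> _. ?P x"
    using exists_injective_resolution[OF L] by auto
  from someI_ex[OF this] have Pr: "?P r" unfolding r_def .
  obtain E \<delta> \<epsilon> where red: "r = (E, \<delta>, \<epsilon>)" by (cases r) auto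
  have res: "injective_resolution ?R ?L E \<delta> \<epsilon>" using Pr red by simp
  have lc: "local_cohomology ?R ?\<mm> ?L i = torsion_cohomology ?R ?\<mm> E \<delta> i" for i
    unfolding local_cohomology_def r_def[symmetric] red by simp
  have inj: "injective_module ?R (E i)" and \<delta>: "\<delta> i \<in> module_hom ?R (E i) (E (Suc i))"
    and \<epsilon>: "\<epsilon> \<in> module_hom ?R ?L (E 0)" "inj_on \<epsilon> (carrier ?L)"
      "\<epsilon> ` carrier ?L = a_kernel (E 0) (E 1) (\<delta> 0)"
    and exact: "\<delta> i ` carrier (E i) = a_kernel (E (Suc i)) (E (Suc (Suc i))) (\<delta> (Suc i))" for i
    using res unfolding injective_resolution_def by auto
  have E: "module ?R (E i)" for i using inj by (simp add: injective_module_def)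
  let ?\<pi> = "\<lambda>x. J +>\<^bsub>?R\<^esub> x"
  let ?\<phi> = "\<lambda>x. \<epsilon> (?\<pi> x)"
  have \<pi>: "?\<pi> \<in> module_hom ?R (ring_module ?R) ?L" by (rule coset_hom[OF cr J])
  have \<phi>: "?\<phi> \<in> module_hom ?R (ring_module ?R) (E 0)"
    by (rule module_homI)
      (simp_all only: module_homD[OF \<pi>] module_homD[OF \<epsilon>(1)])
  have \<phi>_img: "?\<phi> ` carrier ?R = a_kernel (E 0) (E 1) (\<delta> 0)"
    unfolding \<epsilon>(3)[symmetric] carrier_quot_ring_module[OF cr J] by (simp add: image_image)
  have \<phi>_ker: "?\<phi> p = \<zero>\<^bsub>E 0\<^esub> \<longleftrightarrow> p \<in> J" if p: "p \<in> carrier ?R" for p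
  proof -
    interpret L: module ?R ?L by (rule L)
    have "?\<pi> p \<in> carrier ?L" using module_homD(1)[OF \<pi>] p by simp
    then have "\<epsilon> (?\<pi> p) = \<epsilon> \<zero>\<^bsub>?L\<^esub> \<longleftrightarrow> ?\<pi> p = \<zero>\<^bsub>?L\<^esub>"
      by (intro inj_on_eq_iff[OF \<epsilon>(2)]) auto
    then show ?thesis
      unfolding module_hom_zero[OF L E \<epsilon>(1)] coset_eq_zero_iff[OF cr J p] .
  qed
  have xs: "set (map mvar vs) \<subseteq> carrier ?R" using vs by (auto intro: mvar_carrier)
  have iff: "koszul_exact_mod V (map mvar vs) J (int i) \<longleftrightarrow> ann_exact E \<delta> (mvar ` V) i" for i
  proof -
    have "koszul_exact_mod V (map mvar vs) J (int i) \<longleftrightarrow>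
        koszul_exact (E 0) (a_kernel (E 0) (E 1) (\<delta> 0)) (map mvar vs) (int i)"
      unfolding \<phi>_img[symmetric] by (rule koszul_exact_image_iff[OF E \<phi> \<phi>_ker xs, symmetric])
    also have "\<dots> \<longleftrightarrow> ann_exact E \<delta> (set (map mvar vs)) i"
      using vs koszul_exact_injective[OF inj, of vs]
      by (intro koszul_exact_iff_ann_exact[where E = E and \<delta> = \<delta>, OF E \<delta> exact xs]) auto
    finally show ?thesis using vs by simp
  qed
  let ?T = "\<lambda>i. torsion ?R ?\<mm> (E i)"
  have triv: "carrier (local_cohomology ?R ?\<mm> ?L i) = {\<zero>\<^bsub>local_cohomology ?R ?\<mm> ?L i\<^esub>} \<longleftrightarrow>
    ?T i \<inter> a_kernel (E i) (E (Suc i)) (\<delta> i) \<subseteq> (case i of 0 \<Rightarrow> {\<zero>\<^bsub>E 0\<^esub>} | Suc k \<Rightarrow> \<delta> k ` ?T k)" for i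
    unfolding lc by (rule torsion_cohomology_trivial_iff[where E = E and \<delta> = \<delta>, OF E \<delta> V])
  have vanish: "carrier (local_cohomology ?R ?\<mm> ?L i) = {\<zero>\<^bsub>local_cohomology ?R ?\<mm> ?L i\<^esub>}" if i: "i < Suc t" for i
    unfolding triv
  proof
    fix z assume z: "z \<in> ?T i \<inter> a_kernel (E i) (E (Suc i)) (\<delta> i)"
    then have "z \<in> ?T i" by blast
    then obtain D where D: "finite D" "downset D" "\<And>m. m \<in> D \<Longrightarrow> keys m \<subseteq> V"
      "\<forall>a\<in>xpows_outside V D. a \<odot>\<^bsub>E i\<^esub> z = \<zero>\<^bsub>E i\<^esub>"
      unfolding torsion_iff[OF E[of i] V] by blast
    have "ann_exact E \<delta> (mvar ` V) i" using below[OF i] iff by blast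
    then have ex: "ann_exact E \<delta> (xpows_outside V D) i"
      by (rule ann_exact_downset[where E = E and \<delta> = \<delta>, OF inj \<delta> exact _ D(1-3)])
    show "z \<in> (case i of 0 \<Rightarrow> {\<zero>\<^bsub>E 0\<^esub>} | Suc k \<Rightarrow> \<delta> k ` ?T k)"
    proof (cases i)
      case 0
      then show ?thesis using ex z D(4) unfolding ann_exact_def by simp
    next
      case (Suc k)
      have "{e \<in> carrier (E k). \<forall>a\<in>xpows_outside V D. a \<odot>\<^bsub>E k\<^esub> e = \<zero>\<^bsub>E k\<^esub>} \<subseteq> ?T k"
      proof
        fix e assume "e \<in> {e \<in> carrier (E k). \<forall>a\<in>xpows_outside V D. a \<odot>\<^bsub>E k\<^esub> e = \<zero>\<^bsub>E k\<^esub>}"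
        then show "e \<in> ?T k"
          unfolding torsion_iff[OF E[of k] V] using D(1-3) by (intro conjI exI[of _ D]) auto
      qed
      moreover have "z \<in> \<delta> k ` {e \<in> carrier (E k). \<forall>a\<in>xpows_outside V D. a \<odot>\<^bsub>E k\<^esub> e = \<zero>\<^bsub>E k\<^esub>}"
        using ex z D(4) Suc unfolding ann_exact_def by simp
      ultimately show ?thesis using Suc by auto
    qed
  qed
  have nonvanish: "carrier (local_cohomology ?R ?\<mm> ?L (Suc t)) \<noteq> {\<zero>\<^bsub>local_cohomology ?R ?\<mm> ?L (Suc t)\<^esub>}"
  proof
    assume "carrier (local_cohomology ?R ?\<mm> ?L (Suc t)) = {\<zero>\<^bsub>local_cohomology ?R ?\<mm> ?L (Suc t)\<^esub>}"
    then have sub: "?T (Suc t) \<inter> a_kernel (E (Suc t)) (E (Suc (Suc t))) (\<delta> (Suc t)) \<subseteq> \<delta> t ` ?T t"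
      unfolding triv by simp
    have "ann_exact E \<delta> (mvar ` V) (Suc t)"
      unfolding ann_exact_def
    proof (intro ballI impI)
      fix z assume z: "z \<in> a_kernel (E (Suc t)) (E (Suc (Suc t))) (\<delta> (Suc t))"
        "\<forall>a\<in>mvar ` V. a \<odot>\<^bsub>E (Suc t)\<^esub> z = \<zero>\<^bsub>E (Suc t)\<^esub>"
      have zc: "z \<in> carrier (E (Suc t))" using z(1) by (simp add: a_kernel_def')
      \<comment> \<open>A socle element is torsion, with the downset \<open>{0}\<close>.\<close>
      have "\<forall>a\<in>xpows_outside V {0}. a \<odot>\<^bsub>E (Suc t)\<^esub> z = \<zero>\<^bsub>E (Suc t)\<^esub>"
      proof
        fix a :: "('v, 'k) mpoly" assume "a \<in> xpows_outside V {0}"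
        then obtain m where m: "a = xpow m" "keys m \<subseteq> V" "m \<noteq> 0" by (auto simp: xpows_outside_def)
        then obtain v where "v \<in> keys m" by (metis keys_eq_empty all_not_in_conv)
        then show "a \<odot>\<^bsub>E (Suc t)\<^esub> z = \<zero>\<^bsub>E (Suc t)\<^esub>"
          using xpow_annihilates[OF E zc _ m(2)] z(2) m by auto
      qed
      moreover have "downset {0 :: 'v monomial}"
        unfolding downset_def using tdeg_add tdeg_eq_0_iff by (metis add_eq_0_iff_both_eq_0 singletonD singletonI)
      ultimately have "z \<in> ?T (Suc t)"
        unfolding torsion_iff[OF E[of "Suc t"] V] using zc by (intro conjI exI[of _ "{0}"]) auto
      then obtain e where e: "e \<in> ?T t" "z = \<delta> t e" using sub z(1) by blast
      from e(1) obtain D where D: "finite D" "downset D" "\<And>m. m \<in> D \<Longrightarrow> keys m \<subseteq> V"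
        "e \<in> carrier (E t)" "\<forall>a\<in>xpows_outside V D. a \<odot>\<^bsub>E t\<^esub> e = \<zero>\<^bsub>E t\<^esub>"
        unfolding torsion_iff[OF E[of t] V] by blast
      have "ann_exact E \<delta> (mvar ` V) t" using below[of t] iff by simp
      from socle_lift[where E = E and \<delta> = \<delta>, OF inj \<delta> exact this D(1-3)]
      show "z \<in> (case Suc t of 0 \<Rightarrow> {\<zero>\<^bsub>E 0\<^esub>}
             | Suc k \<Rightarrow> \<delta> k ` {e \<in> carrier (E k). \<forall>a\<in>mvar ` V. a \<odot>\<^bsub>E k\<^esub> e = \<zero>\<^bsub>E k\<^esub>})"
        using D(4,5) e(2) z(2) zc by simp
    qed
    then show False using at iff by blast
  qed
  show ?thesis
    unfolding depth_def
  proof (rule Least_equality)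
    show "Suc t \<le> i" if "carrier (local_cohomology ?R ?\<mm> ?L i) \<noteq> {\<zero>\<^bsub>local_cohomology ?R ?\<mm> ?L i\<^esub>}" for i
      using vanish[of i] that by (meson not_less)
  qed (rule nonvanish)
qed

subsection \<open>Vanishing of Koszul cohomology modulo a monomial ideal\<close>

lemma pdiff_diff: "pdiff xs (\<lambda>b. c b - d b) bs = pdiff xs c bs - pdiff xs d bs"
proof (induction xs arbitrary: c d bs)
  case (Cons x xs)
  show ?case by (cases bs rule: bool_list_cases) (simp_all add: Cons algebra_simps)
qed simp

lemma pdiff_zero [simp]: "pdiff xs (\<lambda>b. 0) bs = 0"
  using pdiff_diff[of xs "\<lambda>b. 0" "\<lambda>b. 0" bs] by simp

lemma pdiff_uminus: "pdiff xs (\<lambda>b. - c b) bs = - pdiff xs c bs"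
  using pdiff_diff[of xs "\<lambda>b. 0" c bs] by simp

lemma pdiff_add: "pdiff xs (\<lambda>b. c b + d b) bs = pdiff xs c bs + pdiff xs d bs"
  using pdiff_diff[of xs c "\<lambda>b. - d b" bs] by (simp add: pdiff_uminus)

lemma pdiff_mult: "pdiff xs (\<lambda>b. a * c b) bs = a * pdiff xs c bs"
proof (induction xs arbitrary: c bs)
  case (Cons x xs)
  show ?case by (cases bs rule: bool_list_cases) (simp_all add: Cons algebra_simps)
qed simp

lemma pdiff_pdiff [simp]: "pdiff xs (pdiff xs c) bs = 0"
proof (induction xs arbitrary: c bs)
  case (Cons x xs)
  show ?case by (cases bs rule: bool_list_cases) (simp_all add: Cons pdiff_diff pdiff_mult)
qed simp

lemma pdiff_mem:
  assumes "0 \<in> I" "\<And>a b. a \<in> I \<Longrightarrow> b \<in> I \<Longrightarrow> a - b \<in> I" "\<And>x a. x \<in> set xs \<Longrightarrow> a \<in> I \<Longrightarrow> x * a \<in> I"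
    and "\<And>bs. c bs \<in> I"
  shows "pdiff xs c bs \<in> I"
  using assms(3,4)
proof (induction xs arbitrary: c bs)
  case (Cons x xs)
  show ?case by (cases bs rule: bool_list_cases) (use Cons assms(1,2) in simp_all)
qed (use assms(1) in simp)

lemma pdiff_support:
  assumes "\<And>bs. c bs \<noteq> 0 \<Longrightarrow> length bs = length xs \<and> int (count_list bs True) = p"
  shows "pdiff xs c bs \<noteq> 0 \<Longrightarrow> length bs = length xs \<and> int (count_list bs True) = p + 1"
  using assms
proof (induction xs arbitrary: c p bs)
  case (Cons x xs)
  show ?case
  proof (cases bs rule: bool_list_cases)
    case (2 bs')
    then show ?thesis
      using Cons.IH[of "\<lambda>b. c (False # b)" bs' p] Cons.prems(1) Cons.prems(2)[of "False # _"] by auto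
  next
    case (3 bs')
    then have "c (False # bs') \<noteq> 0 \<or> pdiff xs (\<lambda>b. c (True # b)) bs' \<noteq> 0"
      using Cons.prems(1) by auto
    then show ?thesis
    proof
      assume "c (False # bs') \<noteq> 0"
      then show ?thesis using Cons.prems(2)[of "False # bs'"] 3 by simp
    next
      assume *: "pdiff xs (\<lambda>b. c (True # b)) bs' \<noteq> 0"
      have "length b = length xs \<and> int (count_list b True) = p - 1" if "c (True # b) \<noteq> 0" for b
        using Cons.prems(2)[OF that] by auto
      from Cons.IH[OF * this] show ?thesis using 3 by simp
    qed
  qed (use Cons.prems in simp)
qed simp

text \<open>Contraction with the basis vector at the first occurrence of \<open>x\<close>; the sign
  is the one that matches \<open>pdiff\<close>.\<close>

fun phom :: "'r::comm_ring \<Rightarrow> 'r list \<Rightarrow> (bool list \<Rightarrow> 'r) \<Rightarrow> bool list \<Rightarrow> 'r" where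
  "phom x [] c bs = 0"
| "phom x (y # xs) c [] = 0"
| "phom x (y # xs) c (False # bs) = (if y = x then c (True # bs) else phom x xs (\<lambda>b. c (False # b)) bs)"
| "phom x (y # xs) c (True # bs) = (if y = x then 0 else - phom x xs (\<lambda>b. c (True # b)) bs)"

lemma phom_diff: "phom x xs (\<lambda>b. c b - d b) bs = phom x xs c bs - phom x xs d bs"
proof (induction xs arbitrary: c d bs)
  case (Cons y xs)
  show ?case by (cases bs rule: bool_list_cases) (simp_all add: Cons)
qed simp

lemma phom_mult: "phom x xs (\<lambda>b. a * c b) bs = a * phom x xs c bs"
proof (induction xs arbitrary: c bs)
  case (Cons y xs)
  show ?case by (cases bs rule: bool_list_cases) (simp_all add: Cons)
qed simp

text \<open>The contraction is a homotopy between multiplication by \<open>x\<close> and zero, so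
  the entries of the sequence act as zero on Koszul cohomology.\<close>

lemma phom_homotopy:
  "x \<in> set xs \<Longrightarrow> length bs = length xs \<Longrightarrow>
    pdiff xs (phom x xs c) bs + phom x xs (pdiff xs c) bs = x * c bs"
proof (induction xs arbitrary: c bs)
  case (Cons y xs)
  show ?case
  proof (cases bs rule: bool_list_cases)
    case (2 bs')
    then show ?thesis using Cons by (cases "y = x") auto
  next
    case (3 bs')
    show ?thesis
    proof (cases "y = x")
      case False
      have "pdiff xs (phom x xs (\<lambda>b. c (True # b))) bs' + phom x xs (pdiff xs (\<lambda>b. c (True # b))) bs'
        = x * c (True # bs')"
        using Cons False 3 by simp
      then show ?thesis using 3 False
        by (simp add: pdiff_uminus phom_diff phom_mult algebra_simps)
    qed (use 3 in simp)
  qed (use Cons in simp)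
qed simp

lemma phom_mem:
  assumes "0 \<in> I" "\<And>a. a \<in> I \<Longrightarrow> - a \<in> I" "\<And>bs. c bs \<in> I"
  shows "phom x xs c bs \<in> I"
  using assms(3)
proof (induction xs arbitrary: c bs)
  case (Cons y xs)
  show ?case by (cases bs rule: bool_list_cases) (use Cons assms(1,2) in simp_all)
qed (use assms(1) in simp)

lemma phom_support:
  assumes "\<And>bs. c bs \<noteq> 0 \<Longrightarrow> length bs = length xs \<and> int (count_list bs True) = p"
  shows "phom x xs c bs \<noteq> 0 \<Longrightarrow> length bs = length xs \<and> int (count_list bs True) = p - 1"
  using assms
proof (induction xs arbitrary: c p bs)
  case (Cons y xs)
  show ?case
  proof (cases bs rule: bool_list_cases)
    case (2 bs')
    show ?thesis
    proof (cases "y = x")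
      case True
      then show ?thesis using Cons.prems(1) Cons.prems(2)[of "True # bs'"] 2 by auto
    next
      case False
      then show ?thesis
        using Cons.IH[of "\<lambda>b. c (False # b)" bs' p] Cons.prems(1) Cons.prems(2)[of "False # _"] 2 by auto
    qed
  next
    case (3 bs')
    then have *: "phom x xs (\<lambda>b. c (True # b)) bs' \<noteq> 0"
      using Cons.prems(1) by (auto split: if_splits)
    have "length b = length xs \<and> int (count_list b True) = p - 1" if "c (True # b) \<noteq> 0" for b
      using Cons.prems(2)[OF that] by auto
    from Cons.IH[OF * this] show ?thesis using 3 by simp
  qed (use Cons.prems in simp)
qed simp

lemma cochainsI:
  assumes "\<And>bs. c bs \<in> H" "\<And>bs. c bs \<noteq> z \<Longrightarrow> length bs = n \<and> int (count_list bs True) = p"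
  shows "c \<in> cochains z H n p"
  using assms by (simp add: cochains_def)

lemma cochains_support:
  "c \<in> cochains z H n p \<Longrightarrow> c bs \<noteq> z \<Longrightarrow> length bs = n \<and> int (count_list bs True) = p"
  by (simp add: cochains_def)

lemma mon_ideal_cong:
  "(\<And>m. keys m \<subseteq> V \<Longrightarrow> m \<in> U \<longleftrightarrow> m \<in> U') \<Longrightarrow> mon_ideal V U = mon_ideal V U'"
  by (auto simp: mon_ideal_def)

lemma xpow_mult_memD: "xpow f * q \<in> mon_ideal V U \<Longrightarrow> q \<in> mon_ideal V {g. g + f \<in> U}"
  using shift_mon_ideal[of "xpow f * q" V U f] by simp

lemma xpow_mult_mem: "q \<in> mon_ideal V {g. g + f \<in> U} \<Longrightarrow> keys f \<subseteq> V \<Longrightarrow> xpow f * q \<in> mon_ideal V U"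
  using keys_mult[of "xpow f" q] by (fastforce simp: mon_ideal_def keys_add_nat add.commute)

context
  fixes V :: "'v set" and vs :: "'v list"
  assumes vs: "set vs = V"
begin

lemma pdiff_mon_ideal:
  fixes c :: "bool list \<Rightarrow> ('v, 'k::field) mpoly"
  assumes "upset U" "\<And>bs. c bs \<in> mon_ideal V U"
  shows "pdiff (map mvar vs) c bs \<in> mon_ideal V U"
proof (rule pdiff_mem)
  fix x a :: "('v, 'k) mpoly" assume "x \<in> set (map mvar vs)" "a \<in> mon_ideal V U"
  then show "x * a \<in> mon_ideal V U"
    using vs mvar_carrier by (auto simp: carrier_mpoly_ring intro!: mon_ideal_mult[OF assms(1)])
qed (use assms in \<open>auto intro: mon_ideal_diff\<close>)

lemma pdiff_cochains:
  fixes c :: "bool list \<Rightarrow> ('v, 'k::field) mpoly"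
  assumes "c \<in> cochains 0 (carrier (mpoly_ring V)) (length vs) p"
  shows "pdiff (map mvar vs) c \<in> cochains 0 (carrier (mpoly_ring V)) (length vs) (p + 1)"
proof (rule cochainsI)
  show "pdiff (map mvar vs) c bs \<in> carrier (mpoly_ring V)" for bs
    using pdiff_mon_ideal[of UNIV c bs] cochainsD(1)[OF assms] by (simp add: carrier_mpoly_ring)
  show "length bs = length vs \<and> int (count_list bs True) = p + 1" if "pdiff (map mvar vs) c bs \<noteq> 0" for bs
    using pdiff_support[of c "map mvar vs" p, OF _ that] cochains_support[OF assms] by simp
qed

lemma cochains_shift:
  fixes c :: "bool list \<Rightarrow> ('v, 'k::field) mpoly"
  assumes "c \<in> cochains 0 (carrier (mpoly_ring V)) n p"
  shows "(\<lambda>bs. shift f (c bs)) \<in> cochains 0 (carrier (mpoly_ring V)) n p"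
  using assms by (rule cochains_map)
    (use shift_mon_ideal[of _ V UNIV f] in \<open>auto simp: carrier_mpoly_ring\<close>)

lemma cochains_diff:
  fixes c d :: "bool list \<Rightarrow> ('v, 'k::field) mpoly"
  assumes "c \<in> cochains 0 (carrier (mpoly_ring V)) n p" "d \<in> cochains 0 (carrier (mpoly_ring V)) n p"
  shows "(\<lambda>bs. c bs - d bs) \<in> cochains 0 (carrier (mpoly_ring V)) n p"
proof (rule cochainsI)
  show "c bs - d bs \<in> carrier (mpoly_ring V)" for bs
    using cochainsD(1)[OF assms(1)] cochainsD(1)[OF assms(2)] by (rule poly_closed)
  show "length bs = n \<and> int (count_list bs True) = p" if "c bs - d bs \<noteq> 0" for bs
    using cochains_support[OF assms(1), of bs] cochains_support[OF assms(2), of bs] that by fastforce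
qed

text \<open>The middle of \<open>0 -> S/(J : f) -> S/J -> S/(J, f) -> 0\<close>, whose first map is
  multiplication by \<open>f\<close>. Exactness on the right makes a cocycle divisible by
  \<open>f\<close> up to a coboundary, and exactness on the left bounds the quotient.\<close>

lemma koszul_exact_mod_colon:
  fixes f :: "'v monomial" and U
  assumes U: "upset U" and f: "keys f \<subseteq> V"
    and 1: "koszul_exact_mod V (map mvar vs :: ('v, 'k::field) mpoly list) (mon_ideal V {g. g + f \<in> U}) p"
    and 2: "koszul_exact_mod V (map mvar vs :: ('v, 'k::field) mpoly list) (mon_ideal V (U \<union> up_closure {f})) p"
  shows "koszul_exact_mod V (map mvar vs :: ('v, 'k::field) mpoly list) (mon_ideal V U) p"
  unfolding koszul_exact_mod_def length_map
proof (intro ballI impI)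
  fix c :: "bool list \<Rightarrow> ('v, 'k) mpoly"
  assume c: "c \<in> cochains 0 (carrier (mpoly_ring V)) (length vs) p" "\<forall>bs. pdiff (map mvar vs) c bs \<in> mon_ideal V U"
  have "\<forall>bs. pdiff (map mvar vs) c bs \<in> mon_ideal V (U \<union> up_closure {f})"
    using c(2) mon_ideal_mono[of U "U \<union> up_closure {f}" V] by blast
  then obtain b1 where b1: "b1 \<in> cochains 0 (carrier (mpoly_ring V)) (length vs) (p - 1)"
    "\<And>bs. c bs - pdiff (map mvar vs) b1 bs \<in> mon_ideal V (U \<union> up_closure {f})"
    using 2 c(1) unfolding koszul_exact_mod_def length_map by blast
  define a where "a bs = shift f (c bs - pdiff (map mvar vs) b1 bs)" for bs
  have a: "a \<in> cochains 0 (carrier (mpoly_ring V)) (length vs) p"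
    unfolding a_def using pdiff_cochains[OF b1(1)] by (intro cochains_shift cochains_diff c(1)) simp
  have r: "c bs - pdiff (map mvar vs) b1 bs - xpow f * a bs \<in> mon_ideal V U" for bs
    unfolding a_def by (rule minus_shift_mon_ideal[OF b1(2)])
  have "pdiff (map mvar vs) (\<lambda>bs. c bs - pdiff (map mvar vs) b1 bs - xpow f * a bs) bs \<in> mon_ideal V U" for bs
    by (rule pdiff_mon_ideal[OF U r])
  then have d: "pdiff (map mvar vs) c bs - xpow f * pdiff (map mvar vs) a bs \<in> mon_ideal V U" for bs
    by (simp add: pdiff_diff pdiff_mult)
  have "xpow f * pdiff (map mvar vs) a bs \<in> mon_ideal V U" for bs
    using mon_ideal_diff[OF spec[OF c(2), of bs] d[of bs]] by simp
  then have "\<forall>bs. pdiff (map mvar vs) a bs \<in> mon_ideal V {g. g + f \<in> U}"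
    using xpow_mult_memD by blast
  then obtain b2 where b2: "b2 \<in> cochains 0 (carrier (mpoly_ring V)) (length vs) (p - 1)"
    "\<And>bs. a bs - pdiff (map mvar vs) b2 bs \<in> mon_ideal V {g. g + f \<in> U}"
    using 1 a unfolding koszul_exact_mod_def length_map by blast
  have fb2: "(\<lambda>bs. - (xpow f * b2 bs)) \<in> cochains 0 (carrier (mpoly_ring V)) (length vs) (p - 1)"
    using b2(1) by (rule cochains_map) (auto intro: poly_closed xpow_carrier[OF f])
  let ?b = "\<lambda>bs. b1 bs - - (xpow f * b2 bs)"
  have "?b \<in> cochains 0 (carrier (mpoly_ring V)) (length vs) (p - 1)" by (rule cochains_diff[OF b1(1) fb2])
  moreover have "c bs - pdiff (map mvar vs) ?b bs \<in> mon_ideal V U" for bs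
  proof -
    have "c bs - pdiff (map mvar vs) ?b bs = (c bs - pdiff (map mvar vs) b1 bs - xpow f * a bs) + xpow f * (a bs - pdiff (map mvar vs) b2 bs)"
      by (simp add: pdiff_add pdiff_mult) (simp add: algebra_simps)
    also have "\<dots> \<in> mon_ideal V U"
      by (intro mon_ideal_add r xpow_mult_mem[OF b2(2) f])
    finally show ?thesis .
  qed
  ultimately show "\<exists>b\<in>cochains 0 (carrier (mpoly_ring V)) (length vs) (p - 1). \<forall>bs. c bs - pdiff (map mvar vs) b bs \<in> mon_ideal V U"
    by blast
qed

text \<open>The variable is a nonzerodivisor modulo \<open>J\<close> by \<open>free\<close> and acts
  as zero on cohomology, so the cohomology of \<open>S/J\<close> in degree \<open>p\<close> is a
  quotient of that of \<open>S/(J, v)\<close> in degree \<open>p - 1\<close>.\<close>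

lemma koszul_exact_mod_free:
  fixes U
  assumes U: "upset U" and v: "v \<in> V" and free: "\<And>g. keys g \<subseteq> V \<Longrightarrow> g + var v \<in> U \<Longrightarrow> g \<in> U"
    and 1: "koszul_exact_mod V (map mvar vs :: ('v, 'k::field) mpoly list) (mon_ideal V (U \<union> up_closure {var v})) (p - 1)"
  shows "koszul_exact_mod V (map mvar vs :: ('v, 'k::field) mpoly list) (mon_ideal V U) p"
  unfolding koszul_exact_mod_def length_map
proof (intro ballI impI)
  fix c :: "bool list \<Rightarrow> ('v, 'k) mpoly"
  assume c: "c \<in> cochains 0 (carrier (mpoly_ring V)) (length vs) p" "\<forall>bs. pdiff (map mvar vs) c bs \<in> mon_ideal V U"
  let ?x = "mvar v :: ('v, 'k) mpoly" and ?U = "U \<union> up_closure {var v}"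
  have vx: "xpow (var v) = ?x" by (simp add: mvar_def)
  have x: "?x \<in> set (map mvar vs)" using v vs by auto
  have xc: "?x \<in> carrier (mpoly_ring V)" by (rule mvar_carrier[OF v])
  \<comment> \<open>Modulo \<open>J\<close> the coboundary of this contraction is
    \<open>x c\<close>, so it is a cocycle modulo \<open>(J, v)\<close>; it represents a preimage of
    \<open>c\<close> under the connecting map.\<close>
  let ?b = "phom ?x (map mvar vs) c"
  have b: "?b \<in> cochains 0 (carrier (mpoly_ring V)) (length vs) (p - 1)"
  proof (rule cochainsI)
    show "?b bs \<in> carrier (mpoly_ring V)" for bs
      by (rule phom_mem) (use cochainsD(1)[OF c(1)] poly_closed in auto)
    show "length bs = length vs \<and> int (count_list bs True) = p - 1" if "?b bs \<noteq> 0" for bs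
      using phom_support[of c "map mvar vs" p, OF _ that] cochains_support[OF c(1)] by simp
  qed
  have hc: "?x * c bs - pdiff (map mvar vs) ?b bs \<in> mon_ideal V U" for bs
  proof (cases "length bs = length vs")
    case True
    then have "?x * c bs - pdiff (map mvar vs) ?b bs = phom ?x (map mvar vs) (pdiff (map mvar vs) c) bs"
      using phom_homotopy[OF x, of bs c] by (simp add: algebra_simps)
    also have "\<dots> \<in> mon_ideal V U"
      by (rule phom_mem) (use c(2) mon_ideal_uminus in auto)
    finally show ?thesis .
  next
    case False
    then have "c bs = 0" "pdiff (map mvar vs) ?b bs = 0"
      using cochains_support[OF c(1), of bs] cochains_support[OF pdiff_cochains[OF b], of bs] by auto
    then show ?thesis by simp
  qed
  have U': "upset ?U" using U upset_up_closure[of "{var v}"] by (auto simp: upset_def)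
  have xm: "?x * q \<in> mon_ideal V ?U" if "q \<in> carrier (mpoly_ring V)" for q
    unfolding vx[symmetric]
    by (rule xpow_mult_mem) (use that v in \<open>auto simp: up_closure_def carrier_mpoly_ring mon_ideal_def\<close>)
  have "pdiff (map mvar vs) ?b bs \<in> mon_ideal V ?U" for bs
  proof -
    have "pdiff (map mvar vs) ?b bs = ?x * c bs - (?x * c bs - pdiff (map mvar vs) ?b bs)" by simp
    also have "\<dots> \<in> mon_ideal V ?U"
      by (rule mon_ideal_diff[OF xm[OF cochainsD(1)[OF c(1)]] subsetD[OF mon_ideal_mono[OF Un_upper1] hc]])
    finally show ?thesis .
  qed
  then obtain b' where b': "b' \<in> cochains 0 (carrier (mpoly_ring V)) (length vs) (p - 1 - 1)"
    "\<And>bs. ?b bs - pdiff (map mvar vs) b' bs \<in> mon_ideal V ?U"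
    using 1 b unfolding koszul_exact_mod_def length_map by blast
  define b2 where "b2 bs = shift (var v) (?b bs - pdiff (map mvar vs) b' bs)" for bs
  have b2: "b2 \<in> cochains 0 (carrier (mpoly_ring V)) (length vs) (p - 1)"
    unfolding b2_def using pdiff_cochains[OF b'(1)] by (intro cochains_shift cochains_diff b) simp
  have r: "?b bs - pdiff (map mvar vs) b' bs - ?x * b2 bs \<in> mon_ideal V U" for bs
    unfolding b2_def using minus_shift_mon_ideal[OF b'(2), of bs] by (simp only: vx)
  have "pdiff (map mvar vs) (\<lambda>bs. ?b bs - pdiff (map mvar vs) b' bs - ?x * b2 bs) bs \<in> mon_ideal V U" for bs
    by (rule pdiff_mon_ideal[OF U r])
  then have e: "pdiff (map mvar vs) ?b bs - ?x * pdiff (map mvar vs) b2 bs \<in> mon_ideal V U" for bs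
    by (simp add: pdiff_diff pdiff_mult)
  \<comment> \<open>Modulo \<open>J\<close> both \<open>x c\<close> and \<open>x\<close> times the
    coboundary of \<open>b2\<close> equal the coboundary of \<open>?b\<close>; it remains to cancel
    \<open>x\<close>.\<close>
  have "?x * (c bs - pdiff (map mvar vs) b2 bs) \<in> mon_ideal V U" for bs
    using mon_ideal_add[OF hc[of bs] e[of bs]] by (simp add: algebra_simps)
  then have "c bs - pdiff (map mvar vs) b2 bs \<in> mon_ideal V {g. g + var v \<in> U}" for bs
    unfolding vx[symmetric] by (rule xpow_mult_memD)
  then have "c bs - pdiff (map mvar vs) b2 bs \<in> mon_ideal V U" for bs
    using free unfolding mon_ideal_def by blast
  then show "\<exists>b\<in>cochains 0 (carrier (mpoly_ring V)) (length vs) (p - 1). \<forall>bs. c bs - pdiff (map mvar vs) b bs \<in> mon_ideal V U"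
    using b2 by blast
qed

lemma koszul_exact_mod_negative:
  "p < 0 \<Longrightarrow> koszul_exact_mod V (map mvar vs :: ('v, 'k::field) mpoly list) (mon_ideal V U) p"
  unfolding koszul_exact_mod_def
proof (intro ballI impI)
  fix c :: "bool list \<Rightarrow> ('v, 'k) mpoly"
  assume p: "p < 0" and c: "c \<in> cochains 0 (carrier (mpoly_ring V)) (length (map mvar vs)) p"
  have "c = (\<lambda>bs. 0)" by (rule cochains_negative[OF c p])
  then show "\<exists>b\<in>cochains 0 (carrier (mpoly_ring V)) (length (map mvar vs)) (p - 1). \<forall>bs. c bs - pdiff (map mvar vs) b bs \<in> mon_ideal V U"
    by (intro bexI[of _ "\<lambda>bs. 0"]) (auto simp: cochains_def poly_closed)
qed

lemma koszul_exact_mod_UNIV: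
  "koszul_exact_mod V (map mvar vs :: ('v, 'k::field) mpoly list) (mon_ideal V UNIV) p"
  unfolding koszul_exact_mod_def
proof (intro ballI impI)
  fix c :: "bool list \<Rightarrow> ('v, 'k) mpoly"
  assume "c \<in> cochains 0 (carrier (mpoly_ring V)) (length (map mvar vs)) p"
  then show "\<exists>b\<in>cochains 0 (carrier (mpoly_ring V)) (length (map mvar vs)) (p - 1). \<forall>bs. c bs - pdiff (map mvar vs) b bs \<in> mon_ideal V UNIV"
    using cochainsD(1) by (intro bexI[of _ "\<lambda>bs. 0"]) (auto simp: cochains_def poly_closed carrier_mpoly_ring)
qed

end

subsection \<open>A nonvanishing criterion\<close>

text \<open>A 1-form: its coefficients are the entries of the first argument, placed at the lists
  with a single \<open>True\<close>.\<close>

fun cochain1 :: "'r::comm_ring list \<Rightarrow> bool list \<Rightarrow> 'r" where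
  "cochain1 [] bs = 0"
| "cochain1 (g # gs) [] = 0"
| "cochain1 (g # gs) (False # bs) = cochain1 gs bs"
| "cochain1 (g # gs) (True # bs) = (if bs = replicate (length gs) False then g else 0)"

lemma cochain1_mem: "0 \<in> I \<Longrightarrow> set gs \<subseteq> I \<Longrightarrow> cochain1 gs bs \<in> I"
proof (induction gs arbitrary: bs)
  case (Cons g gs)
  then show ?case by (cases bs rule: bool_list_cases) simp_all
qed simp

lemma cochain1_support: "cochain1 gs bs \<noteq> 0 \<Longrightarrow> length bs = length gs \<and> count_list bs True = 1"
proof (induction gs arbitrary: bs)
  case (Cons g gs)
  then show ?case
    by (cases bs rule: bool_list_cases) (auto split: if_splits)
qed simp

lemma cochain1_diff: "x * cochain1 (map G us) bs - cochain1 (map H us) bs = cochain1 (map (\<lambda>u. x * G u - H u) us) bs"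
proof (induction us arbitrary: bs)
  case (Cons u us)
  show ?case by (cases bs rule: bool_list_cases) (simp_all add: Cons)
qed simp

lemma pdiff_replicate_False: "pdiff xs c (replicate n False) = 0"
proof (induction xs arbitrary: c n)
  case (Cons x xs)
  then show ?case by (cases n) simp_all
qed simp

lemma pdiff_point: "pdiff xs (\<lambda>b. if b = replicate (length xs) False then g else 0) bs = cochain1 (map (\<lambda>x. x * g) xs) bs"
proof (induction xs arbitrary: bs)
  case (Cons x xs)
  show ?case by (cases bs rule: bool_list_cases) (simp_all add: Cons)
qed simp

lemma pdiff_cochain1_mem:
  assumes "0 \<in> I" "\<And>u v. u \<in> set us \<Longrightarrow> v \<in> set us \<Longrightarrow> X u * G v - X v * G u \<in> I"
  shows "pdiff (map X us) (cochain1 (map G us)) bs \<in> I"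
  using assms(2)
proof (induction us arbitrary: bs)
  case (Cons u us)
  show ?case
  proof (cases bs rule: bool_list_cases)
    case (3 bs')
    have "pdiff (map X (u # us)) (cochain1 (map G (u # us))) bs =
      X u * cochain1 (map G us) bs' - cochain1 (map (\<lambda>v. X v * G u) us) bs'"
      using 3 pdiff_point[of "map X us" "G u" bs'] by (simp add: comp_def)
    also have "\<dots> = cochain1 (map (\<lambda>v. X u * G v - X v * G u) us) bs'"
      by (rule cochain1_diff)
    also have "\<dots> \<in> I"
      by (rule cochain1_mem[OF assms(1)]) (use Cons.prems in auto)
    finally show ?thesis .
  qed (use Cons assms(1) in simp_all)
qed (use assms(1) in simp)

text \<open>Exterior multiplication by the top form of the first \<open>k\<close> entries; it moves
  a cocycle up by \<open>k\<close> degrees.\<close>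

fun prepend_True :: "nat \<Rightarrow> (bool list \<Rightarrow> 'r::zero) \<Rightarrow> bool list \<Rightarrow> 'r" where
  "prepend_True 0 c bs = c bs"
| "prepend_True (Suc k) c [] = 0"
| "prepend_True (Suc k) c (b # bs) = (if b then prepend_True k c bs else 0)"

lemma prepend_True_replicate [simp]: "prepend_True k c (replicate k True @ bs) = c bs"
  by (induction k) simp_all

lemma prepend_True_mem: "0 \<in> I \<Longrightarrow> (\<And>bs. c bs \<in> I) \<Longrightarrow> prepend_True k c bs \<in> I"
  by (induction k c bs rule: prepend_True.induct) auto

lemma prepend_True_support:
  "prepend_True k c bs \<noteq> 0 \<Longrightarrow> (\<And>bs. c bs \<noteq> 0 \<Longrightarrow> length bs = n \<and> count_list bs True = p) \<Longrightarrow>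
    length bs = k + n \<and> count_list bs True = k + p"
  by (induction k c bs rule: prepend_True.induct) (auto split: if_splits)

lemma pdiff_prepend_True_mem:
  assumes "0 \<in> I" "\<And>a. a \<in> I \<Longrightarrow> - a \<in> I" "\<And>bs. pdiff xs c bs \<in> I"
  shows "pdiff (zs @ xs) (prepend_True (length zs) c) bs \<in> I"
proof (induction zs arbitrary: bs)
  case Nil
  have "prepend_True 0 c = c" by (rule ext) simp
  then show ?case using assms by simp
next
  case (Cons z zs)
  show ?case by (cases bs rule: bool_list_cases) (simp_all add: Cons assms)
qed

lemma pdiff_unit:
  "pdiff (xs @ y # ys) c (replicate (length xs) False @ True # replicate (length ys) False) =
    y * c (replicate (length (xs @ y # ys)) False)"
  by (induction xs arbitrary: c) (simp_all add: pdiff_replicate_False)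

lemma cochain1_unit:
  "cochain1 (xs @ y # ys) (replicate (length xs) False @ True # replicate (length ys) False) = y"
  by (induction xs) simp_all

text \<open>A monomial free of the variables \<open>zs\<close> does not see terms multiplied by one
  of them, so passing each of these positions only contributes a sign.\<close>

lemma lookup_pdiff_replicate_True:
  fixes c :: "bool list \<Rightarrow> ('v, 'k::field) mpoly"
  assumes "keys m \<inter> set zs = {}"
  shows "lookup (pdiff (map mvar zs @ xs) c (replicate (length zs) True @ e)) m =
    (- 1) ^ length zs * lookup (pdiff xs (\<lambda>e. c (replicate (length zs) True @ e)) e) m"
  using assms
proof (induction zs arbitrary: c)
  case (Cons z zs)
  have "m \<noteq> m' + var z" for m'
    using Cons.prems by (auto simp: keys_add_nat)
  then have "lookup (mvar z * c (False # replicate (length zs) True @ e)) m = 0"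
    unfolding mvar_def by (rule lookup_xpow_mult_eq_0)
  then show ?case
    using Cons.IH[of "\<lambda>b. c (True # b)"] Cons.prems by (simp add: lookup_minus)
qed simp

text \<open>Multiples of \<open>f\<close> outside \<open>U\<close> form a complex in which
  \<open>X\<close> and \<open>Y\<close> are not connected. The 1-form with entries
  \<open>f x\<close> on \<open>X\<close> and zero on \<open>Y\<close> is a cocycle since mixed
  products lie in \<open>U\<close>, but a coboundary has the same coefficient at all vertices. The
  variables \<open>zs\<close> do not divide \<open>f\<close> and enter through their top
  form.\<close>

lemma not_koszul_exact_mod:
  fixes V :: "'v set"
  assumes V: "set zs \<union> set us = V" "set zs \<inter> set us = {}" and U: "upset U" and f: "keys f \<subseteq> set us"
    and XY: "set us = X \<union> Y" "X \<inter> Y = {}" "X \<noteq> {}" "Y \<noteq> {}"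
    and fXY: "\<And>x y. x \<in> X \<Longrightarrow> y \<in> Y \<Longrightarrow> f + var x + var y \<in> U"
    and fX: "\<And>x. x \<in> X \<Longrightarrow> f + var x \<notin> U" and fY: "\<And>y. y \<in> Y \<Longrightarrow> f + var y \<notin> U"
  shows "\<not> koszul_exact_mod V (map mvar (zs @ us) :: ('v, 'k::field) mpoly list) (mon_ideal V U)
    (int (length zs) + 1)"
proof
  let ?S = "carrier (mpoly_ring V) :: ('v, 'k) mpoly set"
  let ?xs = "map mvar (zs @ us) :: ('v, 'k) mpoly list"
  let ?n = "length us" and ?k = "length zs"
  assume ex: "koszul_exact_mod V ?xs (mon_ideal V U) (int ?k + 1)"
  define G :: "'v \<Rightarrow> ('v, 'k) mpoly" where "G v = (if v \<in> X then xpow (f + var v) else 0)" for v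
  let ?c = "prepend_True ?k (cochain1 (map G us))"
  have G: "set (map G us) \<subseteq> ?S"
    using V(1) f by (auto simp: G_def carrier_mpoly_ring mon_in_mon_ideal_iff keys_add_nat)
  have "?c \<in> cochains 0 ?S (length ?xs) (int ?k + 1)"
  proof (rule cochainsI)
    show "?c bs \<in> ?S" for bs
      using G by (intro prepend_True_mem cochain1_mem) (auto simp: poly_closed)
    show "length bs = length ?xs \<and> int (count_list bs True) = int ?k + 1" if "?c bs \<noteq> 0" for bs
      using prepend_True_support[OF that, of ?n 1] cochain1_support[of "map G us"] by auto
  qed
  moreover have "\<forall>bs. pdiff ?xs ?c bs \<in> mon_ideal V U"
  proof
    fix bs
    have "mvar u * G v - mvar v * G u \<in> mon_ideal V U" if uv: "u \<in> set us" "v \<in> set us" for u v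
    proof -
      have sub: "keys f \<subseteq> V" "u \<in> V" "v \<in> V" using f uv V by auto
      consider "u \<in> X" "v \<in> X" | "u \<in> X" "v \<in> Y" | "u \<in> Y" "v \<in> X" | "u \<in> Y" "v \<in> Y"
        using uv XY by blast
      then show ?thesis
      proof cases
        case 1
        then show ?thesis by (simp add: G_def mvar_def mult_single add_ac)
      next
        case 2
        then have "v \<notin> X" using XY by blast
        with 2 show ?thesis
          using fXY[OF 2] sub by (auto simp: G_def mvar_def mult_single add_ac keys_add_nat mon_in_mon_ideal_iff
              intro!: mon_ideal_uminus)
      next
        case 3
        then have "u \<notin> X" using XY by blast
        with 3 show ?thesis
          using fXY[OF 3(2,1)] sub by (auto simp: G_def mvar_def mult_single add_ac keys_add_nat mon_in_mon_ideal_iff)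
      next
        case 4
        then have "u \<notin> X" "v \<notin> X" using XY by blast+
        then show ?thesis by (simp add: G_def)
      qed
    qed
    then have "pdiff (map mvar us) (cochain1 (map G us)) bs \<in> mon_ideal V U" for bs
      by (intro pdiff_cochain1_mem) auto
    from pdiff_prepend_True_mem[OF _ _ this, of "map mvar zs" bs]
    show "pdiff ?xs ?c bs \<in> mon_ideal V U" by (simp add: mon_ideal_uminus)
  qed
  ultimately obtain b where b: "\<And>bs. ?c bs - pdiff ?xs b bs \<in> mon_ideal V U"
    using ex unfolding koszul_exact_mod_def by blast
  let ?q = "b (replicate ?k True @ replicate ?n False)"
  \<comment> \<open>The right-hand side does not depend on \<open>v\<close>, while the left-hand
    side is 1 on \<open>X\<close> and 0 on \<open>Y\<close>.\<close>
  have key: "lookup (G v) (f + var v) = (- 1) ^ ?k * lookup ?q f" if v: "v \<in> set us" for v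
  proof -
    obtain us1 us2 where us: "us = us1 @ v # us2" using v by (meson split_list)
    let ?e = "replicate (length us1) False @ True # replicate (length us2) False"
    have "f + var v \<notin> U" using fX fY v XY by blast
    then have "f + var v \<notin> keys (?c (replicate ?k True @ ?e) - pdiff ?xs b (replicate ?k True @ ?e))"
      using b[of "replicate ?k True @ ?e"] by (auto simp: mon_ideal_def)
    then have "lookup (?c (replicate ?k True @ ?e)) (f + var v) = lookup (pdiff ?xs b (replicate ?k True @ ?e)) (f + var v)"
      by (simp add: in_keys_iff lookup_minus)
    also have "?c (replicate ?k True @ ?e) = G v"
      using cochain1_unit[of "map G us1" "G v" "map G us2"] us by simp
    also have "lookup (pdiff ?xs b (replicate ?k True @ ?e)) (f + var v) =
      (- 1) ^ ?k * lookup (pdiff (map mvar us) (\<lambda>e. b (replicate ?k True @ e)) ?e) (f + var v)"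
      using lookup_pdiff_replicate_True[of "f + var v" zs "map mvar us" b ?e] v f V(2)
      by (auto simp: keys_add_nat)
    also have "pdiff (map mvar us) (\<lambda>e. b (replicate ?k True @ e)) ?e = mvar v * ?q"
      using pdiff_unit[of "map mvar us1" "mvar v" "map mvar us2"] us by simp
    also have "lookup (mvar v * ?q) (f + var v) = lookup ?q f"
      unfolding mvar_def by (rule lookup_xpow_mult_add)
    finally show ?thesis .
  qed
  obtain x y where xy: "x \<in> X" "y \<in> Y" using XY by blast
  then have "y \<notin> X" using XY by blast
  then show False using key[of x] key[of y] xy XY(1) by (simp add: G_def)
qed

section \<open>Powers of edge ideals\<close>

text \<open>Otherwise \<open>var v\<close> is rewritten to \<open>Poly_Mapping.single v (Suc 0)\<close>.\<close>

declare One_nat_def [simp del]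

text \<open>The argument \<open>K\<close> only fixes the coefficient field.\<close>

definition vanish :: "'k::field itself \<Rightarrow> 'v list \<Rightarrow> 'v monomial set \<Rightarrow> int \<Rightarrow> bool" where
  "vanish K vs U t \<longleftrightarrow> (\<forall>p<t. koszul_exact_mod (set vs)
     (map mvar vs :: ('v, 'k) mpoly list) (mon_ideal (set vs) U) p)"

lemma vanish_mono: "vanish K vs U t \<Longrightarrow> t' \<le> t \<Longrightarrow> vanish K vs U t'"
  by (simp add: vanish_def)

lemma vanish_nonpos: "t \<le> 0 \<Longrightarrow> vanish K vs U t"
  by (simp add: vanish_def koszul_exact_mod_negative)

lemma vanish_UNIV: "vanish K vs UNIV t"
  by (simp add: vanish_def koszul_exact_mod_UNIV)

lemma vanish_cong:
  "(\<And>m. keys m \<subseteq> set vs \<Longrightarrow> m \<in> U \<longleftrightarrow> m \<in> U') \<Longrightarrow> vanish K vs U t \<longleftrightarrow> vanish K vs U' t"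
  unfolding vanish_def using mon_ideal_cong[of "set vs" U U'] by metis

lemma vanish_colon:
  "upset U \<Longrightarrow> keys f \<subseteq> set vs \<Longrightarrow> vanish K vs {g. g + f \<in> U} t \<Longrightarrow>
    vanish K vs (U \<union> up_closure {f}) t \<Longrightarrow> vanish K vs U t"
  unfolding vanish_def using koszul_exact_mod_colon[OF refl] by blast

lemma vanish_free:
  fixes K :: "'a::field itself"
  assumes "upset U" "v \<in> set vs" "\<And>g. keys g \<subseteq> set vs \<Longrightarrow> g + var v \<in> U \<Longrightarrow> g \<in> U"
    and "vanish K vs (U \<union> up_closure {var v}) t"
  shows "vanish K vs U (t + 1)"
  unfolding vanish_def
proof (intro allI impI)
  fix p assume "p < t + 1"
  then have "p - 1 < t" by simp
  with assms(4) have "koszul_exact_mod (set vs) (map mvar vs :: (_ \<Rightarrow>\<^sub>0 'a) list)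
      (mon_ideal (set vs) (U \<union> up_closure {var v})) (p - 1)"
    unfolding vanish_def by blast
  then show "koszul_exact_mod (set vs) (map mvar vs :: (_ \<Rightarrow>\<^sub>0 'a) list) (mon_ideal (set vs) U) p"
    using koszul_exact_mod_free[OF refl assms(1,2), where p = p] assms(3) by blast
qed

text \<open>One edge is peeled off at a time; starting from \<open>UNIV\<close> leaves room for an
  arbitrary cofactor, so the set is an upset without further closure.\<close>

fun edge_pow :: "('v \<Rightarrow> 'v \<Rightarrow> bool) \<Rightarrow> nat \<Rightarrow> 'v monomial set" where
  "edge_pow A 0 = UNIV"
| "edge_pow A (Suc s) = {var u + var v + m | u v m. A u v \<and> m \<in> edge_pow A s}"

lemma edge_powI: "A u v \<Longrightarrow> m \<in> edge_pow A s \<Longrightarrow> var u + var v + m \<in> edge_pow A (Suc s)"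
  by auto

lemma edge_powE:
  assumes "k \<in> edge_pow A (Suc s)"
  obtains u v m where "k = var u + var v + m" "A u v" "m \<in> edge_pow A s"
  using assms by auto

declare edge_pow.simps(2) [simp del]

lemma upset_edge_pow: "upset (edge_pow A s)"
proof (induction s)
  case (Suc s)
  show ?case
    unfolding upset_def
  proof (intro ballI allI)
    fix k r assume "k \<in> edge_pow A (Suc s)"
    then obtain u v m where k: "k = var u + var v + m" "A u v" "m \<in> edge_pow A s" by (rule edge_powE)
    then have "r + m \<in> edge_pow A s" using Suc by (simp add: upset_def)
    from edge_powI[OF k(2) this] show "r + k \<in> edge_pow A (Suc s)" by (simp add: k(1) add_ac)
  qed
qed simp

lemma edge_pow_upward: "m \<in> edge_pow A s \<Longrightarrow> r + m \<in> edge_pow A s" "m \<in> edge_pow A s \<Longrightarrow> m + r \<in> edge_pow A s"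
  using upset_edge_pow[of A s] by (auto simp: upset_def add.commute)

lemma powset_eq_edge_pow: "powset (up_closure {var u + var v | u v. A u v}) s = edge_pow A s"
proof (induction s)
  case (Suc s)
  show ?case
  proof (intro equalityI subsetI)
    fix k assume "k \<in> powset (up_closure {var u + var v | u v. A u v}) (Suc s)"
    then have "k \<in> sumset (edge_pow A s) (up_closure {var u + var v | u v. A u v})"
      by (simp only: powset.simps Suc)
    then obtain m r u v where k: "k = m + (r + (var u + var v))" "m \<in> edge_pow A s" "A u v"
      unfolding sumset_def up_closure_def by blast
    from edge_powI[OF k(3) edge_pow_upward(2)[OF k(2), of r]] show "k \<in> edge_pow A (Suc s)" by (simp add: k(1) add_ac)
  next
    fix k assume "k \<in> edge_pow A (Suc s)"
    then obtain u v m where k: "k = var u + var v + m" "A u v" "m \<in> edge_pow A s" by (rule edge_powE)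
    have "k = m + (0 + (var u + var v))" by (simp add: k(1) add_ac)
    then show "k \<in> powset (up_closure {var u + var v | u v. A u v}) (Suc s)"
      using k Suc unfolding powset.simps sumset_def up_closure_def by blast
  qed
qed simp

section \<open>Induced subgraphs and colons by an edge\<close>

definition restr :: "('v \<Rightarrow> 'v \<Rightarrow> bool) \<Rightarrow> 'v set \<Rightarrow> 'v \<Rightarrow> 'v \<Rightarrow> bool" where
  "restr A W u v \<longleftrightarrow> A u v \<and> u \<notin> W \<and> v \<notin> W"

text \<open>Exponents do not cancel, so a monomial avoiding \<open>W\<close> is divisible only by
  edges avoiding \<open>W\<close>.\<close>

lemma edge_pow_restr: "keys m \<inter> W = {} \<Longrightarrow> m \<in> edge_pow (restr A W) s \<longleftrightarrow> m \<in> edge_pow A s"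
proof (induction s arbitrary: m)
  case (Suc s)
  show ?case
  proof
    assume "m \<in> edge_pow (restr A W) (Suc s)"
    then obtain u v k where k: "m = var u + var v + k" "restr A W u v" "k \<in> edge_pow (restr A W) s" by (rule edge_powE)
    have "keys k \<inter> W = {}" using Suc.prems by (auto simp: k(1) keys_add_nat)
    then have "k \<in> edge_pow A s" using Suc.IH k(3) by blast
    moreover have "A u v" using k(2) by (simp add: restr_def)
    ultimately show "m \<in> edge_pow A (Suc s)" unfolding k(1) by (intro edge_powI)
  next
    assume "m \<in> edge_pow A (Suc s)"
    then obtain u v k where k: "m = var u + var v + k" "A u v" "k \<in> edge_pow A s" by (rule edge_powE)
    have "keys k \<inter> W = {}" using Suc.prems by (auto simp: k(1) keys_add_nat)
    then have "k \<in> edge_pow (restr A W) s" using Suc.IH k(3) by blast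
    moreover have "restr A W u v" using k(2) Suc.prems by (auto simp: k(1) keys_add_nat restr_def)
    ultimately show "m \<in> edge_pow (restr A W) (Suc s)" unfolding k(1) by (intro edge_powI)
  qed
qed simp

lemma var_add_eq_cancel:
  assumes "n + var y = var v + m'" "y \<noteq> v"
  obtains m'' where "m' = m'' + var y" "n = var v + m''"
proof -
  have "y \<in> keys (n + var y)" by (simp add: keys_add_nat)
  then have "y \<in> keys (var v + m')" by (simp only: assms(1))
  then have "y \<in> keys m'" using assms(2) by (auto simp: keys_add_nat)
  then have m': "m' - var y + var y = m'" by (rule var_add_minus)
  then have "n + var y = (var v + (m' - var y)) + var y" using assms(1) by (simp add: add_ac)
  then have "n = var v + (m' - var y)" by simp
  then show ?thesis using that[of "m' - var y"] m' by simp
qed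

text \<open>The variable \<open>v\<close> occurs in no edge and can only sit in the
  cofactor.\<close>

lemma edge_pow_isolated:
  assumes "\<And>w. \<not> A v w" "\<And>w. \<not> A w v"
  shows "g + var v \<in> edge_pow A s \<longleftrightarrow> g \<in> edge_pow A s"
proof
  show "g + var v \<in> edge_pow A s \<Longrightarrow> g \<in> edge_pow A s"
  proof (induction s arbitrary: g)
    case (Suc s)
    then obtain u w m where m: "g + var v = var u + var w + m" "A u w" "m \<in> edge_pow A s" by (auto elim: edge_powE)
    then have uw: "v \<noteq> u" "v \<noteq> w" using assms by auto
    have "g + var v = var u + (var w + m)" using m(1) by (simp add: add_ac)
    then obtain m1 where m1: "var w + m = m1 + var v" "g = var u + m1"
      by (rule var_add_eq_cancel) (use uw in auto)
    obtain m2 where m2: "m = m2 + var v" "m1 = var w + m2"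
      using var_add_eq_cancel[OF m1(1)[symmetric] uw(2)] .
    from edge_powI[OF m(2) Suc.IH[of m2]] show ?case using m(3) by (simp add: m2 m1(2) add_ac)
  qed simp
qed (rule edge_pow_upward)

text \<open>Every neighbour of \<open>y\<close> is a neighbour of \<open>b\<close>, so an edge
  through \<open>y\<close> may be rerouted through \<open>b\<close>; a \<open>y\<close> in the
  cofactor is simply replaced.\<close>

lemma edge_pow_subst:
  assumes "\<And>u v. A u v \<Longrightarrow> A v u" "\<And>c. A y c \<Longrightarrow> A b c"
  shows "m + var y \<in> edge_pow A s \<Longrightarrow> m + var b \<in> edge_pow A s"
proof (induction s arbitrary: m)
  case (Suc s)
  then obtain u w k where k: "m + var y = var u + var w + k" "A u w" "k \<in> edge_pow A s" by (auto elim: edge_powE)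
  consider "u = y" | "w = y" | "u \<noteq> y" "w \<noteq> y" by blast
  then show ?case
  proof cases
    case 1
    then have "m + var y = (var w + k) + var y" using k(1) by (simp add: add_ac)
    then have "m = var w + k" by (rule add_right_imp_eq)
    then have "m + var b = var b + var w + k" by (simp add: add_ac)
    then show ?thesis using edge_powI[of A b w k] k assms 1 by simp
  next
    case 2
    then have "m + var y = (var u + k) + var y" using k(1) by (simp add: add_ac)
    then have "m = var u + k" by (rule add_right_imp_eq)
    then have "m + var b = var b + var u + k" by (simp add: add_ac)
    then show ?thesis using edge_powI[of A b u k] k assms 2 by simp
  next
    case 3
    have "m + var y = var u + (var w + k)" using k(1) by (simp add: add_ac)
    then obtain m1 where m1: "var w + k = m1 + var y" "m = var u + m1"
      by (rule var_add_eq_cancel) (use 3 in auto)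
    obtain m2 where m2: "k = m2 + var y" "m1 = var w + m2"
      using var_add_eq_cancel[OF m1(1)[symmetric] 3(2)[symmetric]] .
    from edge_powI[OF k(2) Suc.IH[of m2]] show ?thesis using k(3) by (simp add: m2 m1(2) add_ac)
  qed
qed simp

text \<open>An edge \<open>xy\<close> all of whose neighbours \<open>b\<close> of \<open>x\<close> and \<open>c\<close> of \<open>y\<close> are adjacent behaves like a leaf
  edge: two factors \<open>xb\<close> and \<open>yc\<close> can be traded for \<open>xy\<close> and \<open>bc\<close>.\<close>

lemma edge_pow_colon_edge:
  assumes sym: "\<And>u v. A u v \<Longrightarrow> A v u" and xy: "A x y" "x \<noteq> y"
    and bis: "\<And>b c. A x b \<Longrightarrow> A y c \<Longrightarrow> A b c"
  shows "m + (var x + var y) \<in> edge_pow A (Suc s) \<longleftrightarrow> m \<in> edge_pow A s"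
proof
  assume "m \<in> edge_pow A s"
  from edge_powI[OF xy(1) this] show "m + (var x + var y) \<in> edge_pow A (Suc s)" by (simp add: add_ac)
next
  \<comment> \<open>The edge peeled off uses \<open>x'\<close> but not \<open>y'\<close>. Then
    \<open>y'\<close> divides \<open>k\<close>, where it may be replaced by \<open>v\<close>,
    because all neighbours of \<open>y'\<close> are adjacent to the neighbour \<open>v\<close> of
    \<open>x'\<close>.\<close>
  have one: "m \<in> edge_pow A s"
    if "m + (var x' + var y') = var u + var v + k" "A u v" "k \<in> edge_pow A s" "u = x'" "v \<noteq> y'"
      "\<And>b c. A x' b \<Longrightarrow> A y' c \<Longrightarrow> A b c" for x' y' u v k m s
  proof -
    have "(m + var y') + var x' = (var v + k) + var x'" using that(1,4) by (simp add: add_ac)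
    then have "m + var y' = var v + k" by (rule add_right_imp_eq)
    then obtain k' where k': "k = k' + var y'" "m = var v + k'"
      by (rule var_add_eq_cancel) (use \<open>v \<noteq> y'\<close> in auto)
    have "k' + var v \<in> edge_pow A s"
      using that(3) unfolding k'(1) by (rule edge_pow_subst[rotated 2]) (use sym that in blast)+
    then show ?thesis by (simp add: k'(2) add.commute)
  qed
  have bis': "A b c" if "A y b" "A x c" for b c using bis[OF that(2,1)] sym by blast
  show "m + (var x + var y) \<in> edge_pow A (Suc s) \<Longrightarrow> m \<in> edge_pow A s"
  proof (induction s arbitrary: m)
    case (Suc s)
    then obtain u v k where k: "m + (var x + var y) = var u + var v + k" "A u v" "k \<in> edge_pow A (Suc s)"
      by (auto elim: edge_powE)
    have k': "m + (var x + var y) = var v + var u + k" "m + (var y + var x) = var u + var v + k"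
      "m + (var y + var x) = var v + var u + k"
      using k(1) by (simp_all add: add_ac)
    consider "u = x" "v = y" | "u = y" "v = x" | "u = x" "v \<noteq> y" | "v = x" "u \<noteq> y"
      | "u = y" "v \<noteq> x" | "v = y" "u \<noteq> x" | "u \<noteq> x" "u \<noteq> y" "v \<noteq> x" "v \<noteq> y" by blast
    then show ?case
    proof cases
      case 1
      then have "m + (var x + var y) = k + (var x + var y)" using k(1) by (simp add: add_ac)
      then have "m = k" by (rule add_right_imp_eq)
      then show ?thesis using k(3) by simp
    next
      case 2
      then have "m + (var x + var y) = k + (var x + var y)" using k(1) by (simp add: add_ac)
      then have "m = k" by (rule add_right_imp_eq)
      then show ?thesis using k(3) by simp
    next
      case 3
      show ?thesis by (rule one[OF k(1,2,3) 3 bis])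
    next
      case 4
      show ?thesis by (rule one[OF k'(1) sym[OF k(2)] k(3) 4 bis])
    next
      case 5
      show ?thesis by (rule one[OF k'(2) k(2,3) 5 bis'])
    next
      case 6
      show ?thesis by (rule one[OF k'(3) sym[OF k(2)] k(3) 6 bis'])
    next
      case 7
      \<comment> \<open>The edge avoids both \<open>x\<close> and \<open>y\<close>, so both divide
        the remaining factor and the induction hypothesis applies to it.\<close>
      have "(m + var x) + var y = var u + (var v + k)" using k(1) by (simp add: add_ac)
      then obtain k1 where k1: "var v + k = k1 + var y" "m + var x = var u + k1"
        by (rule var_add_eq_cancel) (use 7 in auto)
      obtain k2 where k2: "k = k2 + var y" "k1 = var v + k2"
        using var_add_eq_cancel[OF k1(1)[symmetric]] 7 by metis
      obtain k3 where k3: "k1 = k3 + var x" "m = var u + k3"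
        using var_add_eq_cancel[OF k1(2)] 7 by metis
      have "k3 + var x = var v + k2" using k2(2) k3(1) by simp
      then obtain k4 where k4: "k2 = k4 + var x" "k3 = var v + k4"
        using var_add_eq_cancel[of k3 x v k2] 7 by metis
      have "k4 + (var x + var y) \<in> edge_pow A (Suc s)" using k(3) k2(1) k4(1) by (simp add: add_ac)
      from edge_powI[OF k(2) Suc.IH[OF this]] show ?thesis by (simp add: k3(2) k4(2) add_ac)
    qed
  qed simp
qed

text \<open>The exponents of \<open>I(G)\<^sup>s + (W)\<close>; modulo \<open>W\<close> this is the power for the induced subgraph without \<open>W\<close>.\<close>

definition killed_pow :: "('v \<Rightarrow> 'v \<Rightarrow> bool) \<Rightarrow> 'v set \<Rightarrow> nat \<Rightarrow> 'v monomial set" where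
  "killed_pow A W s = {m. keys m \<inter> W \<noteq> {}} \<union> edge_pow (restr A W) s"

lemma upset_killed_pow: "upset (killed_pow A W s)"
  using upset_edge_pow[of "restr A W" s] by (auto simp: killed_pow_def upset_def keys_add_nat)

lemma killed_pow_iff: "m \<in> killed_pow A W s \<longleftrightarrow> keys m \<inter> W \<noteq> {} \<or> m \<in> edge_pow A s"
  using edge_pow_restr[of m W A s] by (auto simp: killed_pow_def)

lemma killed_pow_restr_iff: "m \<in> killed_pow A W s \<longleftrightarrow> keys m \<inter> W \<noteq> {} \<or> m \<in> edge_pow (restr A W) s"
  by (auto simp: killed_pow_def)

lemma up_closure_var: "up_closure {var v} = {m. v \<in> keys m}"
proof (intro equalityI subsetI)
  fix m :: "'a \<Rightarrow>\<^sub>0 nat" assume "m \<in> {m. v \<in> keys m}"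
  then have "m = (m - var v) + var v" using var_add_minus[of v m] by simp
  then show "m \<in> up_closure {var v}" unfolding up_closure_def by blast
qed (auto simp: up_closure_def keys_add_nat)

lemma killed_pow_insert: "killed_pow A W s \<union> up_closure {var v} = killed_pow A (insert v W) s"
  by (auto simp: killed_pow_iff up_closure_var)

section \<open>Reduction rules on induced subgraphs\<close>

context
  fixes K :: "'k::field itself" and vs :: "'v list" and A :: "'v \<Rightarrow> 'v \<Rightarrow> bool"
  assumes symp: "symp A" and irrefl: "\<And>v. \<not> A v v"
begin

lemmas A_sym = sympD[OF symp]

lemma vanish_power_0: "vanish K vs (killed_pow A W 0) t"
proof -
  have "killed_pow A W 0 = UNIV" by (simp add: killed_pow_def)
  then show ?thesis by (simp add: vanish_UNIV)
qed

text \<open>\<open>W\<close> holds the deleted vertices, so \<open>v\<close> is isolated in what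
  remains; as a free variable it is worth one degree.\<close>

lemma vanish_isolated:
  assumes "v \<in> set vs" "v \<notin> W" "\<And>w. A v w \<Longrightarrow> w \<in> W" "vanish K vs (killed_pow A (insert v W) s) (t - 1)"
  shows "vanish K vs (killed_pow A W s) t"
proof -
  have "g \<in> killed_pow A W s" if "g + var v \<in> killed_pow A W s" for g
  proof -
    have "g + var v \<in> edge_pow (restr A W) s \<longleftrightarrow> g \<in> edge_pow (restr A W) s"
        by (rule edge_pow_isolated; use assms(3) A_sym in \<open>unfold restr_def; blast\<close>)
    then show ?thesis using that assms(2) by (auto simp: killed_pow_def keys_add_nat)
  qed
  from vanish_free[OF upset_killed_pow assms(1) this, of K "t - 1"]
  show ?thesis using assms(4) by (simp add: killed_pow_insert)
qed

text \<open>Colons by \<open>x y\<close> and then by \<open>y\<close>. The first lowers the power.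
  Once \<open>x y\<close> is added, the second brings \<open>x\<close> into the ideal; hypothesis
  \<open>2\<close> is about the induced subgraph without \<open>x\<close>, where \<open>y\<close>
  may still have neighbours.\<close>

lemma vanish_edge:
  assumes V: "x \<in> set vs" "y \<in> set vs" and W: "x \<notin> W" "y \<notin> W" and xy: "A x y"
    and bis: "\<And>b c. b \<notin> W \<Longrightarrow> c \<notin> W \<Longrightarrow> A x b \<Longrightarrow> A y c \<Longrightarrow> A b c"
    and 1: "vanish K vs (killed_pow A W s) t"
    and 2: "vanish K vs {g. keys g \<inter> insert x W \<noteq> {} \<or> g + var y \<in> edge_pow (restr A (insert x W)) (Suc s)} t"
    and 3: "vanish K vs (killed_pow A (insert y W) (Suc s)) t"
  shows "vanish K vs (killed_pow A W (Suc s)) t"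
proof -
  have ne: "x \<noteq> y" using xy irrefl by blast
  let ?U = "killed_pow A W (Suc s)" and ?f = "var x + var y"
  let ?U1 = "?U \<union> up_closure {?f}"
  have "m + ?f \<in> edge_pow (restr A W) (Suc s) \<longleftrightarrow> m \<in> edge_pow (restr A W) s" for m
  proof (rule edge_pow_colon_edge)
    show "restr A W v u" if "restr A W u v" for u v using that A_sym unfolding restr_def by blast
    show "restr A W x y" using xy W unfolding restr_def by blast
    show "restr A W b c" if "restr A W x b" "restr A W y c" for b c
      using that bis[of b c] unfolding restr_def by blast
  qed (rule ne)
  then have "{g. g + ?f \<in> ?U} = killed_pow A W s"
    using W by (auto simp: killed_pow_restr_iff keys_add_nat)
  then have c1: "vanish K vs {g. g + ?f \<in> ?U} t" using 1 by simp
  have U1: "upset ?U1" using upset_killed_pow[of A W "Suc s"] upset_up_closure[of "{?f}"]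
    by (auto simp: upset_def)
  have f_iff: "g + var y \<in> up_closure {?f} \<longleftrightarrow> x \<in> keys g" for g
  proof
    assume "g + var y \<in> up_closure {?f}"
    then obtain r where "g + var y = r + ?f" by (auto simp: up_closure_def)
    then have "g = r + var x" by (simp add: add.assoc[symmetric])
    then show "x \<in> keys g" by (simp add: keys_add_nat)
  next
    assume "x \<in> keys g"
    then have "g + var y = (g - var x) + ?f" using var_add_minus[of x g] by (simp add: add.assoc[symmetric])
    then show "g + var y \<in> up_closure {?f}" unfolding up_closure_def by blast
  qed
  have "{g. g + var y \<in> ?U1} = {g. keys g \<inter> insert x W \<noteq> {} \<or> g + var y \<in> edge_pow (restr A (insert x W)) (Suc s)}"
  proof (rule Set.set_eqI)
    fix g
    have "g + var y \<in> edge_pow (restr A (insert x W)) (Suc s) \<longleftrightarrow> g + var y \<in> edge_pow A (Suc s)"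
      if "keys g \<inter> insert x W = {}"
      by (rule edge_pow_restr) (use that W ne in \<open>auto simp: keys_add_nat\<close>)
    then show "g \<in> {g. g + var y \<in> ?U1} \<longleftrightarrow>
        g \<in> {g. keys g \<inter> insert x W \<noteq> {} \<or> g + var y \<in> edge_pow (restr A (insert x W)) (Suc s)}"
      using f_iff[of g] W by (auto simp: killed_pow_iff keys_add_nat)
  qed
  then have c2: "vanish K vs {g. g + var y \<in> ?U1} t" using 2 by simp
  have "?U1 \<union> up_closure {var y} = killed_pow A (insert y W) (Suc s)"
    unfolding killed_pow_insert[symmetric]
    by (auto simp: up_closure_var) (auto simp: up_closure_def keys_add_nat)
  then have c3: "vanish K vs (?U1 \<union> up_closure {var y}) t" using 3 by simp
  have "vanish K vs ?U1 t"
    by (rule vanish_colon[OF U1 _ c2 c3]) (use V in simp)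
  show ?thesis
    by (rule vanish_colon[OF upset_killed_pow _ c1 \<open>vanish K vs ?U1 t\<close>]) (use V in \<open>simp add: keys_add_nat\<close>)
qed

text \<open>Without \<open>x\<close> the leaf \<open>y\<close> is isolated, so the colon by
  \<open>y\<close> merely deletes \<open>x\<close>.\<close>

lemma vanish_leaf:
  assumes V: "x \<in> set vs" "y \<in> set vs" and W: "x \<notin> W" "y \<notin> W" and xy: "A x y"
    and bis: "\<And>b c. b \<notin> W \<Longrightarrow> c \<notin> W \<Longrightarrow> A x b \<Longrightarrow> A y c \<Longrightarrow> A b c"
    and leaf: "\<And>c. c \<notin> W \<Longrightarrow> A y c \<Longrightarrow> c = x"
    and 1: "vanish K vs (killed_pow A W s) t"
    and 2: "vanish K vs (killed_pow A (insert x W) (Suc s)) t"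
    and 3: "vanish K vs (killed_pow A (insert y W) (Suc s)) t"
  shows "vanish K vs (killed_pow A W (Suc s)) t"
proof (rule vanish_edge[OF V W xy bis 1 _ 3])
  have "g + var y \<in> edge_pow (restr A (insert x W)) (Suc s) \<longleftrightarrow> g \<in> edge_pow (restr A (insert x W)) (Suc s)" for g
    by (rule edge_pow_isolated; use leaf A_sym in \<open>unfold restr_def; blast\<close>)
  then have "{g. keys g \<inter> insert x W \<noteq> {} \<or> g + var y \<in> edge_pow (restr A (insert x W)) (Suc s)}
     = killed_pow A (insert x W) (Suc s)"
    by (auto simp: killed_pow_def)
  then show "vanish K vs {g. keys g \<inter> insert x W \<noteq> {} \<or> g + var y \<in> edge_pow (restr A (insert x W)) (Suc s)} t"
    using 2 by simp
qed

text \<open>Once \<open>x\<close> is deleted, \<open>y\<close> is a leaf at \<open>a\<close>. A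
  further colon by \<open>a\<close> completes the factor \<open>a y\<close> and lowers the power,
  whereas adding \<open>a\<close> leaves \<open>y\<close> isolated.\<close>

lemma vanish_path:
  assumes V: "x \<in> set vs" "y \<in> set vs" "a \<in> set vs" and W: "x \<notin> W" "y \<notin> W" "a \<notin> W" and xy: "A x y" "A a y"
    and bis: "\<And>b c. b \<notin> W \<Longrightarrow> c \<notin> W \<Longrightarrow> A x b \<Longrightarrow> A y c \<Longrightarrow> A b c"
    and path: "\<And>c. c \<notin> W \<Longrightarrow> A y c \<Longrightarrow> c = x \<or> c = a" and xa: "x \<noteq> a"
    and 1: "vanish K vs (killed_pow A W s) t"
    and 2: "vanish K vs (killed_pow A (insert x W) s) t"
    and 3: "vanish K vs (killed_pow A (insert a (insert x W)) (Suc s)) t"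
    and 4: "vanish K vs (killed_pow A (insert y W) (Suc s)) t"
  shows "vanish K vs (killed_pow A W (Suc s)) t"
proof (rule vanish_edge[OF V(1,2) W(1,2) xy(1) bis 1 _ 4])
  let ?W = "insert x W"
  let ?B = "restr A ?W"
  let ?U = "{g. keys g \<inter> ?W \<noteq> {} \<or> g + var y \<in> edge_pow ?B (Suc s)}"
  have ne: "x \<noteq> y" "a \<noteq> y" using xy irrefl by auto
  have "m + (var a + var y) \<in> edge_pow ?B (Suc s) \<longleftrightarrow> m \<in> edge_pow ?B s" for m
  proof (rule edge_pow_colon_edge)
    show "?B b c" if "?B a b" "?B y c" for b c
    proof -
      have "c = a" using that path unfolding restr_def by blast
      then show ?thesis using that A_sym unfolding restr_def by blast
    qed
    show "?B v u" if "?B u v" for u v using that A_sym unfolding restr_def by blast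
    show "?B a y" using xy W ne xa unfolding restr_def by blast
  qed (rule ne)
  then have "{g. g + var a \<in> ?U} = killed_pow A ?W s"
    using W xa by (auto simp: killed_pow_restr_iff keys_add_nat add.assoc)
  then have c1: "vanish K vs {g. g + var a \<in> ?U} t" using 2 by simp
  have U: "upset ?U"
    unfolding upset_def
  proof (intro ballI allI)
    fix m r assume "m \<in> ?U"
    then show "r + m \<in> ?U"
      using edge_pow_upward(1)[of "m + var y" ?B "Suc s" r] by (auto simp: keys_add_nat add.assoc)
  qed
  have "?U \<union> up_closure {var a} = killed_pow A (insert a ?W) (Suc s)"
  proof (rule Set.set_eqI)
    fix g
    let ?C = "restr A (insert a ?W)"
    have "g + var y \<in> edge_pow ?B (Suc s) \<longleftrightarrow> g \<in> edge_pow ?C (Suc s)" if g: "keys g \<inter> insert a ?W = {}"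
    proof -
      have "g + var y \<in> edge_pow ?B (Suc s) \<longleftrightarrow> g + var y \<in> edge_pow A (Suc s)"
        by (rule edge_pow_restr) (use g W ne in \<open>auto simp: keys_add_nat\<close>)
      also have "\<dots> \<longleftrightarrow> g + var y \<in> edge_pow ?C (Suc s)"
        by (rule edge_pow_restr[symmetric]) (use g W ne in \<open>auto simp: keys_add_nat\<close>)
      also have "\<dots> \<longleftrightarrow> g \<in> edge_pow ?C (Suc s)"
        by (rule edge_pow_isolated; use path A_sym in \<open>unfold restr_def; blast\<close>)
      finally show ?thesis .
    qed
    then show "g \<in> ?U \<union> up_closure {var a} \<longleftrightarrow> g \<in> killed_pow A (insert a ?W) (Suc s)"
      by (auto simp: killed_pow_restr_iff up_closure_var)
  qed
  then have c2: "vanish K vs (?U \<union> up_closure {var a}) t" using 3 by simp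
  show "vanish K vs ?U t"
    by (rule vanish_colon[OF U _ c1 c2]) (use V in simp)
qed

end

section \<open>The graphs\<close>

definition adj :: "nat \<Rightarrow> nat \<Rightarrow> vertex \<Rightarrow> vertex \<Rightarrow> bool" where
  "adj d j u v \<longleftrightarrow> {u, v} \<in> G_edges d j"

lemma adj_simps:
  assumes "1 \<le> j" "j \<le> d"
  shows "adj d j (Xv i) (Yv k) \<longleftrightarrow> i \<in> {1..d} \<and> k \<in> {1..d} \<and> (i = k \<or> i = 1 \<or> k = j \<and> i \<le> j)"
    "adj d j (Yv k) (Xv i) \<longleftrightarrow> i \<in> {1..d} \<and> k \<in> {1..d} \<and> (i = k \<or> i = 1 \<or> k = j \<and> i \<le> j)"
    "\<not> adj d j (Xv i) (Xv k)" "\<not> adj d j (Yv i) (Yv k)"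
  using assms by (auto simp: adj_def G_edges_def doubleton_eq_iff)

lemma adj_sym: "adj d j u v \<Longrightarrow> adj d j v u"
  by (simp add: adj_def insert_commute)

lemma adj_irrefl: "\<not> adj d j v v"
  by (auto simp: adj_def G_edges_def doubleton_eq_iff)

lemma symp_adj: "symp (adj d j)"
  by (rule sympI) (rule adj_sym)

section \<open>Lower bounds for the graphs\<close>

context
  fixes d j :: nat and K :: "'k::field itself" and vs :: "vertex list"
  assumes j: "1 \<le> j" "j \<le> d" and vs: "set vs = G_verts d"
begin

lemmas [simp] = adj_simps[OF j]

lemma X_in_vs [simp]: "Xv i \<in> set vs \<longleftrightarrow> i \<in> {1..d}" and Y_in_vs [simp]: "Yv i \<in> set vs \<longleftrightarrow> i \<in> {1..d}"
  by (auto simp: vs G_verts_def)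

abbreviation "vanish_G W s t \<equiv> vanish K vs (killed_pow (adj d j) W s) t"

lemmas iso_rule = vanish_isolated[where A = "adj d j" and K = K and vs = vs, OF symp_adj adj_irrefl]
lemmas leaf_rule = vanish_leaf[where A = "adj d j" and K = K and vs = vs, OF symp_adj adj_irrefl]
lemmas path_rule = vanish_path[where A = "adj d j" and K = K and vs = vs, OF symp_adj adj_irrefl]
lemmas power_0_rule = vanish_power_0[where A = "adj d j" and K = K and vs = vs, OF symp_adj adj_irrefl]

text \<open>A nonempty induced subgraph has an isolated vertex, a leaf, or a path to which a rule
  applies, and the deletions made by the rules always leave a vertex over. The induction is on the
  number of remaining vertices, and for the smaller power on \<open>s\<close>.\<close>

lemma vanish_one: "v \<in> set vs \<Longrightarrow> v \<notin> W \<Longrightarrow> vanish_G W s 1"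
proof (induction "card (set vs - W)" arbitrary: W v s rule: less_induct)
  case less
  have IH: "vanish_G W' s' 1" if "x \<in> set vs" "x \<notin> W" "insert x W \<subseteq> W'" "z \<in> set vs" "z \<notin> W'" for W' s' x z
  proof -
    have "set vs - W' \<subset> set vs - W" using that by blast
    then have "card (set vs - W') < card (set vs - W)" by (intro psubset_card_mono) auto
    then show ?thesis using less.hyps that by blast
  qed
  show ?case
  \<comment> \<open>An isolated vertex yields the bound 1 at once, since the bound 0 is
    trivial.\<close>
  proof (cases "\<exists>v\<in>set vs - W. \<forall>w. adj d j v w \<longrightarrow> w \<in> W")
    case True
    then show ?thesis using iso_rule[of _ W s 1] vanish_nonpos[of 0] by auto
  next
    case False
    then have nbr: "\<exists>w. w \<notin> W \<and> adj d j v w" if "v \<in> set vs" "v \<notin> W" for v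
      using that by blast
    show ?thesis
    proof (induction s)
      case 0
      show ?case by (rule power_0_rule)
    next
      case (Suc s)
      \<comment> \<open>A remaining \<open>y_k\<close> with \<open>k \<noteq> j\<close> is a leaf or
        the middle of a path. If none is left, each remaining \<open>x_k\<close> is a leaf at
        \<open>y_j\<close>; and \<open>y_j\<close> alone would be isolated.\<close>
      consider (Y) k where "k \<in> {1..d}" "k \<noteq> j" "Yv k \<notin> W"
        | (X) k where "k \<in> {1..d}" "Xv k \<notin> W" "\<And>i. i \<in> {1..d} \<Longrightarrow> i \<noteq> j \<Longrightarrow> Yv i \<in> W"
        | (j) "\<And>k. k \<in> {1..d} \<Longrightarrow> Xv k \<in> W" "Yv j \<notin> W"
        using less.prems by (metis Y_in_vs X_in_vs vertex.exhaust)
      then show ?case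
      proof cases
        case (Y k)
        show ?thesis
        proof (cases "k \<noteq> 1 \<and> Xv k \<notin> W")
          case True
          have bis: "adj d j b c" if "b \<notin> W" "c \<notin> W" "adj d j (Xv k) b" "adj d j (Yv k) c" for b c
            using that True Y j by (cases b; cases c) auto
          show ?thesis
          proof (cases "Xv 1 \<in> W")
            case True': True
            show ?thesis
            proof (rule leaf_rule[of "Xv k" "Yv k", OF _ _ _ _ _ bis _ Suc])
              show "c = Xv k" if "c \<notin> W" "adj d j (Yv k) c" for c
                using that True' Y by (cases c) auto
              show "vanish_G (insert (Xv k) W) (Suc s) 1"
                by (rule IH[of "Xv k" _ "Yv k"]) (use Y True in auto)
              show "vanish_G (insert (Yv k) W) (Suc s) 1"
                by (rule IH[of "Yv k" _ "Xv k"]) (use Y True in auto)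
            qed (use Y True in auto)
          next
            case False': False
            show ?thesis
            proof (rule path_rule[of "Xv k" "Yv k" "Xv 1", OF _ _ _ _ _ _ _ _ bis _ _ Suc])
              show "c = Xv k \<or> c = Xv 1" if "c \<notin> W" "adj d j (Yv k) c" for c
                using that Y by (cases c) auto
              show "vanish_G (insert (Xv k) W) s 1"
                by (rule IH[of "Xv k" _ "Yv k"]) (use Y True in auto)
              show "vanish_G (insert (Xv 1) (insert (Xv k) W)) (Suc s) 1"
                by (rule IH[of "Xv k" _ "Yv k"]) (use Y True in auto)
              show "vanish_G (insert (Yv k) W) (Suc s) 1"
                by (rule IH[of "Yv k" _ "Xv k"]) (use Y True in auto)
            qed (use Y True False' in auto)
          qed
        next
          case False
          have leaf: "c = Xv 1" if "c \<notin> W" "adj d j (Yv k) c" for c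
            using that False Y by (cases c) auto
          obtain w where w: "w \<notin> W" "adj d j (Yv k) w" using nbr[of "Yv k"] Y by auto
          then have X1: "Xv 1 \<notin> W" "adj d j (Yv k) (Xv 1)" using leaf by auto
          show ?thesis
          proof (rule leaf_rule[of "Xv 1" "Yv k", OF _ _ _ _ _ _ leaf Suc])
            show "adj d j b c" if "b \<notin> W" "c \<notin> W" "adj d j (Xv 1) b" "adj d j (Yv k) c" for b c
              using leaf[OF that(2,4)] that(3) adj_sym by blast
            show "vanish_G (insert (Xv 1) W) (Suc s) 1"
              by (rule IH[of "Xv 1" _ "Yv k"]) (use Y X1 in auto)
            show "vanish_G (insert (Yv k) W) (Suc s) 1"
              by (rule IH[of "Yv k" _ "Xv 1"]) (use Y X1 in auto)
          qed (use Y X1 in auto)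
        qed
      next
        case (X k)
        have leaf: "c = Yv j" if "c \<notin> W" "adj d j (Xv k) c" for c
          using that X by (cases c) auto
        obtain w where w: "w \<notin> W" "adj d j (Xv k) w" using nbr[of "Xv k"] X by auto
        then have Yj: "Yv j \<notin> W" "adj d j (Xv k) (Yv j)" using leaf by auto
        show ?thesis
        proof (rule leaf_rule[of "Yv j" "Xv k", OF _ _ _ _ _ _ leaf Suc])
          show "adj d j b c" if "b \<notin> W" "c \<notin> W" "adj d j (Yv j) b" "adj d j (Xv k) c" for b c
            using leaf[OF that(2,4)] that(3) adj_sym by blast
          show "vanish_G (insert (Yv j) W) (Suc s) 1"
            by (rule IH[of "Yv j" _ "Xv k"]) (use X Yj j in auto)
          show "vanish_G (insert (Xv k) W) (Suc s) 1"
            by (rule IH[of "Xv k" _ "Yv j"]) (use X Yj j in auto)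
        qed (use X Yj j in auto)
      next
        case j': j
        obtain w where w: "w \<notin> W" "adj d j (Yv j) w" using nbr[of "Yv j"] j' j by auto
        then have False using j' by (cases w) auto
        then show ?thesis ..
      qed
    qed
  qed
qed

text \<open>Without \<open>x_1\<close> each pair \<open>x_i\<close>, \<open>y_i\<close> with
  \<open>i > j\<close> is a separate edge. Whichever endpoint is deleted, the other becomes
  isolated, so every pair is worth one degree; the further vertex \<open>v\<close> provides the
  \<open>+ 1\<close>.\<close>

lemma vanish_matching:
  assumes "finite I" "I \<subseteq> {j<..d}" "Xv 1 \<in> W" "\<And>i. i \<in> I \<Longrightarrow> Xv i \<notin> W \<and> Yv i \<notin> W"
    and "v \<in> set vs" "v \<notin> W" "v \<notin> Xv ` I \<union> Yv ` I"
  shows "vanish_G W s (int (card I) + 1)"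
  using assms
proof (induction I arbitrary: W s rule: finite_induct)
  case empty
  then show ?case using vanish_one[of v W s] by simp
next
  case (insert i I)
  have i: "i \<in> {1..d}" "j < i" "i \<noteq> 1" "Xv i \<notin> W" "Yv i \<notin> W" "i \<notin> I"
    using insert.prems insert.hyps j by auto
  have X1: "Xv 1 \<in> W" by fact
  show ?case
  proof (induction s)
    case 0
    show ?case by (rule power_0_rule)
  next
    case (Suc s)
    have rest: "vanish_G (insert (Xv i) (insert (Yv i) W)) (Suc s) (int (card (insert i I)) + 1 - 1)"
    proof -
      have "vanish_G (insert (Xv i) (insert (Yv i) W)) (Suc s) (int (card I) + 1)"
        by (rule insert.IH) (use insert.prems insert.hyps in auto)
      then show ?thesis using insert.hyps by (simp add: add.commute)
    qed
    show ?case
    proof (rule leaf_rule[of "Yv i" "Xv i", OF _ _ _ _ _ _ _ Suc])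
      show leaf: "c = Yv i" if "c \<notin> W" "adj d j (Xv i) c" for c
        using that i by (cases c) auto
      show "adj d j b c" if "b \<notin> W" "c \<notin> W" "adj d j (Yv i) b" "adj d j (Xv i) c" for b c
        using leaf[OF that(2,4)] that(3) adj_sym by blast
      show "vanish_G (insert (Yv i) W) (Suc s) (int (card (insert i I)) + 1)"
      proof (rule iso_rule[of "Xv i", OF _ _ _ rest])
        show "w \<in> insert (Yv i) W" if "adj d j (Xv i) w" for w
          using that i by (cases w) auto
      qed (use i in auto)
      show "vanish_G (insert (Xv i) W) (Suc s) (int (card (insert i I)) + 1)"
      proof (rule iso_rule[of "Yv i"])
        show "w \<in> insert (Xv i) W" if "adj d j (Yv i) w" for w
          using that i X1 by (cases w) auto
        show "vanish_G (insert (Yv i) (insert (Xv i) W)) (Suc s) (int (card (insert i I)) + 1 - 1)"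
          using rest by (simp only: insert_commute)
      qed (use i in auto)
    qed (use i in auto)
  qed
qed

text \<open>Induction on the paths, and inside on \<open>s\<close>, with
  \<open>t + s - card I\<close> kept bounded: the colon by \<open>x_i y_i\<close> lowers
  \<open>s\<close>, the colon by \<open>x_1\<close> lowers \<open>s\<close> while it uses up the
  path, deleting \<open>y_i\<close> frees \<open>x_i\<close>, and deleting \<open>x_1\<close> and
  \<open>x_i\<close> leaves a matching with two free variables.\<close>

lemma vanish_paths:
  assumes "2 \<le> j" "finite I" "I \<subseteq> {j<..d}" "Xv 1 \<notin> W" "Yv 1 \<notin> W" "Xv j \<notin> W" "Yv j \<notin> W"
    "\<And>i. i \<in> I \<Longrightarrow> Xv i \<notin> W \<and> Yv i \<notin> W" "t + int s \<le> int (card I) + 3"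
  shows "vanish_G W s t"
  using assms(2-)
proof (induction I arbitrary: W s t rule: finite_induct)
  case empty
  \<comment> \<open>Without paths the bound is \<open>3 - s\<close>: trivial for
    \<open>s = 0\<close>, at most 1 for \<open>s \<ge> 2\<close>, and 2 for the edge ideal
    itself.\<close>
  consider "s = 0" | "s = 1" | "2 \<le> s" by linarith
  then show ?case
  proof cases
    case 1
    then show ?thesis using power_0_rule by simp
  next
    case 3
    have "vanish_G W s 1" by (rule vanish_one[of "Xv 1"]) (use empty j in auto)
    then show ?thesis by (rule vanish_mono) (use empty 3 in simp)
  next
    case s: 2
    have s': "s = Suc 0" using s by simp
    let ?U = "killed_pow (adj d j) W s" and ?Y = "Yv ` {1..d}"
    \<comment> \<open>The colon by \<open>x_1\<close> contains all \<open>y_i\<close>; modulo these,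
      \<open>x_1\<close> and \<open>x_j\<close> are free, and they are distinct because
      \<open>j \<ge> 2\<close>.\<close>
    have "vanish_G (W \<union> ?Y) s 2"
    proof -
      have a: "vanish_G (insert (Xv j) (insert (Xv 1) (W \<union> ?Y))) s (2 - 1 - 1)"
        by (rule vanish_nonpos) simp
      have "vanish_G (insert (Xv 1) (W \<union> ?Y)) s (2 - 1)"
      proof (rule iso_rule[of "Xv j"])
        show "w \<in> insert (Xv 1) (W \<union> ?Y)" if "adj d j (Xv j) w" for w using that by (cases w) auto
      qed (use a empty assms(1) j in auto)
      then show ?thesis
      proof (rule iso_rule[of "Xv 1", rotated -1])
        show "w \<in> W \<union> ?Y" if "adj d j (Xv 1) w" for w using that by (cases w) auto
      qed (use empty j in auto)
    qed
    moreover have "m \<in> {g. g + var (Xv 1) \<in> ?U} \<longleftrightarrow> m \<in> killed_pow (adj d j) (W \<union> ?Y) s"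
      if "keys m \<subseteq> set vs" for m
    proof (cases "keys m \<inter> ?Y = {}")
      case True
      have "m + var (Xv 1) \<notin> edge_pow (adj d j) s"
      proof
        assume "m + var (Xv 1) \<in> edge_pow (adj d j) s"
        then obtain u v k where k: "m + var (Xv 1) = var u + var v + k" "adj d j u v"
          unfolding s' by (rule edge_powE)
        then obtain i where "i \<in> {1..d}" "u = Yv i \<or> v = Yv i" by (cases u; cases v) auto
        then have "Yv i \<in> keys (m + var (Xv 1))" unfolding k(1) by (auto simp: keys_add_nat)
        then show False using True \<open>i \<in> {1..d}\<close> by (auto simp: keys_add_nat)
      qed
      moreover from this have "m \<notin> edge_pow (adj d j) s" using edge_pow_upward(2) by blast
      ultimately show ?thesis
        using True empty by (auto simp: killed_pow_iff keys_add_nat)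
    next
      case False
      then obtain i where i: "i \<in> {1..d}" "Yv i \<in> keys m" by blast
      have "adj d j (Xv 1) (Yv i)" using i j by auto
      then have "var (Xv 1) + var (Yv i) + (m - var (Yv i)) \<in> edge_pow (adj d j) s"
        unfolding s' by (intro edge_powI) simp_all
      moreover have "var (Xv 1) + var (Yv i) + (m - var (Yv i)) = m + var (Xv 1)"
        using var_add_minus[OF i(2)] by (simp add: add_ac)
      ultimately show ?thesis using i by (auto simp: killed_pow_iff)
    qed
    ultimately have colon: "vanish K vs {g. g + var (Xv 1) \<in> ?U} 2"
      using vanish_cong[of vs "{g. g + var (Xv 1) \<in> ?U}" "killed_pow (adj d j) (W \<union> ?Y) s"] by blast
    \<comment> \<open>Without \<open>x_1\<close> the vertex \<open>y_1\<close> is isolated, and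
      \<open>y_j\<close> is a different vertex that remains.\<close>
    have b: "vanish_G (insert (Yv 1) (insert (Xv 1) W)) s (2 - 1)"
      using vanish_one[of "Yv j" "insert (Yv 1) (insert (Xv 1) W)" s] empty assms(1) j by auto
    have "vanish_G (insert (Xv 1) W) s 2"
    proof (rule iso_rule[of "Yv 1"])
      show "w \<in> insert (Xv 1) W" if "adj d j (Yv 1) w" for w
        using that assms(1) by (cases w) auto
    qed (use b empty j in auto)
    then have "vanish K vs (?U \<union> up_closure {var (Xv 1)}) 2"
      by (simp only: killed_pow_insert)
    then have "vanish_G W s 2"
      by (rule vanish_colon[OF upset_killed_pow _ colon, rotated]) (use j in auto)
    then show ?thesis by (rule vanish_mono) (use empty s in simp)
  qed
next
  case (insert i I)
  have i: "i \<in> {1..d}" "j < i" "i \<noteq> 1" "Xv i \<notin> W" "Yv i \<notin> W" "i \<notin> I"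
    using insert.prems insert.hyps j by auto
  have card: "card (insert i I) = Suc (card I)" using insert.hyps by simp
  show ?case
    using insert.prems(7)
  proof (induction s arbitrary: t)
    case 0
    show ?case by (rule power_0_rule)
  next
    case (Suc s)
    have leafX: "c = Yv i" if "adj d j (Xv i) c" for c
      using that i by (cases c) auto
    show ?case
    proof (rule path_rule[of "Xv i" "Yv i" "Xv 1"])
      show "adj d j b c" if "b \<notin> W" "c \<notin> W" "adj d j (Xv i) b" "adj d j (Yv i) c" for b c
        using leafX[OF that(3)] that(4) by blast
      show "c = Xv i \<or> c = Xv 1" if "c \<notin> W" "adj d j (Yv i) c" for c
        using that i by (cases c) auto
      show "vanish_G W s t" by (rule Suc.IH) (use Suc.prems in simp)
      show "vanish_G (insert (Xv i) W) s t"
        by (rule insert.IH) (use insert.prems(1-6) insert.hyps i Suc.prems card in auto)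
      \<comment> \<open>With \<open>x_1\<close> and \<open>x_i\<close> deleted, \<open>y_1\<close>
        and \<open>y_i\<close> are isolated. They contribute two degrees, the matching on
        \<open>I\<close> together with \<open>y_j\<close> the rest.\<close>
      show "vanish_G (insert (Xv 1) (insert (Xv i) W)) (Suc s) t"
      proof (rule iso_rule[of "Yv 1"])
        show "w \<in> insert (Xv 1) (insert (Xv i) W)" if "adj d j (Yv 1) w" for w
          using that assms(1) by (cases w) auto
        let ?W = "insert (Yv 1) (insert (Xv 1) (insert (Xv i) W))"
        show "vanish_G ?W (Suc s) (t - 1)"
        proof (rule iso_rule[of "Yv i"])
          show "w \<in> ?W" if "adj d j (Yv i) w" for w
            using that i by (cases w) auto
          have "vanish_G (insert (Yv i) ?W) (Suc s) (int (card I) + 1)"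
            by (rule vanish_matching[where v = "Yv j"])
              (use insert.prems(1-6) insert.hyps i j assms(1) in auto)
          then show "vanish_G (insert (Yv i) ?W) (Suc s) (t - 1 - 1)"
            by (rule vanish_mono) (use Suc.prems card in simp)
        qed (use i in auto)
      qed (use insert.prems(1-6) j i in auto)
      show "vanish_G (insert (Yv i) W) (Suc s) t"
      proof (rule iso_rule[of "Xv i"])
        show "w \<in> insert (Yv i) W" if "adj d j (Xv i) w" for w using leafX[OF that] by simp
        show "vanish_G (insert (Xv i) (insert (Yv i) W)) (Suc s) (t - 1)"
          by (rule insert.IH) (use insert.prems(1-6) insert.hyps i Suc.prems card in auto)
      qed (use i in auto)
    qed (use i j insert.prems(1-6) in auto)
  qed
qed

end

section \<open>The upper bound and the depth\<close>

definition wdeg :: "'v set \<Rightarrow> 'v monomial \<Rightarrow> nat" where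
  "wdeg C m = (\<Sum>v\<in>C. lookup m v)"

lemma wdeg_add: "wdeg C (m + n) = wdeg C m + wdeg C n"
  by (simp add: wdeg_def lookup_add sum.distrib)

lemma wdeg_sum: "wdeg C (\<Sum>i\<in>I. m i) = (\<Sum>i\<in>I. wdeg C (m i))"
  by (induction I rule: infinite_finite_induct) (simp_all add: wdeg_add, simp_all add: wdeg_def)

lemma wdeg_var: "finite C \<Longrightarrow> wdeg C (var v) = (if v \<in> C then 1 else 0)"
  by (simp add: wdeg_def lookup_single when_def)

text \<open>Each of the \<open>s\<close> edge factors contains a vertex of the cover. Applied to the
  two sides of the bipartition, this is how monomials are kept out of the power.\<close>

lemma le_wdeg_vertex_cover:
  assumes "finite C" "\<And>u v. A u v \<Longrightarrow> u \<in> C \<or> v \<in> C"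
  shows "m \<in> edge_pow A s \<Longrightarrow> s \<le> wdeg C m"
proof (induction s arbitrary: m)
  case (Suc s)
  then obtain u v k where k: "m = var u + var v + k" "A u v" "k \<in> edge_pow A s" by (auto elim: edge_powE)
  then show ?case
    using Suc.IH[of k] assms(2)[OF k(2)] by (auto simp: wdeg_add wdeg_var[OF assms(1)])
qed simp

lemma edge_pow_sum:
  assumes "finite I" "\<And>i. i \<in> I \<Longrightarrow> A (u i) (v i)"
  shows "(\<Sum>i\<in>I. var (u i) + var (v i)) \<in> edge_pow A (card I)"
  using assms
proof (induction I rule: finite_induct)
  case (insert i I)
  then show ?case
    using edge_powI[of A "u i" "v i" "\<Sum>i\<in>I. var (u i) + var (v i)" "card I"] by (simp add: add.assoc)
qed simp

lemma edge_ideal_power_eq: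
  "(edge_ideal (G_verts d) (G_edges d j) :: ((vertex \<Rightarrow>\<^sub>0 nat) \<Rightarrow>\<^sub>0 'k::field) set) [^]\<^bsub>ideals_set (mpoly_ring (G_verts d))\<^esub> s
    = mon_ideal (G_verts d) (edge_pow (adj d j) s)" if j: "1 \<le> j" "j \<le> d"
proof -
  have sub: "e \<subseteq> G_verts d" if "e \<in> G_edges d j" for e
    using G_edges_bipartite[OF j that] by (auto simp: G_verts_def)
  show ?thesis
    by (simp only: edge_ideal_eq_mon_ideal[of "G_edges d j" "G_verts d", OF sub] ideal_power_mon_ideal[OF upset_up_closure] adj_def[symmetric] powset_eq_edge_pow)
qed

lemma killed_pow_empty: "killed_pow A {} s = edge_pow A s"
  by (rule Set.set_eqI) (simp add: killed_pow_iff)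

text \<open>Both bounds meet in \<open>length zs + 1\<close>, where \<open>zs\<close> lists the
  \<open>d - j - r\<close> variables outside \<open>X'\<close>. If \<open>r = d - j\<close>,
  positive depth is all that is claimed from below; otherwise \<open>s - 2 < d - j\<close>, which
  together with the hypothesis for \<open>j = 1\<close> forces \<open>j \<ge> 2\<close>.\<close>

lemma depth_quot_edge_pow:
  fixes d j s :: nat
  assumes "1 \<le> j" and "j \<le> d" and "2 \<le> s" and "j = 1 \<Longrightarrow> d < s"
  shows "int (depth (mpoly_ring (G_verts d) :: ((vertex \<Rightarrow>\<^sub>0 nat) \<Rightarrow>\<^sub>0 'k::field) ring) (max_hom_ideal (G_verts d))
           (quot_module (ring_module (mpoly_ring (G_verts d)))
             (mon_ideal (G_verts d) (edge_pow (adj d j) s))))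
         = max 1 (int d - int j - int s + 3)"
proof -
  let ?V = "G_verts d" and ?A = "adj d j" and ?K = "TYPE('k)"
  define r where "r = min (d - j) (s - 2)"
  define zs where "zs = map Xv [j + r + 1..<d + 1]"
  define us where "us = map Xv [1..<j + r + 1] @ map Yv [1..<d + 1]"
  let ?X = "Xv ` {1..j + r}" and ?Y = "Yv ` {1..d}"
  let ?U = "edge_pow ?A s"
  have r: "r \<le> d - j" "r \<le> s - 2" by (simp_all add: r_def)
  have zs: "set zs = Xv ` {j + r<..d}" "length zs = d - j - r"
    using assms(1,2) r by (auto simp: zs_def)
  have us: "set us = ?X \<union> ?Y" by (auto simp: us_def atLeastLessThanSuc_atLeastAtMost simp flip: atLeastLessThanSuc_atLeastAtMost)
  have V: "set zs \<union> set us = ?V" "set zs \<inter> set us = {}"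
    using assms(1,2) r by (auto simp: zs us G_verts_def image_iff)
  have dist: "distinct (zs @ us)"
    using V(2) by (auto simp: zs_def us_def distinct_map inj_on_def)
  have set_vs: "set (zs @ us) = ?V" using V(1) by simp
  note adj = adj_simps[OF assms(1,2)]
  \<comment> \<open>\<open>y_(h i)\<close> is the partner of \<open>x_1\<close> in factor
    \<open>i\<close> of \<open>f\<close>: the first \<open>r\<close> factors bring in
    \<open>y_(j+1), ..., y_(j+r)\<close>, the others repeat \<open>y_j\<close>. As
    \<open>r \<le> s - 2\<close>, at least one of the \<open>s - 1\<close> factors is of the latter
    kind.\<close>
  define h where "h i = (if i < r then j + 1 + i else j)" for i
  have h: "h i \<in> {1..d}" for i using assms(1,2) r by (auto simp: h_def)
  have ah: "?A (Xv 1) (Yv (h i))" for i using h[of i] assms(1,2) by (simp add: adj)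
  define f where "f = (\<Sum>i<s - 1. var (Xv 1) + var (Yv (h i)))"
  have f_pow: "f \<in> edge_pow ?A (s - 1)"
    unfolding f_def using edge_pow_sum[of "{..<s - 1}" ?A "\<lambda>_. Xv 1" "\<lambda>i. Yv (h i)"] ah by simp
  have f_split: "\<exists>g. f = (var (Xv 1) + var (Yv (h i))) + g \<and> g \<in> edge_pow ?A (s - 2)" if i: "i < s - 1" for i
  proof (intro exI conjI)
    show "f = (var (Xv 1) + var (Yv (h i))) + (\<Sum>i\<in>{..<s - 1} - {i}. var (Xv 1) + var (Yv (h i)))"
      unfolding f_def by (rule sum.remove) (use i in auto)
    have "card ({..<s - 1} - {i}) = s - 2" using i assms(3) by simp
    then show "(\<Sum>i\<in>{..<s - 1} - {i}. var (Xv 1) + var (Yv (h i))) \<in> edge_pow ?A (s - 2)"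
      using edge_pow_sum[of "{..<s - 1} - {i}" ?A "\<lambda>_. Xv 1" "\<lambda>i. Yv (h i)"] ah by simp
  qed
  have coverX: "u \<in> Xv ` {1..d} \<or> v \<in> Xv ` {1..d}" and coverY: "u \<in> ?Y \<or> v \<in> ?Y" if "?A u v" for u v
    using that by (cases u; cases v; auto simp: adj)+
  have degX: "wdeg (Xv ` {1..d}) f = s - 1" and degY: "wdeg ?Y f = s - 1"
    using h assms(1,2) by (auto simp: f_def wdeg_sum wdeg_add wdeg_var image_iff)
  have s2: "Suc (s - 2) = s - 1" "Suc (s - 1) = s" using assms(3) by auto
  have fXY: "f + var x + var y \<in> ?U" if x: "x \<in> ?X" and y: "y \<in> ?Y" for x y
  proof -
    obtain i where i: "x = Xv i" "1 \<le> i" "i \<le> j + r" using x by auto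
    have ay: "?A (Xv 1) y" using y assms(1,2) by (auto simp: adj)
    show ?thesis
    proof (cases "i = 1")
      case True
      have "var (Xv 1) + var y + f \<in> edge_pow ?A (Suc (s - 1))" by (rule edge_powI[OF ay f_pow])
      then show ?thesis unfolding s2 using i True by (simp add: add_ac)
    next
      case False
      \<comment> \<open>Some factor \<open>x_1 y_h\<close> of \<open>f\<close> has
        \<open>y_h\<close> adjacent to \<open>x_i\<close>: the last one, with \<open>h = j\<close>,
        if \<open>i \<le> j\<close>, and number \<open>i - j - 1\<close>, with \<open>h = i\<close>,
        otherwise.\<close>
      have "\<exists>l<s - 1. ?A (Xv i) (Yv (h l))"
      proof (cases "i \<le> j")
        case True
        then show ?thesis using i assms(1-3) r by (intro exI[of _ "s - 2"]) (auto simp: adj h_def)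
      next
        case False
        then show ?thesis using i assms(1-3) r by (intro exI[of _ "i - j - 1"]) (auto simp: adj h_def)
      qed
      then obtain l where l: "l < s - 1" "?A (Xv i) (Yv (h l))" by blast
      obtain g where g: "f = (var (Xv 1) + var (Yv (h l))) + g" "g \<in> edge_pow ?A (s - 2)" using f_split[OF l(1)] by blast
      \<comment> \<open>Although \<open>x_i\<close> and \<open>y\<close> need not be adjacent,
        \<open>x_i (x_1 y_h) y\<close> regroups into the edges \<open>x_i y_h\<close> and
        \<open>x_1 y\<close>.\<close>
      have "var (Xv i) + var (Yv (h l)) + (var (Xv 1) + var y + g) \<in> edge_pow ?A (Suc (Suc (s - 2)))"
        by (intro edge_powI ay l(2) g(2))
      then show ?thesis unfolding s2 using i g(1) by (simp add: add_ac)
    qed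
  qed
  \<comment> \<open>A variable on one side leaves the degree on the other side at
    \<open>s - 1\<close>, too small for \<open>s\<close> edges.\<close>
  have fX: "f + var x \<notin> ?U" if "x \<in> ?X" for x
  proof
    assume "f + var x \<in> ?U"
    then have "s \<le> wdeg ?Y (f + var x)"
      by (intro le_wdeg_vertex_cover[where A = ?A] coverY) auto
    moreover have "x \<notin> ?Y" using that by auto
    ultimately show False using degY assms(3) by (simp add: wdeg_add wdeg_var)
  qed
  have fY: "f + var y \<notin> ?U" if "y \<in> ?Y" for y
  proof
    assume "f + var y \<in> ?U"
    then have "s \<le> wdeg (Xv ` {1..d}) (f + var y)"
      by (intro le_wdeg_vertex_cover[where A = ?A] coverX) auto
    moreover have "y \<notin> Xv ` {1..d}" using that by auto
    ultimately show False using degX assms(3) by (simp add: wdeg_add wdeg_var)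
  qed
  have keys_f: "keys f \<subseteq> set us"
  proof -
    have "keys (\<Sum>i\<in>I. var (Xv 1) + var (Yv (h i))) \<subseteq> set us" if "finite I" for I
      using that
    proof (induction I rule: finite_induct)
      case (insert i I)
      then show ?case using h[of i] assms(1) us by (auto simp: keys_add_nat)
    qed simp
    then show ?thesis unfolding f_def by simp
  qed
  have at: "\<not> koszul_exact_mod ?V (map mvar (zs @ us) :: ((vertex \<Rightarrow>\<^sub>0 nat) \<Rightarrow>\<^sub>0 'k) list) (mon_ideal ?V ?U)
      (int (length zs) + 1)"
    by (rule not_koszul_exact_mod[OF V upset_edge_pow keys_f us _ _ _ fXY fX fY]) (use assms(1,2) in auto)
  have "vanish ?K (zs @ us) (killed_pow ?A {} s) (int (length zs) + 1)"
  proof (cases "d - j \<le> s - 2")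
    case True
    then have "length zs = 0" by (simp add: zs r_def)
    moreover have "vanish ?K (zs @ us) (killed_pow ?A {} s) 1"
      by (rule vanish_one[OF assms(1,2) set_vs, of "Xv 1"]) (use assms(1,2) set_vs in \<open>auto simp: G_verts_def\<close>)
    ultimately show ?thesis by simp
  next
    case False
    then have "j \<noteq> 1" using assms(1-4) by auto
    then have j2: "2 \<le> j" using assms(1) by simp
    show ?thesis
      by (rule vanish_paths[OF assms(1,2) set_vs j2, of "{j<..d}"])
        (use False in \<open>auto simp: zs r_def\<close>)
  qed
  then have below: "koszul_exact_mod ?V (map mvar (zs @ us) :: ((vertex \<Rightarrow>\<^sub>0 nat) \<Rightarrow>\<^sub>0 'k) list) (mon_ideal ?V ?U) (int i)"
    if "i < Suc (length zs)" for i
    unfolding vanish_def killed_pow_empty set_vs using that by simp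
  have "depth (mpoly_ring ?V :: ((vertex \<Rightarrow>\<^sub>0 nat) \<Rightarrow>\<^sub>0 'k) ring) (max_hom_ideal ?V)
           (quot_module (ring_module (mpoly_ring ?V)) (mon_ideal ?V ?U)) = Suc (length zs)"
  proof (rule depth_eqI[OF _ ideal_mon_ideal[OF upset_edge_pow] dist set_vs below])
    show "finite ?V" by (simp add: G_verts_def)
    show "\<not> koszul_exact_mod ?V (map mvar (zs @ us) :: ((vertex \<Rightarrow>\<^sub>0 nat) \<Rightarrow>\<^sub>0 'k) list) (mon_ideal ?V ?U) (int (Suc (length zs)))"
      using at by (simp add: add.commute)
  qed
  then show ?thesis using assms(1-3) by (simp add: zs r_def)
qed

theorem theorem1p4:
  fixes d j s :: nat
    and S :: "((vertex \<Rightarrow>\<^sub>0 nat) \<Rightarrow>\<^sub>0 'k::field) ring"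
  assumes "1 \<le> j" and "j \<le> d" and "2 \<le> s"
    and "j = 1 \<Longrightarrow> d < s"
  defines "S \<equiv> mpoly_ring (G_verts d)"
  shows "int (depth S (max_hom_ideal (G_verts d))
           (quot_module (ring_module S)
             (edge_ideal (G_verts d) (G_edges d j) [^]\<^bsub>ideals_set S\<^esub> s)))
         = max 1 (int d - int j - int s + 3)"
  unfolding S_def edge_ideal_power_eq[OF assms(1,2)] by (rule depth_quot_edge_pow[OF assms(1-4)])

end
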